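(* Let $R$ be a commutative ring annihilated by a prime $p$. Then the square-zero extension $R'$ of $R$ by $R^{(1)}$ corresponding to the cyclic powers elementary extension $$0\to V^{(1)}[1]\xrightarrow{b}C_\bullet(V)\xrightarrow{a}V\to0$$ of $R$ by $R^{(1)}$ is isomorphic to the second Witt vectors ring $W_2(R)$.
   Context: $R^{(1)}$ is the group $R$ considered as an $R$-module via Frobenius, $r\cdot r'=r^pr'$ (and as an $R$-bimodule with equal left and right actions); for an $R$-module $V$, $V^{(1)}=R^{(1)}\otimes_RV$, and $\mathrm{Fr}:V\to V^{(1)}$, $v\mapsto1\otimes v$, is the $R$-linear Frobenius map. Construction of $C_\bullet$: for a finitely generated projective (or flat) $R$-module $V$, let $\sigma$ be the cyclic permutation of order $p$ of $V^{\otimes_Rp}$, and let $\mathrm{tr}=1+\sigma+\dots+\sigma^{p-1}:(V^{\otimes_Rp})_\sigma\to(V^{\otimes_Rp})^\sigma$ be the trace map from coinvariants to invariants. All these are regarded as $R$-modules with $r\in R$ acting by multiplication by $r^p$. Let $\tilde C_\bullet(V)$ be the complex with $\tilde C_1=(V^{\otimes_Rp})_\sigma$, $\tilde C_0=(V^{\otimes_Rp})^\sigma$ and differential $\mathrm{tr}$. It is known that there is a functorial exact sequence $$0\to V^{(1)}\xrightarrow{\psi}(V^{\otimes_Rp})_\sigma\xrightarrow{\mathrm{tr}}(V^{\otimes_Rp})^\sigma\xrightarrow{\hat\psi}V^{(1)}\to0,$$ with $\psi(r\otimes v)=r\,v^{\otimes p}$, and $\hat\psi$ dual to $\psi$ for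 $V$ finitely generated projective (explicitly, $\hat\psi$ kills $\operatorname{Im}\mathrm{tr}$ and sends $r\,v^{\otimes p}$ to $r\otimes v$). Then $C_1(V)=\tilde C_1(V)$, $C_0(V)=\tilde C_0(V)\times_{V^{(1)}}V$ is the fibered product with respect to $\hat\psi$ and $\mathrm{Fr}$, with differential induced by $\mathrm{tr}$; $a:C_0(V)\to V$ is the projection and $b:V^{(1)}\to C_1(V)$ is $\psi$. This gives an exact sequence of functors $0\to V^{(1)}\xrightarrow{b}C_1(V)\xrightarrow{d}C_0(V)\xrightarrow{a}V\to0$, $V\in R\text{-proj}$ (finitely generated projective $R$-modules), i.e. an elementary extension of $R$ by $R^{(1)}$ (an elementary extension of the inclusion functor $\mathsf I:R\text{-proj}\to R\text{-mod}$ by $\mathsf I(R^{(1)}):V\mapsto R^{(1)}\otimes_RV$ in the category of pointed, not necessarily additive, functors). A square-zero extension of $R$ by a bimodule $M$ is a ring $R'$ with an exact sequence $0\to M\xrightarrow{i}R'\xrightarrow{q}R\to0$ of abelian groups, $q$ a unital ring map, $i(m)r'=i(mq(r'))$, $r'i(m)=i(q(r')m)$, $i(m)i(m')=0$. The square-zero extension corresponding to an elementary extension $0\to\mathsf I(M)\xrightarrow{b}C_1\xrightarrow{d}C_0\xrightarrow{a}\mathsf I\to0$ is defined as follows. In the category $\mathcal B(R,\mathbb Z)$ of pointed functors from $R\text{-proj}$ to abelian groups there is a splitting, unique up to isomorphism: a functor $C_{01}$ with maps $c_1:C_1\to C_{01}$ injective, $c_0:C_{01}\to C_0$ surjective, $c_0c_1=d$,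 $\operatorname{Ker}c_0=c_1(b(\mathsf I(M)))$. $R'$ is the ring of endomorphisms $r'$ of $C_{01}\in\mathcal B(R,\mathbb Z)$ for which there is a (unique) $r\in R$ with $c_0r'=rc_0$ and $r'c_1=c_1r$; $q(r')=r$ and $i(m)$ is $x\mapsto c_1(b(m\otimes a(c_0(x))))$. *)

theory Defs
  imports "HOL-Computational_Algebra.Primes" "HOL-Algebra.QuotRing" "HOL-Algebra.Module"
begin

section \<open>Modules\<close>

text \<open>
  A record \<open>M\<close> of type \<open>('a, 'b) module\<close> also has ring fields \<open>mult\<close> and \<open>one\<close>. The locale
  \<^locale>\<open>module\<close> ignores them, and so does everything below. Maps between carriers are
  taken to be \<^const>\<open>extensional\<close>, so that equality of morphisms is equality of functions.
\<close>

definition ab_hom :: "('b, 'x) ring_scheme \<Rightarrow> ('c, 'y) ring_scheme \<Rightarrow> ('b \<Rightarrow> 'c) set" where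
  "ab_hom A B = hom (add_monoid A) (add_monoid B) \<inter> extensional (carrier A)"

definition lin_hom ::
  "('a, 'k) ring_scheme \<Rightarrow> ('a, 'b, 'x) module_scheme \<Rightarrow> ('a, 'c, 'y) module_scheme \<Rightarrow> ('b \<Rightarrow> 'c) set"
  where "lin_hom R M N =
    {f \<in> ab_hom M N. \<forall>r \<in> carrier R. \<forall>x \<in> carrier M. f (r \<odot>\<^bsub>M\<^esub> x) = r \<odot>\<^bsub>N\<^esub> f x}"

definition submodule_hull ::
  "('a, 'k) ring_scheme \<Rightarrow> ('a, 'b, 'x) module_scheme \<Rightarrow> 'b set \<Rightarrow> 'b set" where
  "submodule_hull R M S = \<Inter>{H. submodule H R M \<and> S \<subseteq> H}"

definition quot_module :: "('a, 'b, 'x) module_scheme \<Rightarrow> 'b set \<Rightarrow> ('a, 'b set) module" where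
  "quot_module M N =
    \<lparr>carrier = a_rcosets\<^bsub>M\<^esub> N, mult = undefined, one = undefined,
     zero = N, add = (\<lambda>X Y. X <+>\<^bsub>M\<^esub> Y),
     smult = (\<lambda>r X. \<Union>x\<in>X. N +>\<^bsub>M\<^esub> (r \<odot>\<^bsub>M\<^esub> x))\<rparr>"

text \<open>The ring \<open>R\<close> as a module over itself.\<close>

definition reg_module :: "('a, 'k) ring_scheme \<Rightarrow> ('a, 'a) module" where
  "reg_module R =
    \<lparr>carrier = carrier R, mult = undefined, one = undefined,
     zero = \<zero>\<^bsub>R\<^esub>, add = (\<lambda>x y. x \<oplus>\<^bsub>R\<^esub> y), smult = (\<lambda>r x. r \<otimes>\<^bsub>R\<^esub> x)\<rparr>"

text \<open>The free \<open>R\<close>-module with basis \<open>I\<close>, as finitely supported functions.\<close>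

definition free_module :: "('a, 'k) ring_scheme \<Rightarrow> 'i set \<Rightarrow> ('a, 'i \<Rightarrow> 'a) module" where
  "free_module R I =
    \<lparr>carrier = {f. range f \<subseteq> carrier R \<and> {i. f i \<noteq> \<zero>\<^bsub>R\<^esub>} \<subseteq> I \<and> finite {i. f i \<noteq> \<zero>\<^bsub>R\<^esub>}},
     mult = undefined, one = undefined,
     zero = (\<lambda>_. \<zero>\<^bsub>R\<^esub>), add = (\<lambda>f g i. f i \<oplus>\<^bsub>R\<^esub> g i), smult = (\<lambda>r f i. r \<otimes>\<^bsub>R\<^esub> f i)\<rparr>"

definition basis_elt :: "('a, 'k) ring_scheme \<Rightarrow> 'i \<Rightarrow> 'i \<Rightarrow> 'a" where
  "basis_elt R i = (\<lambda>j. if j = i then \<one>\<^bsub>R\<^esub> else \<zero>\<^bsub>R\<^esub>)"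

text \<open>The linear extension to a free module of a map \<open>g\<close> from the basis to \<open>M\<close>.\<close>

definition lin_ext ::
  "('a, 'k) ring_scheme \<Rightarrow> ('a, 'b, 'x) module_scheme \<Rightarrow> ('i \<Rightarrow> 'b) \<Rightarrow> ('i \<Rightarrow> 'a) \<Rightarrow> 'b" where
  "lin_ext R M g f = (\<Oplus>\<^bsub>M\<^esub>i \<in> {i. f i \<noteq> \<zero>\<^bsub>R\<^esub>}. f i \<odot>\<^bsub>M\<^esub> g i)"

definition finitely_generated :: "('a, 'k) ring_scheme \<Rightarrow> ('a, 'v, 'x) module_scheme \<Rightarrow> bool" where
  "finitely_generated R V \<longleftrightarrow>
    (\<exists>S. finite S \<and> S \<subseteq> carrier V \<and> submodule_hull R V S = carrier V)"

text \<open>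
  Projective modules are the direct summands of free modules. It is no restriction to take the
  basis in the type of elements of \<open>V\<close>, since \<open>V\<close> is a quotient of the free module on its carrier.
\<close>

definition projective :: "('a, 'k) ring_scheme \<Rightarrow> ('a, 'v, 'x) module_scheme \<Rightarrow> bool" where
  "projective R V \<longleftrightarrow>
    (\<exists>I :: 'v set. \<exists>s \<in> lin_hom R V (free_module R I). \<exists>\<pi> \<in> lin_hom R (free_module R I) V.
       \<forall>v \<in> carrier V. \<pi> (s v) = v)"

text \<open>
  The category \<open>R\<close>-proj: objects are the finitely generated projective modules whose carrier lies
  in the type \<open>'v\<close>, morphisms are \<^const>\<open>lin_hom\<close>. As soon as the lists over the carrier of \<open>R\<close>
  embed into \<open>'v\<close>, every finitely generated projective \<open>R\<close>-module is isomorphic to one of these.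
\<close>

definition proj_modules :: "('a, 'k) ring_scheme \<Rightarrow> ('a, 'v) module set" where
  "proj_modules R = {V. module R V \<and> finitely_generated R V \<and> projective R V}"


section \<open>Tensor products and the Frobenius twist\<close>

definition tensor_rels ::
  "('a, 'k) ring_scheme \<Rightarrow> ('a, 'b, 'x) module_scheme \<Rightarrow> ('a, 'c, 'y) module_scheme \<Rightarrow> ('b \<times> 'c \<Rightarrow> 'a) set"
  where "tensor_rels R M N =
    (let F = free_module R (carrier M \<times> carrier N); e = basis_elt R in
     submodule_hull R F
      ({e (x \<oplus>\<^bsub>M\<^esub> x', y) \<ominus>\<^bsub>F\<^esub> (e (x, y) \<oplus>\<^bsub>F\<^esub> e (x', y)) | x x' y.
          x \<in> carrier M \<and> x' \<in> carrier M \<and> y \<in> carrier N} \<union>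
       {e (x, y \<oplus>\<^bsub>N\<^esub> y') \<ominus>\<^bsub>F\<^esub> (e (x, y) \<oplus>\<^bsub>F\<^esub> e (x, y')) | x y y'.
          x \<in> carrier M \<and> y \<in> carrier N \<and> y' \<in> carrier N} \<union>
       {e (r \<odot>\<^bsub>M\<^esub> x, y) \<ominus>\<^bsub>F\<^esub> (r \<odot>\<^bsub>F\<^esub> e (x, y)) | r x y.
          r \<in> carrier R \<and> x \<in> carrier M \<and> y \<in> carrier N} \<union>
       {e (x, r \<odot>\<^bsub>N\<^esub> y) \<ominus>\<^bsub>F\<^esub> (r \<odot>\<^bsub>F\<^esub> e (x, y)) | r x y.
          r \<in> carrier R \<and> x \<in> carrier M \<and> y \<in> carrier N}))"

definition tensor ::
  "('a, 'k) ring_scheme \<Rightarrow> ('a, 'b, 'x) module_scheme \<Rightarrow> ('a, 'c, 'y) module_scheme \<Rightarrow>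
   ('a, ('b \<times> 'c \<Rightarrow> 'a) set) module" where
  "tensor R M N = quot_module (free_module R (carrier M \<times> carrier N)) (tensor_rels R M N)"

definition pure ::
  "('a, 'k) ring_scheme \<Rightarrow> ('a, 'b, 'x) module_scheme \<Rightarrow> ('a, 'c, 'y) module_scheme \<Rightarrow>
   'b \<Rightarrow> 'c \<Rightarrow> ('b \<times> 'c \<Rightarrow> 'a) set" where
  "pure R M N x y =
    tensor_rels R M N +>\<^bsub>free_module R (carrier M \<times> carrier N)\<^esub> basis_elt R (x, y)"

text \<open>The tensor power \<open>V \<otimes> \<dots> \<otimes> V\<close> (\<open>n\<close> factors), with \<open>v\<^sub>1 \<otimes> \<dots> \<otimes> v\<^sub>n\<close> indexed by lists.\<close>

definition words :: "nat \<Rightarrow> ('a, 'v, 'x) module_scheme \<Rightarrow> 'v list set" where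
  "words n V = {vs. length vs = n \<and> set vs \<subseteq> carrier V}"

definition tpower_rels ::
  "('a, 'k) ring_scheme \<Rightarrow> nat \<Rightarrow> ('a, 'v, 'x) module_scheme \<Rightarrow> ('v list \<Rightarrow> 'a) set" where
  "tpower_rels R n V =
    (let F = free_module R (words n V); e = basis_elt R in
     submodule_hull R F
      ({e (vs[i := x \<oplus>\<^bsub>V\<^esub> y]) \<ominus>\<^bsub>F\<^esub> (e (vs[i := x]) \<oplus>\<^bsub>F\<^esub> e (vs[i := y])) | vs i x y.
          vs \<in> words n V \<and> i < n \<and> x \<in> carrier V \<and> y \<in> carrier V} \<union>
       {e (vs[i := r \<odot>\<^bsub>V\<^esub> x]) \<ominus>\<^bsub>F\<^esub> (r \<odot>\<^bsub>F\<^esub> e (vs[i := x])) | r vs i x.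
          r \<in> carrier R \<and> vs \<in> words n V \<and> i < n \<and> x \<in> carrier V}))"

definition tpower ::
  "('a, 'k) ring_scheme \<Rightarrow> nat \<Rightarrow> ('a, 'v, 'x) module_scheme \<Rightarrow> ('a, ('v list \<Rightarrow> 'a) set) module" where
  "tpower R n V = quot_module (free_module R (words n V)) (tpower_rels R n V)"

definition tpure ::
  "('a, 'k) ring_scheme \<Rightarrow> nat \<Rightarrow> ('a, 'v, 'x) module_scheme \<Rightarrow> 'v list \<Rightarrow> ('v list \<Rightarrow> 'a) set" where
  "tpure R n V vs = tpower_rels R n V +>\<^bsub>free_module R (words n V)\<^esub> basis_elt R vs"

text \<open>
  The module \<open>M\<close> with \<open>r\<close> acting as multiplication by \<open>r\<^sup>p\<close>. The left and right actions on the twist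
  \<open>R1\<close> of \<open>R\<close> agree, so \<open>R1 \<otimes> V\<close> is a tensor product of modules over the commutative ring \<open>R\<close>.
\<close>

definition frob ::
  "('a, 'k) ring_scheme \<Rightarrow> nat \<Rightarrow> ('a, 'b, 'x) module_scheme \<Rightarrow> ('a, 'b, 'x) module_scheme" where
  "frob R p M = M\<lparr>smult := (\<lambda>r x. (r [^]\<^bsub>R\<^esub> p) \<odot>\<^bsub>M\<^esub> x)\<rparr>"

definition R1 :: "('a, 'k) ring_scheme \<Rightarrow> nat \<Rightarrow> ('a, 'a) module" where
  "R1 R p = frob R p (reg_module R)"

definition V1 ::
  "('a, 'k) ring_scheme \<Rightarrow> nat \<Rightarrow> ('a, 'v, 'x) module_scheme \<Rightarrow> ('a, ('a \<times> 'v \<Rightarrow> 'a) set) module" where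
  "V1 R p V = tensor R (R1 R p) V"

definition Fr ::
  "('a, 'k) ring_scheme \<Rightarrow> nat \<Rightarrow> ('a, 'v, 'x) module_scheme \<Rightarrow> 'v \<Rightarrow> ('a \<times> 'v \<Rightarrow> 'a) set" where
  "Fr R p V = (\<lambda>v \<in> carrier V. pure R (R1 R p) V \<one>\<^bsub>R\<^esub> v)"


section \<open>The cyclic powers complex\<close>

text \<open>
  Maps out of a quotient are described by a map \<open>h\<close> on representatives which is constant on
  cosets: the coset \<open>X\<close> goes to \<open>the_elem (h ` X)\<close>.
\<close>

definition tpower_map ::
  "('a, 'k) ring_scheme \<Rightarrow> nat \<Rightarrow> ('a, 'v, 'x) module_scheme \<Rightarrow> ('a, 'w, 'y) module_scheme \<Rightarrow>
   ('v \<Rightarrow> 'w) \<Rightarrow> ('v list \<Rightarrow> 'a) set \<Rightarrow> ('w list \<Rightarrow> 'a) set" where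
  "tpower_map R n V W f = (\<lambda>X \<in> carrier (tpower R n V).
     the_elem (lin_ext R (tpower R n W) (\<lambda>vs. tpure R n W (map f vs)) ` X))"

definition cyc ::
  "('a, 'k) ring_scheme \<Rightarrow> nat \<Rightarrow> ('a, 'v, 'x) module_scheme \<Rightarrow>
   ('v list \<Rightarrow> 'a) set \<Rightarrow> ('v list \<Rightarrow> 'a) set" where
  "cyc R n V = (\<lambda>X \<in> carrier (tpower R n V).
     the_elem (lin_ext R (tpower R n V) (\<lambda>vs. tpure R n V (rotate1 vs)) ` X))"

definition cyc_bd ::
  "('a, 'k) ring_scheme \<Rightarrow> nat \<Rightarrow> ('a, 'v, 'x) module_scheme \<Rightarrow> ('v list \<Rightarrow> 'a) set set" where
  "cyc_bd R n V = {cyc R n V x \<ominus>\<^bsub>tpower R n V\<^esub> x | x. x \<in> carrier (tpower R n V)}"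

definition coinv ::
  "('a, 'k) ring_scheme \<Rightarrow> nat \<Rightarrow> ('a, 'v, 'x) module_scheme \<Rightarrow>
   ('a, ('v list \<Rightarrow> 'a) set set) module" where
  "coinv R n V = quot_module (tpower R n V) (cyc_bd R n V)"

definition coinv_class ::
  "('a, 'k) ring_scheme \<Rightarrow> nat \<Rightarrow> ('a, 'v, 'x) module_scheme \<Rightarrow>
   ('v list \<Rightarrow> 'a) set \<Rightarrow> ('v list \<Rightarrow> 'a) set set" where
  "coinv_class R n V x = cyc_bd R n V +>\<^bsub>tpower R n V\<^esub> x"

definition invar ::
  "('a, 'k) ring_scheme \<Rightarrow> nat \<Rightarrow> ('a, 'v, 'x) module_scheme \<Rightarrow>
   ('a, ('v list \<Rightarrow> 'a) set) module" where
  "invar R n V = (tpower R n V)\<lparr>carrier := {x \<in> carrier (tpower R n V). cyc R n V x = x}\<rparr>"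

definition trace ::
  "('a, 'k) ring_scheme \<Rightarrow> nat \<Rightarrow> ('a, 'v, 'x) module_scheme \<Rightarrow>
   ('v list \<Rightarrow> 'a) set set \<Rightarrow> ('v list \<Rightarrow> 'a) set" where
  "trace R n V = (\<lambda>X \<in> carrier (coinv R n V).
     the_elem ((\<lambda>x. \<Oplus>\<^bsub>tpower R n V\<^esub>i \<in> {..<n}. (cyc R n V ^^ i) x) ` X))"

text \<open>The element \<open>r v\<^sup>\<otimes>\<^sup>p\<close> of the tensor power.\<close>

definition scaled_power ::
  "('a, 'k) ring_scheme \<Rightarrow> nat \<Rightarrow> ('a, 'v, 'x) module_scheme \<Rightarrow> 'a \<Rightarrow> 'v \<Rightarrow> ('v list \<Rightarrow> 'a) set" where
  "scaled_power R p V r v = r \<odot>\<^bsub>tpower R p V\<^esub> tpure R p V (replicate p v)"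

definition psi ::
  "('a, 'k) ring_scheme \<Rightarrow> nat \<Rightarrow> ('a, 'v, 'x) module_scheme \<Rightarrow>
   ('a \<times> 'v \<Rightarrow> 'a) set \<Rightarrow> ('v list \<Rightarrow> 'a) set set" where
  "psi R p V = (\<lambda>X \<in> carrier (V1 R p V).
     the_elem (lin_ext R (frob R p (coinv R p V))
       (\<lambda>(r, v). coinv_class R p V (scaled_power R p V r v)) ` X))"

text \<open>
  For projective \<open>V\<close> the module of invariants is generated by the image of the trace and the
  elements \<open>r v\<^sup>\<otimes>\<^sup>p\<close>, so the conditions below determine \<open>psi_hat\<close>.
\<close>

definition psi_hat ::
  "('a, 'k) ring_scheme \<Rightarrow> nat \<Rightarrow> ('a, 'v, 'x) module_scheme \<Rightarrow>
   ('v list \<Rightarrow> 'a) set \<Rightarrow> ('a \<times> 'v \<Rightarrow> 'a) set" where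
  "psi_hat R p V = (THE h. h \<in> lin_hom R (frob R p (invar R p V)) (V1 R p V) \<and>
     (\<forall>X \<in> carrier (coinv R p V). h (trace R p V X) = \<zero>\<^bsub>V1 R p V\<^esub>) \<and>
     (\<forall>r \<in> carrier R. \<forall>v \<in> carrier V.
        h (scaled_power R p V r v) = pure R (R1 R p) V r v))"

definition cycC1 ::
  "('a, 'k) ring_scheme \<Rightarrow> nat \<Rightarrow> ('a, 'v, 'x) module_scheme \<Rightarrow>
   ('a, ('v list \<Rightarrow> 'a) set set) module" where
  "cycC1 R p V = frob R p (coinv R p V)"

text \<open>The fibre product of \<open>psi_hat\<close> and \<open>Fr\<close>.\<close>

definition cycC0 ::
  "('a, 'k) ring_scheme \<Rightarrow> nat \<Rightarrow> ('a, 'v, 'x) module_scheme \<Rightarrow>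
   ('a, ('v list \<Rightarrow> 'a) set \<times> 'v) module" where
  "cycC0 R p V = (let I = frob R p (invar R p V) in
    \<lparr>carrier = {(x, v). x \<in> carrier I \<and> v \<in> carrier V \<and> psi_hat R p V x = Fr R p V v},
     mult = undefined, one = undefined,
     zero = (\<zero>\<^bsub>I\<^esub>, \<zero>\<^bsub>V\<^esub>),
     add = (\<lambda>(x, v) (y, w). (x \<oplus>\<^bsub>I\<^esub> y, v \<oplus>\<^bsub>V\<^esub> w)),
     smult = (\<lambda>r (x, v). (r \<odot>\<^bsub>I\<^esub> x, r \<odot>\<^bsub>V\<^esub> v))\<rparr>)"

definition cycC1_map ::
  "('a, 'k) ring_scheme \<Rightarrow> nat \<Rightarrow> ('a, 'v, 'x) module_scheme \<Rightarrow> ('a, 'w, 'y) module_scheme \<Rightarrow>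
   ('v \<Rightarrow> 'w) \<Rightarrow> ('v list \<Rightarrow> 'a) set set \<Rightarrow> ('w list \<Rightarrow> 'a) set set" where
  "cycC1_map R p V W f = (\<lambda>X \<in> carrier (cycC1 R p V).
     the_elem ((\<lambda>x. coinv_class R p W (tpower_map R p V W f x)) ` X))"

definition cycC0_map ::
  "('a, 'k) ring_scheme \<Rightarrow> nat \<Rightarrow> ('a, 'v, 'x) module_scheme \<Rightarrow> ('a, 'w, 'y) module_scheme \<Rightarrow>
   ('v \<Rightarrow> 'w) \<Rightarrow> ('v list \<Rightarrow> 'a) set \<times> 'v \<Rightarrow> ('w list \<Rightarrow> 'a) set \<times> 'w" where
  "cycC0_map R p V W f = (\<lambda>(x, v) \<in> carrier (cycC0 R p V). (tpower_map R p V W f x, f v))"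


section \<open>Functors on \<open>R\<close>-proj\<close>

text \<open>
  \<open>arr F V W f\<close> is the value of the functor on \<open>f : V \<rightarrow> W\<close>. The values on objects are
  modules or just abelian groups (\<open>'ob\<close> being a module or ring record accordingly).
\<close>

record ('a, 'v, 'ob, 'g) proj_functor =
  obj :: "('a, 'v) module \<Rightarrow> 'ob"
  arr :: "('a, 'v) module \<Rightarrow> ('a, 'v) module \<Rightarrow> ('v \<Rightarrow> 'v) \<Rightarrow> 'g \<Rightarrow> 'g"

text \<open>Objects of the category of pointed functors from \<open>R\<close>-proj to abelian groups.\<close>

definition pointed_functor ::
  "('a, 'k) ring_scheme \<Rightarrow> ('a, 'v, ('g, 'x) ring_scheme, 'g) proj_functor \<Rightarrow> bool" where
  "pointed_functor R F \<longleftrightarrow>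
    (\<forall>V \<in> proj_modules R. abelian_group (obj F V)) \<and>
    (\<forall>V \<in> proj_modules R. \<forall>W \<in> proj_modules R. \<forall>f \<in> lin_hom R V W.
       arr F V W f \<in> ab_hom (obj F V) (obj F W)) \<and>
    (\<forall>V \<in> proj_modules R. arr F V V (\<lambda>v \<in> carrier V. v) = (\<lambda>x \<in> carrier (obj F V). x)) \<and>
    (\<forall>U \<in> proj_modules R. \<forall>V \<in> proj_modules R. \<forall>W \<in> proj_modules R.
       \<forall>f \<in> lin_hom R U V. \<forall>g \<in> lin_hom R V W.
         arr F U W (compose (carrier U) g f) =
         compose (carrier (obj F U)) (arr F V W g) (arr F U V f)) \<and>
    (\<forall>V \<in> proj_modules R. carrier V = {\<zero>\<^bsub>V\<^esub>} \<longrightarrow> carrier (obj F V) = {\<zero>\<^bsub>obj F V\<^esub>})"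

definition nat_trans ::
  "('a, 'k) ring_scheme \<Rightarrow> ('a, 'v, ('g, 'x) ring_scheme, 'g) proj_functor \<Rightarrow>
   ('a, 'v, ('h, 'y) ring_scheme, 'h) proj_functor \<Rightarrow> (('a, 'v) module \<Rightarrow> 'g \<Rightarrow> 'h) set" where
  "nat_trans R F G =
    {t \<in> (\<Pi>\<^sub>E V \<in> proj_modules R. ab_hom (obj F V) (obj G V)).
       \<forall>V \<in> proj_modules R. \<forall>W \<in> proj_modules R. \<forall>f \<in> lin_hom R V W. \<forall>x \<in> carrier (obj F V).
         t W (arr F V W f x) = arr G V W f (t V x)}"


section \<open>The square-zero extension of an elementary extension\<close>

text \<open>
  The data of an elementary extension \<open>0 \<rightarrow> M \<otimes> V \<rightarrow> C\<^sub>1(V) \<rightarrow> C\<^sub>0(V) \<rightarrow> V \<rightarrow> 0\<close> of a commutative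
  ring \<open>R\<close> by an \<open>R\<close>-module \<open>M\<close> (an \<open>R\<close>-bimodule with equal left and right actions).
\<close>

record ('a, 'v, 'm, 'g, 'h) elementary_extension =
  coeff :: "('a, 'm) module"
  C1 :: "('a, 'v, ('a, 'g) module, 'g) proj_functor"
  C0 :: "('a, 'v, ('a, 'h) module, 'h) proj_functor"
  bmap :: "('a, 'v) module \<Rightarrow> ('m \<times> 'v \<Rightarrow> 'a) set \<Rightarrow> 'g"
  dmap :: "('a, 'v) module \<Rightarrow> 'g \<Rightarrow> 'h"
  amap :: "('a, 'v) module \<Rightarrow> 'h \<Rightarrow> 'v"

definition cyclic_powers_ext ::
  "('a, 'k) ring_scheme \<Rightarrow> nat \<Rightarrow>
   ('a, 'v, 'a, ('v list \<Rightarrow> 'a) set set, ('v list \<Rightarrow> 'a) set \<times> 'v) elementary_extension" where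
  "cyclic_powers_ext R p =
    \<lparr>coeff = R1 R p,
     C1 = \<lparr>obj = cycC1 R p, arr = cycC1_map R p\<rparr>,
     C0 = \<lparr>obj = cycC0 R p, arr = cycC0_map R p\<rparr>,
     bmap = psi R p,
     dmap = (\<lambda>V. \<lambda>X \<in> carrier (cycC1 R p V). (trace R p V X, \<zero>\<^bsub>V\<^esub>)),
     amap = (\<lambda>V. \<lambda>(x, v) \<in> carrier (cycC0 R p V). v)\<rparr>"

text \<open>
  A splitting over the integers. It is unique up to isomorphism, so the constructions below are
  made for an arbitrary one.
\<close>

definition splitting ::
  "('a, 'k) ring_scheme \<Rightarrow> ('a, 'v, 'm, 'g, 'h) elementary_extension \<Rightarrow>
   ('a, 'v, ('c, 'x) ring_scheme, 'c) proj_functor \<Rightarrow>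
   (('a, 'v) module \<Rightarrow> 'g \<Rightarrow> 'c) \<Rightarrow> (('a, 'v) module \<Rightarrow> 'c \<Rightarrow> 'h) \<Rightarrow> bool" where
  "splitting R E C01 c1 c0 \<longleftrightarrow>
    pointed_functor R C01 \<and>
    c1 \<in> nat_trans R (C1 E) C01 \<and> c0 \<in> nat_trans R C01 (C0 E) \<and>
    (\<forall>V \<in> proj_modules R.
       inj_on (c1 V) (carrier (obj (C1 E) V)) \<and>
       c0 V ` carrier (obj C01 V) = carrier (obj (C0 E) V) \<and>
       (\<forall>y \<in> carrier (obj (C1 E) V). c0 V (c1 V y) = dmap E V y) \<and>
       a_kernel (obj C01 V) (obj (C0 E) V) (c0 V) =
         c1 V ` bmap E V ` carrier (tensor R (coeff E) V))"

text \<open>The condition \<open>c\<^sub>0 r' = r c\<^sub>0\<close> and \<open>r' c\<^sub>1 = c\<^sub>1 r\<close> relating \<open>r'\<close> to \<open>r\<close>.\<close>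

definition lies_over ::
  "('a, 'k) ring_scheme \<Rightarrow> ('a, 'v, 'm, 'g, 'h) elementary_extension \<Rightarrow>
   ('a, 'v, ('c, 'x) ring_scheme, 'c) proj_functor \<Rightarrow>
   (('a, 'v) module \<Rightarrow> 'g \<Rightarrow> 'c) \<Rightarrow> (('a, 'v) module \<Rightarrow> 'c \<Rightarrow> 'h) \<Rightarrow>
   (('a, 'v) module \<Rightarrow> 'c \<Rightarrow> 'c) \<Rightarrow> 'a \<Rightarrow> bool" where
  "lies_over R E C01 c1 c0 r' r \<longleftrightarrow>
    (\<forall>V \<in> proj_modules R.
       (\<forall>x \<in> carrier (obj C01 V). c0 V (r' V x) = r \<odot>\<^bsub>obj (C0 E) V\<^esub> c0 V x) \<and>
       (\<forall>y \<in> carrier (obj (C1 E) V). r' V (c1 V y) = c1 V (r \<odot>\<^bsub>obj (C1 E) V\<^esub> y)))"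

definition sqz_ring ::
  "('a, 'k) ring_scheme \<Rightarrow> ('a, 'v, 'm, 'g, 'h) elementary_extension \<Rightarrow>
   ('a, 'v, ('c, 'x) ring_scheme, 'c) proj_functor \<Rightarrow>
   (('a, 'v) module \<Rightarrow> 'g \<Rightarrow> 'c) \<Rightarrow> (('a, 'v) module \<Rightarrow> 'c \<Rightarrow> 'h) \<Rightarrow>
   (('a, 'v) module \<Rightarrow> 'c \<Rightarrow> 'c) ring" where
  "sqz_ring R E C01 c1 c0 =
    \<lparr>carrier = {r' \<in> nat_trans R C01 C01. \<exists>r \<in> carrier R. lies_over R E C01 c1 c0 r' r},
     mult = (\<lambda>s t. \<lambda>V \<in> proj_modules R. compose (carrier (obj C01 V)) (s V) (t V)),
     one = (\<lambda>V \<in> proj_modules R. \<lambda>x \<in> carrier (obj C01 V). x),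
     zero = (\<lambda>V \<in> proj_modules R. \<lambda>x \<in> carrier (obj C01 V). \<zero>\<^bsub>obj C01 V\<^esub>),
     add = (\<lambda>s t. \<lambda>V \<in> proj_modules R. \<lambda>x \<in> carrier (obj C01 V). s V x \<oplus>\<^bsub>obj C01 V\<^esub> t V x)\<rparr>"

definition sqz_q ::
  "('a, 'k) ring_scheme \<Rightarrow> ('a, 'v, 'm, 'g, 'h) elementary_extension \<Rightarrow>
   ('a, 'v, ('c, 'x) ring_scheme, 'c) proj_functor \<Rightarrow>
   (('a, 'v) module \<Rightarrow> 'g \<Rightarrow> 'c) \<Rightarrow> (('a, 'v) module \<Rightarrow> 'c \<Rightarrow> 'h) \<Rightarrow>
   (('a, 'v) module \<Rightarrow> 'c \<Rightarrow> 'c) \<Rightarrow> 'a" where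
  "sqz_q R E C01 c1 c0 r' = (THE r. r \<in> carrier R \<and> lies_over R E C01 c1 c0 r' r)"

definition sqz_i ::
  "('a, 'k) ring_scheme \<Rightarrow> ('a, 'v, 'm, 'g, 'h) elementary_extension \<Rightarrow>
   ('a, 'v, ('c, 'x) ring_scheme, 'c) proj_functor \<Rightarrow>
   (('a, 'v) module \<Rightarrow> 'g \<Rightarrow> 'c) \<Rightarrow> (('a, 'v) module \<Rightarrow> 'c \<Rightarrow> 'h) \<Rightarrow>
   'm \<Rightarrow> ('a, 'v) module \<Rightarrow> 'c \<Rightarrow> 'c" where
  "sqz_i R E C01 c1 c0 m =
    (\<lambda>V \<in> proj_modules R. \<lambda>x \<in> carrier (obj C01 V).
       c1 V (bmap E V (pure R (coeff E) V m (amap E V (c0 V x)))))"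

definition square_zero_extension ::
  "('a, 'k) ring_scheme \<Rightarrow> ('a, 'm, 'x) module_scheme \<Rightarrow> ('e, 'y) ring_scheme \<Rightarrow>
   ('m \<Rightarrow> 'e) \<Rightarrow> ('e \<Rightarrow> 'a) \<Rightarrow> bool" where
  "square_zero_extension R M E i q \<longleftrightarrow>
    ring E \<and> i \<in> hom (add_monoid M) (add_monoid E) \<and> q \<in> ring_hom E R \<and>
    inj_on i (carrier M) \<and> a_kernel E R q = i ` carrier M \<and> q ` carrier E = carrier R \<and>
    (\<forall>m \<in> carrier M. \<forall>x \<in> carrier E.
       i m \<otimes>\<^bsub>E\<^esub> x = i (q x \<odot>\<^bsub>M\<^esub> m) \<and> x \<otimes>\<^bsub>E\<^esub> i m = i (q x \<odot>\<^bsub>M\<^esub> m)) \<and>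
    (\<forall>m \<in> carrier M. \<forall>m' \<in> carrier M. i m \<otimes>\<^bsub>E\<^esub> i m' = \<zero>\<^bsub>E\<^esub>)"


section \<open>Witt vectors of length two\<close>

text \<open>
  The \<open>p\<close>-typical Witt vectors \<open>(a\<^sub>0, a\<^sub>1)\<close>, with ghost components \<open>a\<^sub>0\<close> and \<open>a\<^sub>0\<^sup>p + p a\<^sub>1\<close>. The
  second component of a sum is \<open>a\<^sub>1 + b\<^sub>1 + (a\<^sub>0\<^sup>p + b\<^sub>0\<^sup>p - (a\<^sub>0 + b\<^sub>0)\<^sup>p) / p\<close>, expanded so that
  its coefficients are integers.
\<close>

definition witt2 :: "('a, 'k) ring_scheme \<Rightarrow> nat \<Rightarrow> ('a \<times> 'a) ring" where
  "witt2 R p =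
    \<lparr>carrier = carrier R \<times> carrier R,
     mult = (\<lambda>(a0, a1) (b0, b1).
       (a0 \<otimes>\<^bsub>R\<^esub> b0,
        (a0 [^]\<^bsub>R\<^esub> p) \<otimes>\<^bsub>R\<^esub> b1 \<oplus>\<^bsub>R\<^esub> (b0 [^]\<^bsub>R\<^esub> p) \<otimes>\<^bsub>R\<^esub> a1 \<oplus>\<^bsub>R\<^esub> ([p] \<cdot>\<^bsub>R\<^esub> (a1 \<otimes>\<^bsub>R\<^esub> b1)))),
     one = (\<one>\<^bsub>R\<^esub>, \<zero>\<^bsub>R\<^esub>),
     zero = (\<zero>\<^bsub>R\<^esub>, \<zero>\<^bsub>R\<^esub>),
     add = (\<lambda>(a0, a1) (b0, b1).
       (a0 \<oplus>\<^bsub>R\<^esub> b0,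
        (a1 \<oplus>\<^bsub>R\<^esub> b1) \<ominus>\<^bsub>R\<^esub>
          (\<Oplus>\<^bsub>R\<^esub>k \<in> {1..<p}. [((p choose k) div p)] \<cdot>\<^bsub>R\<^esub>
             ((a0 [^]\<^bsub>R\<^esub> k) \<otimes>\<^bsub>R\<^esub> (b0 [^]\<^bsub>R\<^esub> (p - k))))))\<rparr>"

end

theory Submission
  imports Defs
begin

text \<open>
  Write \<open>C01\<close> for a splitting, \<open>U\<close> for \<open>R\<close> viewed as an object of \<open>R\<close>-proj with generator \<open>u\<close>, and choose
  \<open>e \<in> C01(U)\<close> over the element \<open>(u \<otimes> \<dots> \<otimes> u, u)\<close> of \<open>C0(U)\<close>. As in the Yoneda lemma, \<open>e\<close> gives for every
  \<open>v \<in> V\<close> an element \<open>lift V v\<close> of \<open>C01(V)\<close> over \<open>v\<close>, naturally in \<open>V\<close>. On free modules every element of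
  \<open>C01(V)\<close> is a lift plus an element of \<open>c1(C1(V))\<close> (\<open>lift_decomposition\<close>), so that \<open>C01\<close> is described by
  the failure of the lifts to be additive.

  The image in \<open>C0\<close> of \<open>lift (v + w) - lift v - lift w\<close> is \<open>(v + w)\<^sup>p - v\<^sup>p - w\<^sup>p\<close> in the tensor power. This is
  a sum of mixed monomials, which fall into rotation classes of \<open>p\<close> elements; hence it is the trace of
  the sum of one monomial from each class (\<open>tpure_power_add\<close>). So the failure is that sum, up to an
  element of \<open>\<psi>(V1)\<close> that is natural in \<open>v\<close> and \<open>w\<close>. For two free generators such an element is
  \<open>\<psi>(\<xi> \<otimes> x + \<eta> \<otimes> y)\<close>, and it vanishes on both axes because the functors are pointed; as \<open>\<psi>\<close> is injective
  on modules of rank one, \<open>\<xi> = \<eta> = 0\<close> (\<open>defect_zero\<close>).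

  An endomorphism in \<open>R'\<close> over \<open>r\<close> is determined by its value at \<open>e\<close> (\<open>nat_trans_determined\<close>). One of them is
  \<open>[r]\<close>, the functor \<open>C01\<close> applied to multiplication by \<open>r\<close>, and the others are \<open>[r] + i(m)\<close> for a unique
  \<open>m \<in> R\<close> (\<open>elt_surj\<close>, \<open>elt_inject\<close>). In these coordinates \<open>[r]\<close> is multiplicative, \<open>[r] i(n) = i(r\<^sup>p n)\<close> and
  \<open>i(m) [s] = i(s\<^sup>p m)\<close>, which is the multiplication of Witt vectors when \<open>p = 0\<close> in \<open>R\<close>. The sum \<open>[r] + [s]\<close> differs
  from \<open>[r + s]\<close> by the mixed monomials in \<open>r u\<close> and \<open>s u\<close>. For
  \<open>0 < k < p\<close>, exactly \<open>(p choose k) / p\<close> rotation classes contain the first letter \<open>k\<close> times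
  (\<open>card_necklaces\<close>), so that the difference is the Witt vector cocycle (\<open>necklace_sum_rank_one\<close>).

  The input on cyclic powers is the decomposition of an invariant tensor over a free module into
  multiples of the \<open>p\<close>-th powers of the basis elements and a trace (\<open>invariant_decomposition\<close>). It
  provides \<open>\<psi>\<close>-hat on free modules (\<open>psi_hat_eq\<close>), the exactness at \<open>C0\<close> that is needed above
  (\<open>cycC0_trace\<close>), the additivity of \<open>\<psi>\<close> (\<open>psi_bilinear\<close>) and that of Frobenius (\<open>frobenius_add\<close>). For an
  arbitrary object of \<open>R\<close>-proj, the uniqueness of endomorphisms is reduced to a free module of which it
  is a direct summand (\<open>proj_module_retract\<close>).
\<close>

section \<open>Additive and linear maps, generation and quotient modules\<close>

lemma (in abelian_group) minus_eq_zero_iff: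
  assumes "x \<in> carrier G" "y \<in> carrier G"
  shows "x \<ominus> y = \<zero> \<longleftrightarrow> x = y"
proof
  assume "x \<ominus> y = \<zero>"
  then have "\<ominus> (\<ominus> y) = x" using assms by (intro minus_equality) (auto simp: minus_eq)
  then show "x = y" using assms by simp
qed (use assms in \<open>simp add: minus_eq r_neg\<close>)

definition add_map :: "('b, 'x) ring_scheme \<Rightarrow> ('c, 'y) ring_scheme \<Rightarrow> ('b \<Rightarrow> 'c) \<Rightarrow> bool" where
  "add_map A B f \<longleftrightarrow> f \<in> carrier A \<rightarrow> carrier B \<and>
    (\<forall>x\<in>carrier A. \<forall>y\<in>carrier A. f (x \<oplus>\<^bsub>A\<^esub> y) = f x \<oplus>\<^bsub>B\<^esub> f y)"

lemma ab_hom_iff: "f \<in> ab_hom A B \<longleftrightarrow> add_map A B f \<and> f \<in> extensional (carrier A)"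
  by (auto simp: ab_hom_def add_map_def hom_def)

lemma add_map_closed: "add_map A B f \<Longrightarrow> x \<in> carrier A \<Longrightarrow> f x \<in> carrier B"
  by (auto simp: add_map_def)

lemma add_map_add:
  "add_map A B f \<Longrightarrow> x \<in> carrier A \<Longrightarrow> y \<in> carrier A \<Longrightarrow> f (x \<oplus>\<^bsub>A\<^esub> y) = f x \<oplus>\<^bsub>B\<^esub> f y"
  by (auto simp: add_map_def)

context
  fixes A :: "('b, 'x) ring_scheme" and B :: "('c, 'y) ring_scheme" and f
  assumes A: "abelian_group A" and B: "abelian_group B" and f: "add_map A B f"
begin

lemma add_map_group_hom: "abelian_group_hom A B f"
proof -
  interpret A: abelian_group A by (rule A)
  interpret B: abelian_group B by (rule B)
  show ?thesis
    by (rule abelian_group_homI)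
      (use f in \<open>auto simp: A B add_map_def
         intro!: group_hom.intro group_hom_axioms.intro A.a_group B.a_group homI\<close>)
qed

lemma add_map_zero: "f \<zero>\<^bsub>A\<^esub> = \<zero>\<^bsub>B\<^esub>"
  by (rule abelian_group_hom.hom_zero[OF add_map_group_hom])

lemma add_map_neg: "x \<in> carrier A \<Longrightarrow> f (\<ominus>\<^bsub>A\<^esub> x) = \<ominus>\<^bsub>B\<^esub> f x"
  by (rule abelian_group_hom.hom_a_inv[OF add_map_group_hom])

lemma add_map_minus: "x \<in> carrier A \<Longrightarrow> y \<in> carrier A \<Longrightarrow> f (x \<ominus>\<^bsub>A\<^esub> y) = f x \<ominus>\<^bsub>B\<^esub> f y"
proof -
  interpret A: abelian_group A by (rule A)
  show "x \<in> carrier A \<Longrightarrow> y \<in> carrier A \<Longrightarrow> f (x \<ominus>\<^bsub>A\<^esub> y) = f x \<ominus>\<^bsub>B\<^esub> f y"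
    by (simp add: a_minus_def add_map_add[OF f] add_map_neg)
qed

end

text \<open>
  Unlike the morphisms in \<open>lin_hom\<close>, these maps are not required to be extensional, so that composites
  and sums of linear maps are again linear as they stand.
\<close>

definition lin_map ::
  "('a, 'k) ring_scheme \<Rightarrow> ('a, 'b, 'x) module_scheme \<Rightarrow> ('a, 'c, 'y) module_scheme \<Rightarrow> ('b \<Rightarrow> 'c) \<Rightarrow> bool"
  where "lin_map R M N f \<longleftrightarrow>
    f \<in> carrier M \<rightarrow> carrier N \<and>
    (\<forall>x \<in> carrier M. \<forall>y \<in> carrier M. f (x \<oplus>\<^bsub>M\<^esub> y) = f x \<oplus>\<^bsub>N\<^esub> f y) \<and>
    (\<forall>r \<in> carrier R. \<forall>x \<in> carrier M. f (r \<odot>\<^bsub>M\<^esub> x) = r \<odot>\<^bsub>N\<^esub> f x)"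

lemma lin_mapI:
  assumes "\<And>x. x \<in> carrier M \<Longrightarrow> f x \<in> carrier N"
    and "\<And>x y. x \<in> carrier M \<Longrightarrow> y \<in> carrier M \<Longrightarrow> f (x \<oplus>\<^bsub>M\<^esub> y) = f x \<oplus>\<^bsub>N\<^esub> f y"
    and "\<And>r x. r \<in> carrier R \<Longrightarrow> x \<in> carrier M \<Longrightarrow> f (r \<odot>\<^bsub>M\<^esub> x) = r \<odot>\<^bsub>N\<^esub> f x"
  shows "lin_map R M N f"
  using assms by (auto simp: lin_map_def)

lemma lin_map_closed: "lin_map R M N f \<Longrightarrow> x \<in> carrier M \<Longrightarrow> f x \<in> carrier N"
  by (auto simp: lin_map_def)

lemma lin_map_add:
  "lin_map R M N f \<Longrightarrow> x \<in> carrier M \<Longrightarrow> y \<in> carrier M \<Longrightarrow> f (x \<oplus>\<^bsub>M\<^esub> y) = f x \<oplus>\<^bsub>N\<^esub> f y"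
  by (auto simp: lin_map_def)

lemma lin_map_smult:
  "lin_map R M N f \<Longrightarrow> r \<in> carrier R \<Longrightarrow> x \<in> carrier M \<Longrightarrow> f (r \<odot>\<^bsub>M\<^esub> x) = r \<odot>\<^bsub>N\<^esub> f x"
  by (auto simp: lin_map_def)

lemma lin_hom_iff: "f \<in> lin_hom R M N \<longleftrightarrow> lin_map R M N f \<and> f \<in> extensional (carrier M)"
  by (auto simp: lin_hom_def ab_hom_def lin_map_def hom_def)

lemma lin_map_cong:
  assumes "lin_map R M N f" "module R M" "\<And>x. x \<in> carrier M \<Longrightarrow> f x = g x"
  shows "lin_map R M N g"
proof -
  interpret M: module R M by fact
  show ?thesis
    using assms(1) unfolding lin_map_def by (auto simp: assms(3)[symmetric])
qed

lemma lin_map_restrict: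
  "lin_map R M N f \<Longrightarrow> module R M \<Longrightarrow> restrict f (carrier M) \<in> lin_hom R M N"
  by (auto simp: lin_hom_iff intro: lin_map_cong)

lemma lin_map_comp:
  "lin_map R M N f \<Longrightarrow> lin_map R N P g \<Longrightarrow> lin_map R M P (\<lambda>x. g (f x))"
  by (auto simp: lin_map_def Pi_def)

lemma lin_map_add_map: "lin_map R M N f \<Longrightarrow> add_map M N f"
  by (simp add: lin_map_def add_map_def)

context
  fixes R :: "('a, 'k) ring_scheme" and M :: "('a, 'b, 'x) module_scheme" and N :: "('a, 'c, 'y) module_scheme"
    and f
  assumes f: "lin_map R M N f" and M: "module R M" and N: "module R N"
begin

lemma lin_map_zero: "f \<zero>\<^bsub>M\<^esub> = \<zero>\<^bsub>N\<^esub>"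
  by (rule add_map_zero[OF module.axioms(2)[OF M] module.axioms(2)[OF N] lin_map_add_map[OF f]])

lemma lin_map_neg: "x \<in> carrier M \<Longrightarrow> f (\<ominus>\<^bsub>M\<^esub> x) = \<ominus>\<^bsub>N\<^esub> f x"
  by (rule add_map_neg[OF module.axioms(2)[OF M] module.axioms(2)[OF N] lin_map_add_map[OF f]])

lemma lin_map_minus:
  "x \<in> carrier M \<Longrightarrow> y \<in> carrier M \<Longrightarrow> f (x \<ominus>\<^bsub>M\<^esub> y) = f x \<ominus>\<^bsub>N\<^esub> f y"
  by (rule add_map_minus[OF module.axioms(2)[OF M] module.axioms(2)[OF N] lin_map_add_map[OF f]])

end

lemma lin_map_finsum:
  assumes f: "lin_map R M N f" and M: "module R M" and N: "module R N"
    and "finite A" "g \<in> A \<rightarrow> carrier M"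
  shows "f (finsum M g A) = finsum N (\<lambda>i. f (g i)) A"
proof -
  interpret M: module R M by fact
  interpret N: module R N by fact
  show ?thesis
    using assms(4,5)
  proof (induction A)
    case empty
    then show ?case using lin_map_zero[OF f M N] by simp
  next
    case (insert a A)
    then have "g \<in> A \<rightarrow> carrier M" "g a \<in> carrier M" by auto
    moreover have "(\<lambda>i. f (g i)) \<in> A \<rightarrow> carrier N" "f (g a) \<in> carrier N"
      using calculation lin_map_closed[OF f] by auto
    ultimately show ?case
      using insert lin_map_add[OF f] by (simp add: M.finsum_closed)
  qed
qed

context cring
begin

lemma lin_map_sum:
  assumes N: "module R N" and M: "module R M"
    and f: "\<And>i. i \<in> A \<Longrightarrow> lin_map R M N (f i)" and "finite A"
  shows "lin_map R M N (\<lambda>x. finsum N (\<lambda>i. f i x) A)"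
proof -
  interpret M: module R M by fact
  interpret N: module R N by fact
  have cl: "(\<lambda>i. f i x) \<in> A \<rightarrow> carrier N" if "x \<in> carrier M" for x
    using that lin_map_closed[OF f] by auto
  show ?thesis
  proof (rule lin_mapI)
    fix x y assume xy: "x \<in> carrier M" "y \<in> carrier M"
    have "finsum N (\<lambda>i. f i (x \<oplus>\<^bsub>M\<^esub> y)) A = finsum N (\<lambda>i. f i x \<oplus>\<^bsub>N\<^esub> f i y) A"
      by (rule N.finsum_cong') (use xy cl in \<open>auto simp: lin_map_add[OF f] Pi_def\<close>)
    then show "finsum N (\<lambda>i. f i (x \<oplus>\<^bsub>M\<^esub> y)) A = finsum N (\<lambda>i. f i x) A \<oplus>\<^bsub>N\<^esub> finsum N (\<lambda>i. f i y) A"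
      using xy cl by (simp add: N.finsum_addf)
  next
    fix r x assume rx: "r \<in> carrier R" "x \<in> carrier M"
    have "finsum N (\<lambda>i. f i (r \<odot>\<^bsub>M\<^esub> x)) A = finsum N (\<lambda>i. r \<odot>\<^bsub>N\<^esub> f i x) A"
      by (rule N.finsum_cong') (use rx cl in \<open>auto simp: lin_map_smult[OF f] Pi_def\<close>)
    then show "finsum N (\<lambda>i. f i (r \<odot>\<^bsub>M\<^esub> x)) A = r \<odot>\<^bsub>N\<^esub> finsum N (\<lambda>i. f i x) A"
      using rx cl \<open>finite A\<close> by (simp add: N.finsum_smult_ldistr)
  qed (use cl in \<open>auto intro: N.finsum_closed\<close>)
qed

lemma submodule_hull_superset: "S \<subseteq> submodule_hull R M S"
  by (auto simp: submodule_hull_def)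

lemma submodule_hull_least: "submodule H R M \<Longrightarrow> S \<subseteq> H \<Longrightarrow> submodule_hull R M S \<subseteq> H"
  by (auto simp: submodule_hull_def)

lemma submodule_submodule_hull:
  assumes "module R M" "S \<subseteq> carrier M"
  shows "submodule (submodule_hull R M S) R M"
proof -
  interpret M: module R M by fact
  have c: "submodule (carrier M) R M" by (rule M.carrier_is_submodule)
  show ?thesis
  proof (rule M.submoduleI)
    show "submodule_hull R M S \<subseteq> carrier M"
      using c assms(2) by (rule submodule_hull_least)
    show "\<zero>\<^bsub>M\<^esub> \<in> submodule_hull R M S"
      unfolding submodule_hull_def
      by (auto dest!: submodule.axioms(1) subgroup.one_closed)
  qed (auto simp: submodule_hull_def M.submoduleE)
qed

text \<open>
  The elements on which two linear maps agree form a submodule.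
\<close>

lemma lin_map_eq_on_generators:
  assumes M: "module R M" and N: "module R N"
    and f: "lin_map R M N f" and g: "lin_map R M N g"
    and S: "submodule_hull R M S = carrier M" "\<And>x. x \<in> S \<Longrightarrow> f x = g x"
    and x: "x \<in> carrier M"
  shows "f x = g x"
proof -
  interpret M: module R M by fact
  interpret N: module R N by fact
  let ?E = "{x \<in> carrier M. f x = g x}"
  have "submodule ?E R M"
  proof (rule M.submoduleI)
    show "\<zero>\<^bsub>M\<^esub> \<in> ?E" using lin_map_zero[OF f M N] lin_map_zero[OF g M N] by simp
  qed (auto simp: lin_map_add[OF f] lin_map_add[OF g] lin_map_smult[OF f] lin_map_smult[OF g]
      lin_map_neg[OF f M N] lin_map_neg[OF g M N])
  moreover have "S \<subseteq> ?E"
    using S submodule_hull_superset[of S M] by auto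
  ultimately have "submodule_hull R M S \<subseteq> ?E" by (rule submodule_hull_least)
  with S(1) x show ?thesis by auto
qed

lemma submodule_preimage:
  assumes M: "module R M" and N: "module R N" and f: "lin_map R M N f" and H: "submodule H R N"
  shows "submodule {x \<in> carrier M. f x \<in> H} R M"
proof -
  interpret M: module R M by fact
  interpret N: module R N by fact
  show ?thesis
    by (rule M.submoduleI)
      (auto simp: lin_map_zero[OF f M N] lin_map_add[OF f] lin_map_smult[OF f] lin_map_neg[OF f M N]
        N.submoduleE[OF H] subgroup.one_closed[OF submodule.axioms(1)[OF H], simplified])
qed

lemma submodule_image:
  assumes M: "module R M" and N: "module R N" and f: "lin_map R M N f"
  shows "submodule (f ` carrier M) R N"
proof -
  interpret M: module R M by fact
  interpret N: module R N by fact
  show ?thesis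
  proof (rule N.submoduleI)
    show "\<zero>\<^bsub>N\<^esub> \<in> f ` carrier M" using lin_map_zero[OF f M N] by (metis M.zero_closed imageI)
    show "\<ominus>\<^bsub>N\<^esub> a \<in> f ` carrier M" if "a \<in> f ` carrier M" for a
    proof -
      from that obtain x where "x \<in> carrier M" "a = f x" by auto
      then show ?thesis by (auto simp: lin_map_neg[OF f M N, symmetric])
    qed
    show "a \<oplus>\<^bsub>N\<^esub> b \<in> f ` carrier M" if "a \<in> f ` carrier M" "b \<in> f ` carrier M" for a b
      using that by (auto simp: lin_map_add[OF f, symmetric])
    show "a \<odot>\<^bsub>N\<^esub> x \<in> f ` carrier M" if "a \<in> carrier R" "x \<in> f ` carrier M" for a x
      using that by (auto simp: lin_map_smult[OF f, symmetric])
  qed (use lin_map_closed[OF f] in auto)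
qed

lemma submodule_abelian_subgroup:
  assumes M: "module R M" and N: "submodule N R M"
  shows "abelian_subgroup N M"
proof -
  interpret M: module R M by fact
  show ?thesis
    by (rule abelian_subgroupI3)
      (auto intro: additive_subgroup.intro submodule.axioms(1)[OF N] M.abelian_group_axioms)
qed

lemma quot_module_simps:
  "carrier (quot_module M N) = (\<lambda>x. N +>\<^bsub>M\<^esub> x) ` carrier M"
  "\<zero>\<^bsub>quot_module M N\<^esub> = N"
  "X \<oplus>\<^bsub>quot_module M N\<^esub> Y = X <+>\<^bsub>M\<^esub> Y"
  by (auto simp: quot_module_def A_RCOSETS_def')

lemma coset_eq_iff:
  assumes M: "module R M" and N: "submodule N R M" and "x \<in> carrier M" "y \<in> carrier M"
  shows "N +>\<^bsub>M\<^esub> x = N +>\<^bsub>M\<^esub> y \<longleftrightarrow> x \<ominus>\<^bsub>M\<^esub> y \<in> N"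
proof -
  interpret M: module R M by fact
  interpret N: abelian_subgroup N M by (rule submodule_abelian_subgroup) fact+
  show ?thesis
    using N.a_rcos_module[of y x] N.a_rcos_self[of x] N.a_repr_independence'[of x y] assms(3,4)
    by (metis M.minus_eq)
qed

lemma quot_module_smult:
  assumes M: "module R M" and N: "submodule N R M" and "r \<in> carrier R" "x \<in> carrier M"
  shows "r \<odot>\<^bsub>quot_module M N\<^esub> (N +>\<^bsub>M\<^esub> x) = N +>\<^bsub>M\<^esub> (r \<odot>\<^bsub>M\<^esub> x)"
proof -
  interpret M: module R M by fact
  interpret N: abelian_subgroup N M by (rule submodule_abelian_subgroup) fact+
  have "N +>\<^bsub>M\<^esub> (r \<odot>\<^bsub>M\<^esub> y) = N +>\<^bsub>M\<^esub> (r \<odot>\<^bsub>M\<^esub> x)" if y: "y \<in> N +>\<^bsub>M\<^esub> x" for y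
  proof -
    have yc: "y \<in> carrier M" using y assms(4) N.a_elemrcos_carrier by blast
    have "y \<ominus>\<^bsub>M\<^esub> x \<in> N"
      using N.a_rcos_module[of x y] y yc assms(4) by (simp add: M.minus_eq)
    then have "r \<odot>\<^bsub>M\<^esub> (y \<ominus>\<^bsub>M\<^esub> x) \<in> N"
      using M.submoduleE(4)[OF N] assms(3) by blast
    then have "(r \<odot>\<^bsub>M\<^esub> y) \<ominus>\<^bsub>M\<^esub> (r \<odot>\<^bsub>M\<^esub> x) \<in> N"
      using yc assms(3,4) by (simp add: M.minus_eq M.smult_r_distr M.smult_r_minus)
    then show ?thesis
      using coset_eq_iff[OF M N] yc assms(3,4) by simp
  qed
  moreover have "x \<in> N +>\<^bsub>M\<^esub> x" using N.a_rcos_self assms(4) by simp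
  ultimately have "(\<Union>y\<in>N +>\<^bsub>M\<^esub> x. N +>\<^bsub>M\<^esub> (r \<odot>\<^bsub>M\<^esub> y)) = N +>\<^bsub>M\<^esub> (r \<odot>\<^bsub>M\<^esub> x)"
    by (metis (no_types, lifting) SUP_eq_const empty_iff)
  then show ?thesis
    by (simp add: quot_module_def)
qed

lemma quot_class_lin_map:
  assumes M: "module R M" and N: "submodule N R M"
  shows "lin_map R M (quot_module M N) (\<lambda>x. N +>\<^bsub>M\<^esub> x)"
proof -
  interpret M: module R M by fact
  interpret N: abelian_subgroup N M by (rule submodule_abelian_subgroup) fact+
  show ?thesis
  proof (rule lin_mapI)
    fix x y assume "x \<in> carrier M" "y \<in> carrier M"
    then show "N +>\<^bsub>M\<^esub> (x \<oplus>\<^bsub>M\<^esub> y) = (N +>\<^bsub>M\<^esub> x) \<oplus>\<^bsub>quot_module M N\<^esub> (N +>\<^bsub>M\<^esub> y)"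
      unfolding quot_module_simps(3) by (rule N.a_rcos_sum[symmetric])
  qed (simp_all add: quot_module_simps(1) quot_module_smult[OF M N])
qed

lemma module_quot_module:
  assumes M: "module R M" and N: "submodule N R M"
  shows "module R (quot_module M N)" (is "module R ?Q")
proof -
  interpret M: module R M by fact
  interpret N: abelian_subgroup N M by (rule submodule_abelian_subgroup) fact+
  note cl = lin_map_add[OF quot_class_lin_map[OF M N], symmetric]
    lin_map_smult[OF quot_class_lin_map[OF M N], symmetric]
  have z: "\<zero>\<^bsub>?Q\<^esub> = N +>\<^bsub>M\<^esub> \<zero>\<^bsub>M\<^esub>"
    by (simp add: quot_module_simps M.a_coset_add_zero N.a_subset)
  show ?thesis
  proof (rule moduleI)
    show "abelian_group ?Q"
    proof (rule abelian_groupI)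
      fix X assume "X \<in> carrier ?Q"
      then obtain x where "x \<in> carrier M" "X = N +>\<^bsub>M\<^esub> x" by (auto simp: quot_module_simps(1))
      then show "\<exists>Y\<in>carrier ?Q. Y \<oplus>\<^bsub>?Q\<^esub> X = \<zero>\<^bsub>?Q\<^esub>"
        by (intro bexI[of _ "N +>\<^bsub>M\<^esub> (\<ominus>\<^bsub>M\<^esub> x)"])
          (auto simp: cl z M.l_neg quot_module_simps(1))
    qed (auto simp: z cl M.a_ac quot_module_simps(1))
  qed (use is_cring in \<open>auto simp: cl quot_module_simps(1) M.smult_l_distr M.smult_r_distr M.smult_assoc1\<close>)
qed

lemma quot_module_descend:
  assumes M: "module R M" and N: "submodule N R M" and P: "module R P"
    and f: "lin_map R M P f" and kill: "\<And>x. x \<in> N \<Longrightarrow> f x = \<zero>\<^bsub>P\<^esub>"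
  shows "x \<in> carrier M \<Longrightarrow> the_elem (f ` (N +>\<^bsub>M\<^esub> x)) = f x"
    and "lin_map R (quot_module M N) P (\<lambda>X. the_elem (f ` X))"
proof -
  interpret M: module R M by fact
  interpret P: module R P by fact
  interpret N: abelian_subgroup N M by (rule submodule_abelian_subgroup) fact+
  have eq: "the_elem (f ` (N +>\<^bsub>M\<^esub> x)) = f x" if x: "x \<in> carrier M" for x
  proof -
    have "f y = f x" if y: "y \<in> N +>\<^bsub>M\<^esub> x" for y
    proof -
      obtain h where h: "h \<in> N" "y = h \<oplus>\<^bsub>M\<^esub> x" using y by (auto simp: a_r_coset_def')
      then have "h \<in> carrier M" using N.a_subset by auto
      then show ?thesis using h x lin_map_add[OF f] kill[OF h(1)] lin_map_closed[OF f x] by simp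
    qed
    moreover have "x \<in> N +>\<^bsub>M\<^esub> x" using N.a_rcos_self x by simp
    ultimately have "f ` (N +>\<^bsub>M\<^esub> x) = {f x}" by blast
    then show ?thesis by simp
  qed
  show "x \<in> carrier M \<Longrightarrow> the_elem (f ` (N +>\<^bsub>M\<^esub> x)) = f x" by (rule eq)
  note cl = lin_map_add[OF quot_class_lin_map[OF M N], symmetric]
    lin_map_smult[OF quot_class_lin_map[OF M N], symmetric]
  show "lin_map R (quot_module M N) P (\<lambda>X. the_elem (f ` X))"
    by (rule lin_mapI)
      (auto simp: quot_module_simps(1) cl eq lin_map_add[OF f] lin_map_smult[OF f] lin_map_closed[OF f])
qed

lemma quot_class_eq_zero_iff:
  assumes M: "module R M" and N: "submodule N R M" and "x \<in> carrier M"
  shows "N +>\<^bsub>M\<^esub> x = \<zero>\<^bsub>quot_module M N\<^esub> \<longleftrightarrow> x \<in> N"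
proof -
  interpret M: module R M by fact
  interpret N: abelian_subgroup N M by (rule submodule_abelian_subgroup) fact+
  have "N +>\<^bsub>M\<^esub> \<zero>\<^bsub>M\<^esub> = \<zero>\<^bsub>quot_module M N\<^esub>"
    by (simp add: quot_module_simps M.a_coset_add_zero N.a_subset)
  moreover have "x \<ominus>\<^bsub>M\<^esub> \<zero>\<^bsub>M\<^esub> = x"
    using assms(3) by (simp add: M.minus_eq)
  ultimately show ?thesis
    using coset_eq_iff[OF M N assms(3) M.zero_closed] by simp
qed


section \<open>Free modules and modules given by generators and relations\<close>

lemma free_module_simps:
  "f \<in> carrier (free_module R I) \<longleftrightarrow>
    (\<forall>i. f i \<in> carrier R) \<and> (\<forall>i. f i \<noteq> \<zero> \<longrightarrow> i \<in> I) \<and> finite {i. f i \<noteq> \<zero>}"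
  "\<zero>\<^bsub>free_module R I\<^esub> = (\<lambda>_. \<zero>)"
  "f \<oplus>\<^bsub>free_module R I\<^esub> g = (\<lambda>i. f i \<oplus> g i)"
  "r \<odot>\<^bsub>free_module R I\<^esub> f = (\<lambda>i. r \<otimes> f i)"
  by (auto simp: free_module_def)

lemma module_free_module: "module R (free_module R I)" (is "module R ?F")
proof (rule moduleI)
  have fin: "finite {i. f i \<oplus> g i \<noteq> \<zero>}" if "finite {i. f i \<noteq> \<zero>}" "finite {i. g i \<noteq> \<zero>}"
    for f g :: "'c \<Rightarrow> 'a"
    by (rule finite_subset[OF _ finite_UnI[OF that]]) auto
  show "abelian_group ?F"
  proof (rule abelian_groupI)
    fix x assume x: "x \<in> carrier ?F"
    have "finite {i. \<ominus> x i \<noteq> \<zero>}"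
      by (rule finite_subset[of _ "{i. x i \<noteq> \<zero>}"]) (use x in \<open>auto simp: free_module_simps\<close>)
    then show "\<exists>y\<in>carrier ?F. y \<oplus>\<^bsub>?F\<^esub> x = \<zero>\<^bsub>?F\<^esub>"
      using x by (intro bexI[of _ "\<lambda>i. \<ominus> x i"]) (auto simp: free_module_simps l_neg intro: ccontr)
  next
    fix x y assume "x \<in> carrier ?F" "y \<in> carrier ?F"
    then show "x \<oplus>\<^bsub>?F\<^esub> y \<in> carrier ?F"
      by (auto simp: free_module_simps fin) (metis l_zero zero_closed)
  qed (auto simp: free_module_simps a_ac)
next
  fix a x assume a: "a \<in> carrier R" and x: "x \<in> carrier ?F"
  have "finite {i. a \<otimes> x i \<noteq> \<zero>}"
    by (rule finite_subset[of _ "{i. x i \<noteq> \<zero>}"]) (use a x in \<open>auto simp: free_module_simps\<close>)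
  then show "a \<odot>\<^bsub>?F\<^esub> x \<in> carrier ?F"
    using a x by (auto simp: free_module_simps) (metis r_null)
qed (use is_cring in \<open>auto simp: free_module_simps l_distr r_distr m_assoc\<close>)

lemma basis_elt_closed: "i \<in> I \<Longrightarrow> basis_elt R i \<in> carrier (free_module R I)"
  by (auto simp: basis_elt_def free_module_simps)

text \<open>
  By induction on the support, removing one basis element at a time.
\<close>

lemma free_module_generated:
  "submodule_hull R (free_module R I) (basis_elt R ` I) = carrier (free_module R I)"
  (is "?H = carrier ?F")
proof
  interpret F: module R ?F by (rule module_free_module)
  have sub: "submodule ?H R ?F"
    by (rule submodule_submodule_hull[OF module_free_module]) (auto intro: basis_elt_closed)
  show "?H \<subseteq> carrier ?F" by (rule F.submoduleE(1)[OF sub])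
  have "f \<in> ?H" if "finite A" "f \<in> carrier ?F" "{i. f i \<noteq> \<zero>} \<subseteq> A" "A \<subseteq> I" for f A
    using that
  proof (induction A arbitrary: f)
    case empty
    then have "f = \<zero>\<^bsub>?F\<^esub>" by (auto simp: free_module_simps)
    then show ?case using subgroup.one_closed[OF submodule.axioms(1)[OF sub]] by simp
  next
    case (insert a A)
    define g where "g = f(a := \<zero>)"
    have "finite {i. g i \<noteq> \<zero>}"
      by (rule finite_subset[of _ A]) (use insert in \<open>auto simp: g_def\<close>)
    then have "g \<in> ?H"
      using insert.prems by (intro insert.IH) (auto simp: g_def free_module_simps)
    moreover have "f a \<odot>\<^bsub>?F\<^esub> basis_elt R a \<in> ?H"
      using insert.prems submodule_hull_superset[of "basis_elt R ` I" ?F]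
      by (intro F.submoduleE(4)[OF sub]) (auto simp: free_module_simps)
    ultimately have "g \<oplus>\<^bsub>?F\<^esub> f a \<odot>\<^bsub>?F\<^esub> basis_elt R a \<in> ?H"
      by (rule F.submoduleE(5)[OF sub])
    moreover have "g \<oplus>\<^bsub>?F\<^esub> f a \<odot>\<^bsub>?F\<^esub> basis_elt R a = f"
      using insert.prems(1) by (auto simp: g_def free_module_simps basis_elt_def)
    ultimately show ?case by simp
  qed
  then show "carrier ?F \<subseteq> ?H"
    using free_module_simps(1)[of _ I] by (intro subsetI) blast
qed

text \<open>
  With a summation range that may exceed the support, the linear extensions of two functions can be
  added term by term.
\<close>

lemma lin_ext_eq_finsum:
  assumes M: "module R M" and f: "f \<in> carrier (free_module R I)" and g: "g \<in> I \<rightarrow> carrier M"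
    and A: "finite A" "{i. f i \<noteq> \<zero>} \<subseteq> A" "A \<subseteq> I"
  shows "lin_ext R M g f = (\<Oplus>\<^bsub>M\<^esub>i\<in>A. f i \<odot>\<^bsub>M\<^esub> g i)"
proof -
  interpret M: module R M by fact
  show ?thesis
    unfolding lin_ext_def
    by (rule M.add.finprod_mono_neutral_cong_left) (use f g A in \<open>auto simp: free_module_simps Pi_def subset_eq\<close>)
qed

lemma lin_ext_lin_map:
  assumes M: "module R M" and g: "g \<in> I \<rightarrow> carrier M"
  shows "lin_map R (free_module R I) M (lin_ext R M g)"
proof -
  interpret M: module R M by fact
  interpret F: module R "free_module R I" by (rule module_free_module)
  have cl: "(\<lambda>i. x i \<odot>\<^bsub>M\<^esub> g i) \<in> A \<rightarrow> carrier M"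
    if "x \<in> carrier (free_module R I)" "A \<subseteq> I" for x A
    using that g by (auto simp: free_module_simps)
  show ?thesis
  proof (rule lin_mapI)
    fix x assume "x \<in> carrier (free_module R I)"
    then show "lin_ext R M g x \<in> carrier M"
      unfolding lin_ext_def by (intro M.finsum_closed cl) (auto simp: free_module_simps)
  next
    fix x y assume x: "x \<in> carrier (free_module R I)" and y: "y \<in> carrier (free_module R I)"
    let ?A = "{i. x i \<noteq> \<zero>} \<union> {i. y i \<noteq> \<zero>}"
    have A: "finite ?A" "?A \<subseteq> I" using x y by (auto simp: free_module_simps)
    have "lin_ext R M g (x \<oplus>\<^bsub>free_module R I\<^esub> y) = (\<Oplus>\<^bsub>M\<^esub>i\<in>?A. (x i \<oplus> y i) \<odot>\<^bsub>M\<^esub> g i)"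
      by (subst lin_ext_eq_finsum[OF M F.a_closed[OF x y] g A(1) _ A(2)])
        (auto simp: free_module_simps)
    also have "\<dots> = (\<Oplus>\<^bsub>M\<^esub>i\<in>?A. x i \<odot>\<^bsub>M\<^esub> g i \<oplus>\<^bsub>M\<^esub> y i \<odot>\<^bsub>M\<^esub> g i)"
      by (rule M.finsum_cong')
        (use x y g A in \<open>auto simp: free_module_simps M.smult_l_distr Pi_def subset_eq\<close>)
    also have "\<dots> = lin_ext R M g x \<oplus>\<^bsub>M\<^esub> lin_ext R M g y"
      by (subst M.finsum_addf[OF cl cl])
        (use A(2) in \<open>auto simp: x y lin_ext_eq_finsum[OF M x g A(1) _ A(2)] lin_ext_eq_finsum[OF M y g A(1) _ A(2)]\<close>)
    finally show "lin_ext R M g (x \<oplus>\<^bsub>free_module R I\<^esub> y) = lin_ext R M g x \<oplus>\<^bsub>M\<^esub> lin_ext R M g y" .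
  next
    fix r x assume r: "r \<in> carrier R" and x: "x \<in> carrier (free_module R I)"
    let ?A = "{i. x i \<noteq> \<zero>}"
    have A: "finite ?A" "?A \<subseteq> I" using x by (auto simp: free_module_simps)
    have "lin_ext R M g (r \<odot>\<^bsub>free_module R I\<^esub> x) = (\<Oplus>\<^bsub>M\<^esub>i\<in>?A. (r \<otimes> x i) \<odot>\<^bsub>M\<^esub> g i)"
      by (subst lin_ext_eq_finsum[OF M F.smult_closed[OF r x] g A(1) _ A(2)])
        (use r in \<open>auto simp: free_module_simps\<close>)
    also have "\<dots> = (\<Oplus>\<^bsub>M\<^esub>i\<in>?A. r \<odot>\<^bsub>M\<^esub> (x i \<odot>\<^bsub>M\<^esub> g i))"
      by (rule M.finsum_cong')
        (use x g r A in \<open>auto simp: free_module_simps M.smult_assoc1 Pi_def subset_eq\<close>)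
    also have "\<dots> = r \<odot>\<^bsub>M\<^esub> lin_ext R M g x"
      unfolding lin_ext_def by (rule M.finsum_smult_ldistr[symmetric, OF A(1) r cl[OF x A(2)]])
    finally show "lin_ext R M g (r \<odot>\<^bsub>free_module R I\<^esub> x) = r \<odot>\<^bsub>M\<^esub> lin_ext R M g x" .
  qed
qed

lemma lin_ext_basis_elt:
  assumes M: "module R M" and g: "g \<in> I \<rightarrow> carrier M" and i: "i \<in> I"
  shows "lin_ext R M g (basis_elt R i) = g i"
proof -
  interpret M: module R M by fact
  have "g i \<in> carrier M" using g i by auto
  moreover have "lin_ext R M g (basis_elt R i) = (\<Oplus>\<^bsub>M\<^esub>j\<in>{i}. basis_elt R i j \<odot>\<^bsub>M\<^esub> g j)"
    by (rule lin_ext_eq_finsum[OF M basis_elt_closed[OF i] g]) (use i in \<open>auto simp: basis_elt_def\<close>)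
  ultimately show ?thesis by (simp add: basis_elt_def)
qed

text \<open>
  The module with generators \<open>I\<close> and relations \<open>S\<close>. Both the tensor product and the tensor
  powers are of this form.
\<close>

definition presented :: "'i set \<Rightarrow> ('i \<Rightarrow> 'a) set \<Rightarrow> ('a, ('i \<Rightarrow> 'a) set) module" where
  "presented I S = quot_module (free_module R I) (submodule_hull R (free_module R I) S)"

definition gen_class :: "'i set \<Rightarrow> ('i \<Rightarrow> 'a) set \<Rightarrow> 'i \<Rightarrow> ('i \<Rightarrow> 'a) set" where
  "gen_class I S i = submodule_hull R (free_module R I) S +>\<^bsub>free_module R I\<^esub> basis_elt R i"

context
  fixes I :: "'i set" and S :: "('i \<Rightarrow> 'a) set"
  assumes S: "S \<subseteq> carrier (free_module R I)"
begin

lemma module_presented: "module R (presented I S)"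
  unfolding presented_def
  by (rule module_quot_module[OF module_free_module submodule_submodule_hull[OF module_free_module S]])

lemma gen_class_closed: "i \<in> I \<Longrightarrow> gen_class I S i \<in> carrier (presented I S)"
  by (auto simp: presented_def gen_class_def quot_module_simps basis_elt_closed)

lemma presented_class_lin_map:
  "lin_map R (free_module R I) (presented I S)
    (\<lambda>f. submodule_hull R (free_module R I) S +>\<^bsub>free_module R I\<^esub> f)"
  unfolding presented_def
  by (rule quot_class_lin_map[OF module_free_module submodule_submodule_hull[OF module_free_module S]])

lemma presented_class_eq:
  assumes rel: "f \<ominus>\<^bsub>free_module R I\<^esub> g \<in> S"
    and f: "f \<in> carrier (free_module R I)" and g: "g \<in> carrier (free_module R I)"
  shows "submodule_hull R (free_module R I) S +>\<^bsub>free_module R I\<^esub> f =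
    submodule_hull R (free_module R I) S +>\<^bsub>free_module R I\<^esub> g"
  using rel submodule_hull_superset[of S "free_module R I"]
  by (auto simp: coset_eq_iff[OF module_free_module submodule_submodule_hull[OF module_free_module S] f g])

lemma presented_generated:
  "submodule_hull R (presented I S) (gen_class I S ` I) = carrier (presented I S)" (is "?H = _")
proof
  interpret P: module R "presented I S" by (rule module_presented)
  have sub: "submodule ?H R (presented I S)"
    by (rule submodule_submodule_hull[OF module_presented]) (auto intro: gen_class_closed)
  show "?H \<subseteq> carrier (presented I S)" by (rule P.submoduleE(1)[OF sub])
  let ?q = "\<lambda>f. submodule_hull R (free_module R I) S +>\<^bsub>free_module R I\<^esub> f"
  have "submodule_hull R (free_module R I) (basis_elt R ` I) \<subseteq> {f \<in> carrier (free_module R I). ?q f \<in> ?H}"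
    by (rule submodule_hull_least[OF submodule_preimage[OF module_free_module module_presented
      presented_class_lin_map sub]])
      (use submodule_hull_superset[of "gen_class I S ` I" "presented I S"] in
        \<open>auto simp: basis_elt_closed gen_class_def\<close>)
  then show "carrier (presented I S) \<subseteq> ?H"
    unfolding free_module_generated by (auto simp: presented_def quot_module_simps(1))
qed

text \<open>
  The elements killed by the linear extension form a submodule, which contains all consequences of the
  relations as soon as it contains the relations.
\<close>

lemma presented_lift:
  assumes M: "module R M" and g: "g \<in> I \<rightarrow> carrier M"
    and kill: "\<And>f. f \<in> S \<Longrightarrow> lin_ext R M g f = \<zero>\<^bsub>M\<^esub>"
  shows "lin_map R (presented I S) M (\<lambda>X. the_elem (lin_ext R M g ` X))"
    and "i \<in> I \<Longrightarrow> the_elem (lin_ext R M g ` gen_class I S i) = g i"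
proof -
  interpret M: module R M by fact
  let ?H = "submodule_hull R (free_module R I) S"
  have z: "submodule {\<zero>\<^bsub>M\<^esub>} R M" by (rule M.submoduleI) auto
  have "?H \<subseteq> {f \<in> carrier (free_module R I). lin_ext R M g f \<in> {\<zero>\<^bsub>M\<^esub>}}"
    by (rule submodule_hull_least[OF submodule_preimage[OF module_free_module M lin_ext_lin_map[OF M g] z]])
      (use S kill in auto)
  then have kill': "lin_ext R M g f = \<zero>\<^bsub>M\<^esub>" if "f \<in> ?H" for f using that by auto
  note d = quot_module_descend[OF module_free_module submodule_submodule_hull[OF module_free_module S] M
    lin_ext_lin_map[OF M g] kill']
  show "lin_map R (presented I S) M (\<lambda>X. the_elem (lin_ext R M g ` X))"
    unfolding presented_def by (rule d(2))
  show "i \<in> I \<Longrightarrow> the_elem (lin_ext R M g ` gen_class I S i) = g i"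
    unfolding gen_class_def by (simp add: d(1) basis_elt_closed lin_ext_basis_elt[OF M g])
qed

end

end

section \<open>Rotation classes of words of prime length\<close>

definition nonconst_words :: "nat \<Rightarrow> 'i set \<Rightarrow> 'i list set" where
  "nonconst_words p I = {w. length w = p \<and> set w \<subseteq> I \<and> (\<forall>i. w \<noteq> replicate p i)}"

lemma finite_nonconst_words: "finite I \<Longrightarrow> finite (nonconst_words p I)"
  by (rule finite_subset[OF _ finite_lists_length_eq[of I p]]) (auto simp: nonconst_words_def)

lemma rotate1_fixed_imp_const:
  assumes "rotate1 w = w" "w \<noteq> []"
  shows "w = replicate (length w) (hd w)"
proof -
  obtain x xs where w: "w = x # xs" using assms(2) by (cases w) auto
  have "xs @ [x] = x # xs" using assms(1) by (simp add: w)
  then have "\<exists>n. xs = replicate n x"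
  proof (induction xs)
    case (Cons y ys)
    then obtain n where "ys = replicate n x" by auto
    with Cons show ?case by (intro exI[of _ "Suc n"]) auto
  qed auto
  then show ?thesis by (auto simp: w)
qed

lemma rotate_mult_fixed: "rotate d w = w \<Longrightarrow> rotate (k * d) w = w"
  by (induction k) (auto simp: rotate_rotate[symmetric])

text \<open>
  As \<open>d\<close> is prime to \<open>p\<close>, the rotation by one place is a power of the rotation by \<open>d\<close> places.
\<close>

lemma rotate_fixed_imp_const:
  assumes w: "rotate d w = w" and p: "prime p" and "length w = p" and d: "0 < d" "d < p"
  shows "w = replicate p (hd w)"
proof -
  have "gcd d p = 1"
    using d p by (metis coprime_iff_gcd_eq_1 coprime_commute dvd_imp_le not_le prime_imp_coprime)
  with bezout_nat[of d p] d obtain x y where "x * d = p * y + 1"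
    by (metis less_irrefl mult.commute)
  then have "rotate (x * d) w = rotate (1 + p * y) w" by simp
  also have "\<dots> = rotate 1 (rotate (p * y) w)" by (simp only: rotate_rotate)
  also have "rotate (p * y) w = w" using assms(3) by (intro rotate_id) simp
  finally have "rotate (x * d) w = rotate1 w" by simp
  then have "rotate1 w = w" using rotate_mult_fixed[OF w, of x] by simp
  moreover have "w \<noteq> []" using assms(3) p by auto
  ultimately show ?thesis using rotate1_fixed_imp_const[of w] assms(3) by simp
qed

text \<open>A set of representatives of the rotation classes of non-constant words.\<close>

definition necklaces :: "nat \<Rightarrow> 'i set \<Rightarrow> 'i list set" where
  "necklaces p I = (\<lambda>w. SOME v. \<exists>j. v = rotate j w) ` nonconst_words p I"

lemma nonconst_words_rotate:
  assumes "w \<in> nonconst_words p I" shows "rotate j w \<in> nonconst_words p I"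
proof -
  have "rotate j w \<noteq> replicate p i" for i
  proof
    assume "rotate j w = replicate p i"
    then have "set w \<subseteq> {i}" by (metis set_replicate_conv_if set_rotate empty_subsetI order_refl)
    then have "w = replicate (length w) i" by (metis replicate_eqI singletonD subsetD)
    then show False using assms by (auto simp: nonconst_words_def)
  qed
  then show ?thesis using assms by (auto simp: nonconst_words_def)
qed

lemma necklaces_subset: "necklaces p I \<subseteq> nonconst_words p I"
proof
  fix v assume "v \<in> necklaces p I"
  then obtain w where w: "w \<in> nonconst_words p I" "v = (SOME v. \<exists>j. v = rotate j w)"
    by (auto simp: necklaces_def)
  have "\<exists>j. v = rotate j w" unfolding w(2) by (rule someI_ex) blast
  then show "v \<in> nonconst_words p I" using nonconst_words_rotate[OF w(1)] by auto
qed

lemma finite_necklaces: "finite I \<Longrightarrow> finite (necklaces p I)"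
  by (rule finite_subset[OF necklaces_subset finite_nonconst_words])

lemma rotate_eq_imp:
  assumes "rotate i v = rotate j w" and "length v = length w"
  shows "\<exists>k. v = rotate k w"
proof (cases "w = []")
  case False
  let ?n = "length w"
  have "rotate (?n * i) v = v"
    using assms(2) by (intro rotate_id) simp
  moreover have "?n * i - i + i = ?n * i" using False by (cases w) auto
  then have "rotate (?n * i) v = rotate (?n * i - i) (rotate i v)" by (simp add: rotate_rotate)
  ultimately show ?thesis using assms(1) by (metis rotate_rotate)
qed (use assms in auto)

lemma necklaces_eq:
  assumes v: "v \<in> necklaces p I" and w: "w \<in> necklaces p I" and eq: "rotate i v = rotate j w"
  shows "v = w"
proof -
  obtain v' where v': "v' \<in> nonconst_words p I" "v = (SOME u. \<exists>j. u = rotate j v')"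
    using v by (auto simp: necklaces_def)
  obtain w' where w': "w' \<in> nonconst_words p I" "w = (SOME u. \<exists>j. u = rotate j w')"
    using w by (auto simp: necklaces_def)
  have "\<exists>j. v = rotate j v'" "\<exists>j. w = rotate j w'"
    unfolding v'(2) w'(2) by (rule someI_ex; blast)+
  then obtain a b where ab: "v = rotate a v'" "w = rotate b w'" by auto
  have len: "length v' = length w'" using v'(1) w'(1) by (auto simp: nonconst_words_def)
  have *: "rotate (i + a) v' = rotate (j + b) w'" using eq ab by (simp add: rotate_rotate)
  obtain k l where "v' = rotate k w'" "w' = rotate l v'"
    using rotate_eq_imp[OF * len] rotate_eq_imp[OF *[symmetric] len[symmetric]] by auto
  then have "(\<lambda>u. \<exists>j. u = rotate j v') = (\<lambda>u. \<exists>j. u = rotate j w')"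
    by (intro ext) (metis rotate_rotate)
  then show ?thesis using v'(2) w'(2) by simp
qed

lemma rotate_inj_on_nonconst:
  assumes p: "prime p" and w: "w \<in> nonconst_words p I"
  shows "inj_on (\<lambda>j. rotate j w) {..<p}"
proof -
  have len: "length w = p" using w by (simp add: nonconst_words_def)
  have False if "rotate i w = rotate j w" "i < j" "j < p" for i j
  proof -
    have "p - i + i = p" using that by simp
    then have "rotate (p - i) (rotate i w) = rotate p w" by (metis rotate_rotate)
    then have "rotate (p - i) (rotate i w) = w" using len by simp
    moreover have "rotate (p - i) (rotate j w) = rotate (j - i) w"
    proof -
      have "p - i + j = (j - i) + p" using that by simp
      then have "rotate (p - i) (rotate j w) = rotate (j - i) (rotate p w)"
        by (simp add: rotate_rotate)
      then show ?thesis using len by simp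
    qed
    ultimately have "rotate (j - i) w = w" using that by simp
    then have "w = replicate p (hd w)" by (rule rotate_fixed_imp_const[OF _ p len]) (use that in auto)
    then show False using w by (auto simp: nonconst_words_def)
  qed
  then show ?thesis by (metis inj_onI lessThan_iff linorder_neqE_nat)
qed

text \<open>
  Since rotation has order \<open>p\<close> on words of length \<open>p\<close>, the first \<open>p\<close> rotations of a representative exhaust
  its class. For prime \<open>p\<close> they are distinct by the preceding lemma.
\<close>

lemma nonconst_words_eq_UN:
  assumes "p > 0"
  shows "nonconst_words p I = (\<Union>w \<in> necklaces p I. (\<lambda>j. rotate j w) ` {..<p})"
proof
  show "(\<Union>w \<in> necklaces p I. (\<lambda>j. rotate j w) ` {..<p}) \<subseteq> nonconst_words p I"
    using necklaces_subset[of p I] nonconst_words_rotate[of _ p I] by auto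
  show "nonconst_words p I \<subseteq> (\<Union>w \<in> necklaces p I. (\<lambda>j. rotate j w) ` {..<p})"
  proof
    fix w assume w: "w \<in> nonconst_words p I"
    define v where "v = (SOME v. \<exists>j. v = rotate j w)"
    have "\<exists>j. v = rotate j w" unfolding v_def by (rule someI_ex) blast
    then obtain j where "rotate 0 w = w" "v = rotate j w" by auto
    moreover have v: "v \<in> necklaces p I" using w by (auto simp: necklaces_def v_def)
    moreover have len: "length w = p" "length v = p"
      using w v necklaces_subset[of p I] by (auto simp: nonconst_words_def)
    ultimately obtain k where "w = rotate k v" using rotate_eq_imp[of j w 0 v] by auto
    then have "w = rotate (k mod p) v" using len rotate_conv_mod by metis
    then show "w \<in> (\<Union>w \<in> necklaces p I. (\<lambda>j. rotate j w) ` {..<p})"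
      using assms by (intro UN_I[OF v] image_eqI[of _ _ "k mod p"]) auto
  qed
qed

lemma necklace_orbits_disjoint:
  assumes "v \<in> necklaces p I" "w \<in> necklaces p I" "v \<noteq> w"
  shows "(\<lambda>j. rotate j v) ` A \<inter> (\<lambda>j. rotate j w) ` B = {}"
  using necklaces_eq[OF assms(1,2)] assms(3) by auto

lemma necklace_letters:
  assumes "\<epsilon> \<in> necklaces p (UNIV :: bool set)"
  shows "True \<in> set \<epsilon>" "False \<in> set \<epsilon>"
proof -
  have nc: "length \<epsilon> = p" "\<epsilon> \<noteq> replicate p True" "\<epsilon> \<noteq> replicate p False"
    using assms necklaces_subset[of p UNIV] by (auto simp: nonconst_words_def)
  then show "True \<in> set \<epsilon>" "False \<in> set \<epsilon>"
    using replicate_eqI[of \<epsilon> p False] replicate_eqI[of \<epsilon> p True] by (metis (full_types))+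
qed

lemma card_binary_words: "card {w :: bool list. length w = n \<and> card {j. j < n \<and> w ! j} = k} = n choose k"
proof -
  let ?W = "{w :: bool list. length w = n \<and> card {j. j < n \<and> w ! j} = k}"
  have "bij_betw (\<lambda>w. {j. j < n \<and> w ! j}) ?W {A. A \<subseteq> {..<n} \<and> card A = k}"
    (is "bij_betw ?f _ _")
  proof (rule bij_betw_byWitness[of _ "\<lambda>A. map (\<lambda>j. j \<in> A) [0..<n]"])
    have A: "?f (map (\<lambda>j. j \<in> A) [0..<n]) = A" if "A \<subseteq> {..<n}" for A
      using that by auto
    show "\<forall>w\<in>?W. map (\<lambda>j. j \<in> ?f w) [0..<n] = w"
      by (auto intro!: nth_equalityI)
    show "\<forall>A\<in>{A. A \<subseteq> {..<n} \<and> card A = k}. ?f (map (\<lambda>j. j \<in> A) [0..<n]) = A"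
      using A by blast
    show "?f ` ?W \<subseteq> {A. A \<subseteq> {..<n} \<and> card A = k}" by auto
    show "(\<lambda>A. map (\<lambda>j. j \<in> A) [0..<n]) ` {A. A \<subseteq> {..<n} \<and> card A = k} \<subseteq> ?W"
      using A by auto
  qed
  from bij_betw_same_card[OF this] show ?thesis by (simp add: n_subsets)
qed

lemma card_rotate_positions:
  fixes w :: "bool list"
  shows "card {j. j < length w \<and> rotate i w ! j} = card {j. j < length w \<and> w ! j}"
proof -
  have "card {j. j < length v \<and> v ! j} = length (filter (\<lambda>x. x) v)" for v :: "bool list"
    by (simp add: length_filter_conv_card)
  moreover have "length (filter (\<lambda>x. x) (rotate i w)) = length (filter (\<lambda>x. x) w)"
  proof (induction i)
    case (Suc i)
    have "length (filter (\<lambda>x. x) (rotate1 v)) = length (filter (\<lambda>x. x) v)" for v :: "bool list"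
      by (cases v) auto
    then show ?case using Suc by simp
  qed simp
  ultimately show ?thesis by (metis length_rotate)
qed

text \<open>
  All words of a rotation class contain \<open>True\<close> equally often, so the words with \<open>k\<close> letters \<open>True\<close> fall into
  classes of \<open>p\<close> elements.
\<close>

lemma card_necklaces:
  assumes p: "prime p" and k: "0 < k" "k < p"
  shows "card {w \<in> necklaces p (UNIV :: bool set). card {j. j < p \<and> w ! j} = k} = (p choose k) div p"
proof -
  let ?T = "{w \<in> necklaces p (UNIV :: bool set). card {j. j < p \<and> w ! j} = k}"
  have p0: "p > 0" using p by (rule prime_gt_0_nat)
  have len: "length w = p" if "w \<in> necklaces p I" for w :: "'i list" and I
    using that necklaces_subset[of p I] by (auto simp: nonconst_words_def)
  have "{w :: bool list. length w = p \<and> card {j. j < p \<and> w ! j} = k} =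
      {w \<in> nonconst_words p UNIV. card {j. j < p \<and> w ! j} = k}"
  proof -
    have "card {j. j < p \<and> replicate p b ! j} \<noteq> k" for b
      using k by (cases b) (auto cong: conj_cong)
    then show ?thesis unfolding nonconst_words_def by blast
  qed
  also have "\<dots> = (\<Union>w \<in> ?T. (\<lambda>j. rotate j w) ` {..<p})"
  proof -
    have "card {i. i < p \<and> rotate j w ! i} = card {i. i < p \<and> w ! i}"
      if "w \<in> necklaces p UNIV" for w j
      using card_rotate_positions[of w j] len[OF that] by simp
    then show ?thesis unfolding nonconst_words_eq_UN[OF p0] by auto
  qed
  finally have "p choose k = card (\<Union>w \<in> ?T. (\<lambda>j. rotate j w) ` {..<p})"
    using card_binary_words[of p k] by simp
  also have "\<dots> = (\<Sum>w\<in>?T. card ((\<lambda>j. rotate j w) ` {..<p}))"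
  proof (rule card_UN_disjoint)
    show "finite ?T" using finite_necklaces[OF finite[of "UNIV :: bool set"], of p] by auto
    show "\<forall>v\<in>?T. \<forall>w\<in>?T. v \<noteq> w \<longrightarrow>
        (\<lambda>j. rotate j v) ` {..<p} \<inter> (\<lambda>j. rotate j w) ` {..<p} = {}"
      by (intro ballI impI necklace_orbits_disjoint[of _ p UNIV]) auto
  qed simp
  also have "\<dots> = (\<Sum>w\<in>?T. p)"
  proof (rule sum.cong)
    fix w assume "w \<in> ?T"
    then have "w \<in> nonconst_words p UNIV" using necklaces_subset[of p UNIV] by auto
    then show "card ((\<lambda>j. rotate j w) ` {..<p}) = p"
      using card_image[OF rotate_inj_on_nonconst[OF p]] by simp
  qed simp
  finally show ?thesis using p0 by simp
qed

context cring
begin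

section \<open>Tensor products and tensor powers\<close>

definition tensor_relators ::
  "('a, 'm, 'x) module_scheme \<Rightarrow> ('a, 'n, 'y) module_scheme \<Rightarrow> ('m \<times> 'n \<Rightarrow> 'a) set"
  where "tensor_relators M N =
    (let F = free_module R (carrier M \<times> carrier N); e = basis_elt R in
       {e (x \<oplus>\<^bsub>M\<^esub> x', y) \<ominus>\<^bsub>F\<^esub> (e (x, y) \<oplus>\<^bsub>F\<^esub> e (x', y)) | x x' y.
          x \<in> carrier M \<and> x' \<in> carrier M \<and> y \<in> carrier N} \<union>
       {e (x, y \<oplus>\<^bsub>N\<^esub> y') \<ominus>\<^bsub>F\<^esub> (e (x, y) \<oplus>\<^bsub>F\<^esub> e (x, y')) | x y y'.
          x \<in> carrier M \<and> y \<in> carrier N \<and> y' \<in> carrier N} \<union>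
       {e (r \<odot>\<^bsub>M\<^esub> x, y) \<ominus>\<^bsub>F\<^esub> (r \<odot>\<^bsub>F\<^esub> e (x, y)) | r x y.
          r \<in> carrier R \<and> x \<in> carrier M \<and> y \<in> carrier N} \<union>
       {e (x, r \<odot>\<^bsub>N\<^esub> y) \<ominus>\<^bsub>F\<^esub> (r \<odot>\<^bsub>F\<^esub> e (x, y)) | r x y.
          r \<in> carrier R \<and> x \<in> carrier M \<and> y \<in> carrier N})"

lemma tensor_presented: "tensor R M N = presented (carrier M \<times> carrier N) (tensor_relators M N)"
  by (simp add: tensor_def tensor_rels_def tensor_relators_def presented_def Let_def)

lemma pure_gen_class: "pure R M N x y = gen_class (carrier M \<times> carrier N) (tensor_relators M N) (x, y)"
  by (simp add: pure_def tensor_rels_def tensor_relators_def gen_class_def Let_def)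

definition bilinear ::
  "('a, 'm, 'x) module_scheme \<Rightarrow> ('a, 'n, 'y) module_scheme \<Rightarrow> ('a, 'd, 'z) module_scheme \<Rightarrow>
   ('m \<times> 'n \<Rightarrow> 'd) \<Rightarrow> bool" where
  "bilinear M N P g \<longleftrightarrow>
    (\<forall>x \<in> carrier M. lin_map R N P (\<lambda>y. g (x, y))) \<and> (\<forall>y \<in> carrier N. lin_map R M P (\<lambda>x. g (x, y)))"

context
  fixes M :: "('a, 'm, 'x) module_scheme" and N :: "('a, 'n, 'y) module_scheme"
  assumes M: "module R M" and N: "module R N"
begin

lemma tensor_relators_subset: "tensor_relators M N \<subseteq> carrier (free_module R (carrier M \<times> carrier N))"
proof -
  interpret M: module R M by fact
  interpret N: module R N by fact
  interpret F: module R "free_module R (carrier M \<times> carrier N)" by (rule module_free_module)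
  show ?thesis
    unfolding tensor_relators_def Let_def
    by (safe; intro F.minus_closed F.a_closed F.smult_closed basis_elt_closed) auto
qed

lemma module_tensor: "module R (tensor R M N)"
  unfolding tensor_presented by (rule module_presented[OF tensor_relators_subset])

lemma pure_closed: "x \<in> carrier M \<Longrightarrow> y \<in> carrier N \<Longrightarrow> pure R M N x y \<in> carrier (tensor R M N)"
  unfolding tensor_presented pure_gen_class by (rule gen_class_closed[OF tensor_relators_subset]) simp

lemma tensor_generated:
  "submodule_hull R (tensor R M N) ((\<lambda>(x, y). pure R M N x y) ` (carrier M \<times> carrier N)) =
    carrier (tensor R M N)"
  using presented_generated[OF tensor_relators_subset]
  by (simp add: tensor_presented pure_gen_class case_prod_beta cong: image_cong)

lemma pure_bilinear: "bilinear M N (tensor R M N) (\<lambda>(x, y). pure R M N x y)"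
proof -
  interpret M: module R M by fact
  interpret N: module R N by fact
  interpret F: module R "free_module R (carrier M \<times> carrier N)" by (rule module_free_module)
  interpret T: module R "tensor R M N" by (rule module_tensor)
  let ?e = "basis_elt R" and ?F = "free_module R (carrier M \<times> carrier N)"
  let ?q = "\<lambda>f. submodule_hull R ?F (tensor_relators M N) +>\<^bsub>?F\<^esub> f"
  have q: "lin_map R ?F (tensor R M N) ?q"
    unfolding tensor_presented by (rule presented_class_lin_map[OF tensor_relators_subset])
  have pq: "pure R M N x y = ?q (?e (x, y))" for x y
    by (simp add: pure_gen_class gen_class_def)
  have e: "?e (x, y) \<in> carrier ?F" if "x \<in> carrier M" "y \<in> carrier N" for x y
    using that by (intro basis_elt_closed) auto
  note rel = presented_class_eq[OF tensor_relators_subset]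
  have "pure R M N (x \<oplus>\<^bsub>M\<^esub> x') y = pure R M N x y \<oplus>\<^bsub>tensor R M N\<^esub> pure R M N x' y"
    if "x \<in> carrier M" "x' \<in> carrier M" "y \<in> carrier N" for x x' y
    unfolding pq lin_map_add[OF q e[OF that(1,3)] e[OF that(2,3)], symmetric]
    by (rule rel) (use that in \<open>auto simp: tensor_relators_def Let_def e\<close>)
  moreover have "pure R M N x (y \<oplus>\<^bsub>N\<^esub> y') = pure R M N x y \<oplus>\<^bsub>tensor R M N\<^esub> pure R M N x y'"
    if "x \<in> carrier M" "y \<in> carrier N" "y' \<in> carrier N" for x y y'
    unfolding pq lin_map_add[OF q e[OF that(1,2)] e[OF that(1,3)], symmetric]
    by (rule rel) (use that in \<open>auto simp: tensor_relators_def Let_def e\<close>)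
  moreover have "pure R M N (r \<odot>\<^bsub>M\<^esub> x) y = r \<odot>\<^bsub>tensor R M N\<^esub> pure R M N x y"
    if "r \<in> carrier R" "x \<in> carrier M" "y \<in> carrier N" for r x y
    unfolding pq lin_map_smult[OF q that(1) e[OF that(2,3)], symmetric]
    by (rule rel) (use that in \<open>auto simp: tensor_relators_def Let_def e\<close>)
  moreover have "pure R M N x (r \<odot>\<^bsub>N\<^esub> y) = r \<odot>\<^bsub>tensor R M N\<^esub> pure R M N x y"
    if "r \<in> carrier R" "x \<in> carrier M" "y \<in> carrier N" for r x y
    unfolding pq lin_map_smult[OF q that(1) e[OF that(2,3)], symmetric]
    by (rule rel) (use that in \<open>auto simp: tensor_relators_def Let_def e\<close>)
  ultimately show ?thesis
    unfolding bilinear_def by (simp add: lin_map_def pure_closed)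
qed

lemma pure_lin_left: "y \<in> carrier N \<Longrightarrow> lin_map R M (tensor R M N) (\<lambda>x. pure R M N x y)"
  using pure_bilinear by (simp add: bilinear_def)

lemma pure_lin_right: "x \<in> carrier M \<Longrightarrow> lin_map R N (tensor R M N) (pure R M N x)"
  using pure_bilinear by (simp add: bilinear_def)

lemma tensor_lift:
  assumes P: "module R P" and g: "bilinear M N P g"
  shows "lin_map R (tensor R M N) P (\<lambda>X. the_elem (lin_ext R P g ` X))"
    and "x \<in> carrier M \<Longrightarrow> y \<in> carrier N \<Longrightarrow> the_elem (lin_ext R P g ` pure R M N x y) = g (x, y)"
proof -
  interpret M: module R M by fact
  interpret N: module R N by fact
  interpret P: module R P by fact
  let ?e = "basis_elt R" and ?F = "free_module R (carrier M \<times> carrier N)"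
  interpret F: module R ?F by (rule module_free_module)
  have gl: "\<And>x. x \<in> carrier M \<Longrightarrow> lin_map R N P (\<lambda>y. g (x, y))"
    and gr: "\<And>y. y \<in> carrier N \<Longrightarrow> lin_map R M P (\<lambda>x. g (x, y))"
    using g by (auto simp: bilinear_def)
  have g': "g \<in> carrier M \<times> carrier N \<rightarrow> carrier P" using lin_map_closed[OF gl] by auto
  have L: "lin_map R ?F P (lin_ext R P g)" by (rule lin_ext_lin_map[OF P g'])
  have e: "?e (x, y) \<in> carrier ?F" "lin_ext R P g (?e (x, y)) = g (x, y)" "g (x, y) \<in> carrier P"
    if "x \<in> carrier M" "y \<in> carrier N" for x y
    using that lin_ext_basis_elt[OF P g'] g' by (auto intro: basis_elt_closed)
  note rules = lin_map_minus[OF L module_free_module P] lin_map_add[OF L] lin_map_smult[OF L] e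
    lin_map_add[OF gl] lin_map_add[OF gr] lin_map_smult[OF gl] lin_map_smult[OF gr]
  have kill: "lin_ext R P g f = \<zero>\<^bsub>P\<^esub>" if "f \<in> tensor_relators M N" for f
    using that unfolding tensor_relators_def Let_def by (auto simp: rules P.r_neg P.minus_eq)
  show "lin_map R (tensor R M N) P (\<lambda>X. the_elem (lin_ext R P g ` X))"
    unfolding tensor_presented by (rule presented_lift(1)[OF tensor_relators_subset P g' kill])
  show "x \<in> carrier M \<Longrightarrow> y \<in> carrier N \<Longrightarrow> the_elem (lin_ext R P g ` pure R M N x y) = g (x, y)"
    unfolding pure_gen_class by (rule presented_lift(2)[OF tensor_relators_subset P g' kill]) auto
qed

end

text \<open>
  Position \<open>i\<close> is varied by overwriting it, as in the relations that define the tensor power.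
\<close>

definition multilinear ::
  "nat \<Rightarrow> ('a, 'v, 'x) module_scheme \<Rightarrow> ('a, 'm, 'y) module_scheme \<Rightarrow> ('v list \<Rightarrow> 'm) \<Rightarrow> bool" where
  "multilinear n V M g \<longleftrightarrow> g \<in> words n V \<rightarrow> carrier M \<and>
    (\<forall>vs \<in> words n V. \<forall>i<n. lin_map R V M (\<lambda>x. g (vs[i := x])))"

lemma multilinear_closed: "multilinear n V M g \<Longrightarrow> vs \<in> words n V \<Longrightarrow> g vs \<in> carrier M"
  by (auto simp: multilinear_def)

lemma multilinear_lin_map:
  "multilinear n V M g \<Longrightarrow> vs \<in> words n V \<Longrightarrow> i < n \<Longrightarrow> lin_map R V M (\<lambda>x. g (vs[i := x]))"
  by (auto simp: multilinear_def)

lemma words_update: "vs \<in> words n V \<Longrightarrow> x \<in> carrier V \<Longrightarrow> vs[i := x] \<in> words n V"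
  using set_update_subset_insert[of vs i x] by (auto simp: words_def)

lemma words_nth: "vs \<in> words n V \<Longrightarrow> i < n \<Longrightarrow> vs ! i \<in> carrier V"
  by (auto simp: words_def subset_eq)

lemma words_replicate: "x \<in> carrier V \<Longrightarrow> replicate n x \<in> words n V"
  by (auto simp: words_def)

lemma words_map: "vs \<in> words n V \<Longrightarrow> f \<in> carrier V \<rightarrow> carrier W \<Longrightarrow> map f vs \<in> words n W"
  by (auto simp: words_def)

lemma words_rotate1: "vs \<in> words n V \<Longrightarrow> rotate1 vs \<in> words n V"
  by (auto simp: words_def)

lemma words_rotate: "vs \<in> words n V \<Longrightarrow> rotate i vs \<in> words n V"
  by (auto simp: words_def)

lemma multilinear_comp:
  "multilinear n V M g \<Longrightarrow> lin_map R M N f \<Longrightarrow> multilinear n V N (\<lambda>vs. f (g vs))"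
  unfolding multilinear_def
  by (blast intro: lin_map_closed lin_map_comp[of R V M "\<lambda>x. g (_[_ := x])"])

lemma multilinear_map:
  assumes "multilinear n W M g" "lin_map R V W f"
  shows "multilinear n V M (\<lambda>vs. g (map f vs))"
proof -
  have f: "f \<in> carrier V \<rightarrow> carrier W" using lin_map_closed[OF assms(2)] by auto
  show ?thesis
    unfolding multilinear_def
    using multilinear_closed[OF assms(1) words_map[OF _ f]]
      lin_map_comp[OF assms(2) multilinear_lin_map[OF assms(1) words_map[OF _ f]]]
    by (auto simp: map_update)
qed

text \<open>
  Rotation moves position \<open>i\<close> to position \<open>i - 1\<close> modulo the length.
\<close>

lemma rotate1_update:
  assumes "i < length vs"
  shows "rotate1 (vs[i := x]) = (rotate1 vs)[(i + length vs - 1) mod length vs := x]"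
proof (rule nth_equalityI)
  fix j assume "j < length (rotate1 (vs[i := x]))"
  then have j: "j < length vs" by simp
  have "(Suc j mod length vs = i) = (j = (i + length vs - 1) mod length vs)"
  proof (cases "i = 0")
    case True
    then show ?thesis using j assms by (cases "Suc j = length vs") auto
  next
    case False
    then have "(i + length vs - 1) mod length vs = i - 1"
      using assms by (simp add: mod_if)
    then show ?thesis using j assms False by (cases "Suc j = length vs") auto
  qed
  moreover have "Suc j mod length vs < length vs" using j by (intro mod_less_divisor) auto
  ultimately show "rotate1 (vs[i := x]) ! j = (rotate1 vs)[(i + length vs - 1) mod length vs := x] ! j"
    using j by (auto simp: nth_rotate1 nth_list_update)
qed simp

lemma multilinear_rotate1:
  assumes "multilinear n V M g"
  shows "multilinear n V M (\<lambda>vs. g (rotate1 vs))"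
  unfolding multilinear_def
proof (intro conjI ballI allI impI)
  show "(\<lambda>vs. g (rotate1 vs)) \<in> words n V \<rightarrow> carrier M"
    using multilinear_closed[OF assms words_rotate1] by auto
  fix vs i assume vs: "vs \<in> words n V" and i: "i < n"
  then have "length vs = n" by (simp add: words_def)
  then show "lin_map R V M (\<lambda>x. g (rotate1 (vs[i := x])))"
    using multilinear_lin_map[OF assms words_rotate1[OF vs], of "(i + n - 1) mod n"] i
    by (simp add: rotate1_update)
qed

text \<open>
  The letters outside the generating set are removed one position at a time, each time by linearity
  in that position.
\<close>

lemma multilinear_eq_on_generators:
  assumes V: "module R V" and M: "module R M"
    and f: "multilinear n V M f" and g: "multilinear n V M g"
    and B: "submodule_hull R V B = carrier V"
    and eq: "\<And>vs. vs \<in> words n V \<Longrightarrow> set vs \<subseteq> B \<Longrightarrow> f vs = g vs"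
    and vs: "vs \<in> words n V"
  shows "f vs = g vs"
proof -
  have BV: "B \<subseteq> carrier V" using B submodule_hull_superset[of B V] by simp
  have "\<forall>vs \<in> words n V. (\<forall>j. k \<le> j \<longrightarrow> j < n \<longrightarrow> vs ! j \<in> B) \<longrightarrow> f vs = g vs" if "k \<le> n" for k
    using that
  proof (induction k)
    case 0
    then show ?case using eq by (auto simp: words_def set_conv_nth)
  next
    case (Suc k)
    show ?case
    proof (intro ballI impI)
      fix vs assume vs: "vs \<in> words n V" and gen: "\<forall>j. Suc k \<le> j \<longrightarrow> j < n \<longrightarrow> vs ! j \<in> B"
      have k: "k < n" and len: "length vs = n" using Suc.prems vs by (auto simp: words_def)
      have "f (vs[k := x]) = g (vs[k := x])" if "x \<in> B" for x
      proof -
        have "vs[k := x] ! j \<in> B" if "k \<le> j" "j < n" for j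
          using gen that \<open>x \<in> B\<close> len by (cases "j = k") auto
        then show ?thesis using Suc words_update[OF vs] that BV by auto
      qed
      then have "f (vs[k := vs ! k]) = g (vs[k := vs ! k])"
        by (rule lin_map_eq_on_generators[OF V M multilinear_lin_map[OF f vs k]
            multilinear_lin_map[OF g vs k] B _ words_nth[OF vs k]])
      then show "f vs = g vs" by simp
    qed
  qed
  from this[of n] vs show ?thesis by simp
qed

definition tpower_relators :: "nat \<Rightarrow> ('a, 'v, 'x) module_scheme \<Rightarrow> ('v list \<Rightarrow> 'a) set" where
  "tpower_relators n V =
    (let F = free_module R (words n V); e = basis_elt R in
      {e (vs[i := x \<oplus>\<^bsub>V\<^esub> y]) \<ominus>\<^bsub>F\<^esub> (e (vs[i := x]) \<oplus>\<^bsub>F\<^esub> e (vs[i := y])) | vs i x y.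
          vs \<in> words n V \<and> i < n \<and> x \<in> carrier V \<and> y \<in> carrier V} \<union>
       {e (vs[i := r \<odot>\<^bsub>V\<^esub> x]) \<ominus>\<^bsub>F\<^esub> (r \<odot>\<^bsub>F\<^esub> e (vs[i := x])) | r vs i x.
          r \<in> carrier R \<and> vs \<in> words n V \<and> i < n \<and> x \<in> carrier V})"

lemma tpower_presented: "tpower R n V = presented (words n V) (tpower_relators n V)"
  by (simp add: tpower_def tpower_rels_def tpower_relators_def presented_def Let_def)

lemma tpure_gen_class: "tpure R n V vs = gen_class (words n V) (tpower_relators n V) vs"
  by (simp add: tpure_def tpower_rels_def tpower_relators_def gen_class_def Let_def)

context
  fixes V :: "('a, 'v, 'x) module_scheme" and n :: nat
  assumes V: "module R V"
begin

lemma tpower_relators_subset: "tpower_relators n V \<subseteq> carrier (free_module R (words n V))"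
proof -
  interpret V: module R V by fact
  interpret F: module R "free_module R (words n V)" by (rule module_free_module)
  show ?thesis
    unfolding tpower_relators_def Let_def
    by (safe; intro F.minus_closed F.a_closed F.smult_closed basis_elt_closed words_update) auto
qed

lemma module_tpower: "module R (tpower R n V)"
  unfolding tpower_presented by (rule module_presented[OF tpower_relators_subset])

lemma tpure_closed: "vs \<in> words n V \<Longrightarrow> tpure R n V vs \<in> carrier (tpower R n V)"
  unfolding tpower_presented tpure_gen_class by (rule gen_class_closed[OF tpower_relators_subset]) simp

lemma tpower_generated:
  "submodule_hull R (tpower R n V) (tpure R n V ` words n V) = carrier (tpower R n V)"
  using presented_generated[OF tpower_relators_subset]
  by (simp add: tpower_presented tpure_gen_class cong: image_cong)

lemma tpure_multilinear: "multilinear n V (tpower R n V) (tpure R n V)"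
proof -
  interpret V: module R V by fact
  let ?e = "basis_elt R" and ?F = "free_module R (words n V)"
  interpret F: module R ?F by (rule module_free_module)
  interpret T: module R "tpower R n V" by (rule module_tpower)
  let ?q = "\<lambda>f. submodule_hull R ?F (tpower_relators n V) +>\<^bsub>?F\<^esub> f"
  have q: "lin_map R ?F (tpower R n V) ?q"
    unfolding tpower_presented by (rule presented_class_lin_map[OF tpower_relators_subset])
  have pq: "tpure R n V vs = ?q (?e vs)" for vs
    by (simp add: tpure_gen_class gen_class_def)
  have e: "?e (vs[i := x]) \<in> carrier ?F" if "vs \<in> words n V" "x \<in> carrier V" for vs i x
    using that by (intro basis_elt_closed words_update)
  note rel = presented_class_eq[OF tpower_relators_subset]
  have "tpure R n V (vs[i := x \<oplus>\<^bsub>V\<^esub> y]) =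
      tpure R n V (vs[i := x]) \<oplus>\<^bsub>tpower R n V\<^esub> tpure R n V (vs[i := y])"
    if "vs \<in> words n V" "i < n" "x \<in> carrier V" "y \<in> carrier V" for vs i x y
    unfolding pq lin_map_add[OF q e[OF that(1,3)] e[OF that(1,4)], symmetric]
    by (rule rel) (use that in \<open>auto simp: tpower_relators_def Let_def e\<close>)
  moreover have "tpure R n V (vs[i := r \<odot>\<^bsub>V\<^esub> x]) = r \<odot>\<^bsub>tpower R n V\<^esub> tpure R n V (vs[i := x])"
    if "vs \<in> words n V" "i < n" "r \<in> carrier R" "x \<in> carrier V" for vs i r x
    unfolding pq lin_map_smult[OF q that(3) e[OF that(1,4)], symmetric]
    by (rule rel) (use that in \<open>auto simp: tpower_relators_def Let_def e\<close>)
  ultimately show ?thesis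
    unfolding multilinear_def by (auto simp: lin_map_def tpure_closed words_update)
qed

lemma tpower_lift:
  assumes M: "module R M" and g: "multilinear n V M g"
  shows "lin_map R (tpower R n V) M (\<lambda>X. the_elem (lin_ext R M g ` X))"
    and "vs \<in> words n V \<Longrightarrow> the_elem (lin_ext R M g ` tpure R n V vs) = g vs"
proof -
  interpret V: module R V by fact
  interpret M: module R M by fact
  let ?e = "basis_elt R" and ?F = "free_module R (words n V)"
  interpret F: module R ?F by (rule module_free_module)
  have g': "g \<in> words n V \<rightarrow> carrier M" using multilinear_closed[OF g] by auto
  have L: "lin_map R ?F M (lin_ext R M g)" by (rule lin_ext_lin_map[OF M g'])
  have e: "?e (vs[i := x]) \<in> carrier ?F" "lin_ext R M g (?e (vs[i := x])) = g (vs[i := x])"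
    "g (vs[i := x]) \<in> carrier M"
    if "vs \<in> words n V" "x \<in> carrier V" for vs i x
    using words_update[OF that] lin_ext_basis_elt[OF M g'] g' by (auto intro: basis_elt_closed)
  note rules = lin_map_minus[OF L module_free_module M] lin_map_add[OF L] lin_map_smult[OF L] e
    lin_map_add[OF multilinear_lin_map[OF g]] lin_map_smult[OF multilinear_lin_map[OF g]]
  have kill: "lin_ext R M g f = \<zero>\<^bsub>M\<^esub>" if "f \<in> tpower_relators n V" for f
    using that unfolding tpower_relators_def Let_def by (auto simp: rules M.r_neg M.minus_eq)
  show "lin_map R (tpower R n V) M (\<lambda>X. the_elem (lin_ext R M g ` X))"
    unfolding tpower_presented by (rule presented_lift(1)[OF tpower_relators_subset M g' kill])
  show "vs \<in> words n V \<Longrightarrow> the_elem (lin_ext R M g ` tpure R n V vs) = g vs"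
    unfolding tpure_gen_class by (rule presented_lift(2)[OF tpower_relators_subset M g' kill])
qed

lemma tpower_lin_map_eq:
  assumes M: "module R M" and f: "lin_map R (tpower R n V) M f" and g: "lin_map R (tpower R n V) M g"
    and B: "submodule_hull R V B = carrier V"
    and eq: "\<And>vs. vs \<in> words n V \<Longrightarrow> set vs \<subseteq> B \<Longrightarrow> f (tpure R n V vs) = g (tpure R n V vs)"
    and t: "t \<in> carrier (tpower R n V)"
  shows "f t = g t"
proof (rule lin_map_eq_on_generators[OF module_tpower M f g tpower_generated _ t])
  fix x assume "x \<in> tpure R n V ` words n V"
  then obtain vs where vs: "vs \<in> words n V" and x: "x = tpure R n V vs" by auto
  show "f x = g x"
    unfolding x
    by (rule multilinear_eq_on_generators[OF V M multilinear_comp[OF tpure_multilinear f]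
        multilinear_comp[OF tpure_multilinear g] B eq vs])
qed

text \<open>
  The scalar is taken out of one position after the other.
\<close>

lemma tpure_smult_all:
  assumes r: "r \<in> carrier R" and vs: "vs \<in> words n V"
  shows "tpure R n V (map (\<lambda>x. r \<odot>\<^bsub>V\<^esub> x) vs) = (r [^] n) \<odot>\<^bsub>tpower R n V\<^esub> tpure R n V vs"
proof -
  interpret V: module R V by fact
  interpret T: module R "tpower R n V" by (rule module_tpower)
  let ?m = "\<lambda>k. map (\<lambda>x. r \<odot>\<^bsub>V\<^esub> x) (take k vs) @ drop k vs"
  have len: "length vs = n" and sub: "set vs \<subseteq> carrier V" using vs by (auto simp: words_def)
  have "tpure R n V (?m k) = (r [^] k) \<odot>\<^bsub>tpower R n V\<^esub> tpure R n V vs" if "k \<le> n" for k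
    using that
  proof (induction k)
    case 0
    then show ?case using vs by (simp add: tpure_closed)
  next
    case (Suc k)
    then have k: "k < n" by simp
    have w: "?m k \<in> words n V"
      using len sub k r by (auto simp: words_def dest: in_set_takeD in_set_dropD)
    have mk: "?m k = (?m k)[k := vs ! k]"
      using k len by (simp add: list_update_append Cons_nth_drop_Suc[symmetric] min_def)
    have "?m (Suc k) = (?m k)[k := r \<odot>\<^bsub>V\<^esub> (vs ! k)]"
      using k len by (simp add: list_update_append Cons_nth_drop_Suc[symmetric] take_Suc_conv_app_nth min_def)
    then have "tpure R n V (?m (Suc k)) = r \<odot>\<^bsub>tpower R n V\<^esub> tpure R n V (?m k)"
      using lin_map_smult[OF multilinear_lin_map[OF tpure_multilinear w k] r words_nth[OF vs k]] mk by simp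
    then show ?case
      using Suc r vs by (simp add: T.smult_assoc1[symmetric] tpure_closed m_comm)
  qed
  from this[of n] show ?thesis using len by simp
qed

lemma tpure_zero:
  assumes vs: "vs \<in> words n V" and z: "\<zero>\<^bsub>V\<^esub> \<in> set vs"
  shows "tpure R n V vs = \<zero>\<^bsub>tpower R n V\<^esub>"
proof -
  obtain i where i: "i < n" "vs ! i = \<zero>\<^bsub>V\<^esub>" using vs z by (auto simp: words_def in_set_conv_nth)
  have "tpure R n V (vs[i := \<zero>\<^bsub>V\<^esub>]) = \<zero>\<^bsub>tpower R n V\<^esub>"
    by (rule lin_map_zero[OF multilinear_lin_map[OF tpure_multilinear vs i(1)] V module_tpower])
  then show ?thesis by (simp add: i(2)[symmetric])
qed

end

section \<open>Functoriality, cyclic permutation and trace\<close>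

context
  fixes V :: "('a, 'v, 'x) module_scheme" and W :: "('a, 'w, 'y) module_scheme" and f :: "'v \<Rightarrow> 'w"
  assumes V: "module R V" and W: "module R W" and f: "lin_map R V W f"
begin

lemma tpower_map_lin_hom: "tpower_map R n V W f \<in> lin_hom R (tpower R n V) (tpower R n W)"
  unfolding tpower_map_def
  by (intro lin_map_restrict tpower_lift[OF V] module_tpower V W multilinear_map[OF tpure_multilinear f])

lemma tpower_map_lin_map: "lin_map R (tpower R n V) (tpower R n W) (tpower_map R n V W f)"
  using tpower_map_lin_hom by (simp add: lin_hom_iff)

lemma tpower_map_tpure:
  "vs \<in> words n V \<Longrightarrow> tpower_map R n V W f (tpure R n V vs) = tpure R n W (map f vs)"
  unfolding tpower_map_def
  by (simp add: tpure_closed V tpower_lift(2)[OF V module_tpower[OF W] multilinear_map[OF tpure_multilinear[OF W] f]])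

end

lemma submodule_hull_carrier:
  assumes "module R V" shows "submodule_hull R V (carrier V) = carrier V"
proof -
  interpret V: module R V by fact
  show ?thesis
    using submodule_hull_superset[of "carrier V" V]
      submodule_hull_least[OF V.carrier_is_submodule order_refl] by auto
qed

lemma homothety_lin_map:
  assumes V: "module R V" and r: "r \<in> carrier R"
  shows "lin_map R V V (\<lambda>v. r \<odot>\<^bsub>V\<^esub> v)"
proof -
  interpret V: module R V by fact
  show ?thesis
    by (rule lin_mapI) (use r in \<open>auto simp: V.smult_r_distr V.smult_assoc1[symmetric] m_comm\<close>)
qed

text \<open>
  On the cyclic powers complex, where \<open>r\<close> acts through \<open>r\<^sup>p\<close>, functoriality applied to multiplication by
  \<open>r\<close> is therefore the action of \<open>r\<close>.
\<close>

lemma tpower_map_homothety: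
  assumes V: "module R V" and r: "r \<in> carrier R" and t: "t \<in> carrier (tpower R n V)"
    and f: "\<And>v. v \<in> carrier V \<Longrightarrow> f v = r \<odot>\<^bsub>V\<^esub> v"
  shows "tpower_map R n V V f t = (r [^] n) \<odot>\<^bsub>tpower R n V\<^esub> t"
proof -
  interpret V: module R V by fact
  have fl: "lin_map R V V f"
    by (rule lin_map_cong[OF homothety_lin_map[OF V r] V]) (simp add: f)
  show ?thesis
  proof (rule tpower_lin_map_eq[OF V module_tpower[OF V] tpower_map_lin_map[OF V V fl]
        homothety_lin_map[OF module_tpower[OF V]] submodule_hull_carrier[OF V] _ t])
    show "r [^] n \<in> carrier R" using r by simp
    fix vs assume vs: "vs \<in> words n V"
    then have m: "map f vs = map (\<lambda>v. r \<odot>\<^bsub>V\<^esub> v) vs" by (auto simp: words_def subset_eq f)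
    show "tpower_map R n V V f (tpure R n V vs) = (r [^] n) \<odot>\<^bsub>tpower R n V\<^esub> tpure R n V vs"
      unfolding tpower_map_tpure[OF V V fl vs] m by (rule tpure_smult_all[OF V r vs])
  qed
qed

text \<open>
  The trace map before passage to coinvariants.
\<close>

definition cyc_sum ::
  "('a, 'v, 'x) module_scheme \<Rightarrow> nat \<Rightarrow> ('v list \<Rightarrow> 'a) set \<Rightarrow> ('v list \<Rightarrow> 'a) set" where
  "cyc_sum V n x = (\<Oplus>\<^bsub>tpower R n V\<^esub>i \<in> {..<n}. (cyc R n V ^^ i) x)"

context
  fixes V :: "('a, 'v, 'x) module_scheme" and n :: nat
  assumes V: "module R V"
begin

lemma cyc_lin_map: "lin_map R (tpower R n V) (tpower R n V) (cyc R n V)"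
proof -
  have "cyc R n V \<in> lin_hom R (tpower R n V) (tpower R n V)"
    unfolding cyc_def
    by (intro lin_map_restrict tpower_lift[OF V] module_tpower V multilinear_rotate1[OF tpure_multilinear])
  then show ?thesis by (simp add: lin_hom_iff)
qed

lemma cyc_tpure: "vs \<in> words n V \<Longrightarrow> cyc R n V (tpure R n V vs) = tpure R n V (rotate1 vs)"
  unfolding cyc_def
  by (simp add: tpure_closed V
      tpower_lift(2)[OF V module_tpower[OF V] multilinear_rotate1[OF tpure_multilinear[OF V]]])

lemma cyc_closed: "t \<in> carrier (tpower R n V) \<Longrightarrow> cyc R n V t \<in> carrier (tpower R n V)"
  by (rule lin_map_closed[OF cyc_lin_map])

lemma cyc_power:
  "v \<in> carrier V \<Longrightarrow> cyc R n V (tpure R n V (replicate n v)) = tpure R n V (replicate n v)"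
  using cyc_tpure[OF words_replicate] by (simp add: rotate1_replicate)

lemma cyc_funpow_lin_map: "lin_map R (tpower R n V) (tpower R n V) (cyc R n V ^^ i)"
proof (induction i)
  case 0
  then show ?case by (simp add: lin_map_def)
next
  case (Suc i)
  then show ?case using lin_map_comp[OF Suc cyc_lin_map] by (simp add: o_def)
qed

lemma cyc_funpow_tpure:
  "vs \<in> words n V \<Longrightarrow> (cyc R n V ^^ i) (tpure R n V vs) = tpure R n V (rotate i vs)"
  by (induction i) (auto simp: cyc_tpure words_rotate)

lemma cyc_funpow_n:
  assumes t: "t \<in> carrier (tpower R n V)"
  shows "(cyc R n V ^^ n) t = t"
proof (rule tpower_lin_map_eq[OF V module_tpower[OF V] cyc_funpow_lin_map _ submodule_hull_carrier[OF V] _ t])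
  show "lin_map R (tpower R n V) (tpower R n V) (\<lambda>t. t)" by (simp add: lin_map_def)
  fix vs assume vs: "vs \<in> words n V"
  then have "rotate n vs = vs" by (intro rotate_id) (simp add: words_def)
  then show "(cyc R n V ^^ n) (tpure R n V vs) = tpure R n V vs"
    using cyc_funpow_tpure[OF vs] by simp
qed

lemma cyc_minus_lin_map:
  "lin_map R (tpower R n V) (tpower R n V) (\<lambda>x. cyc R n V x \<ominus>\<^bsub>tpower R n V\<^esub> x)"
proof -
  interpret T: module R "tpower R n V" by (rule module_tpower[OF V])
  show ?thesis
    by (rule lin_mapI)
      (auto simp: T.minus_eq lin_map_add[OF cyc_lin_map] lin_map_smult[OF cyc_lin_map] cyc_closed
        T.smult_r_distr T.smult_r_minus T.minus_add T.a_ac)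
qed

lemma submodule_cyc_bd: "submodule (cyc_bd R n V) R (tpower R n V)"
proof -
  have "cyc_bd R n V = (\<lambda>x. cyc R n V x \<ominus>\<^bsub>tpower R n V\<^esub> x) ` carrier (tpower R n V)"
    by (auto simp: cyc_bd_def)
  then show ?thesis
    using submodule_image[OF module_tpower[OF V] module_tpower[OF V] cyc_minus_lin_map] by simp
qed

lemma module_coinv: "module R (coinv R n V)"
  unfolding coinv_def by (rule module_quot_module[OF module_tpower[OF V] submodule_cyc_bd])

lemma coinv_class_lin_map: "lin_map R (tpower R n V) (coinv R n V) (coinv_class R n V)"
  unfolding coinv_def coinv_class_def[abs_def]
  by (rule quot_class_lin_map[OF module_tpower[OF V] submodule_cyc_bd])

lemma carrier_coinv: "carrier (coinv R n V) = coinv_class R n V ` carrier (tpower R n V)"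
  by (auto simp: coinv_def coinv_class_def quot_module_simps(1))

lemma coinv_class_eq_zero_iff:
  "x \<in> carrier (tpower R n V) \<Longrightarrow> coinv_class R n V x = \<zero>\<^bsub>coinv R n V\<^esub> \<longleftrightarrow> x \<in> cyc_bd R n V"
  unfolding coinv_def coinv_class_def by (rule quot_class_eq_zero_iff[OF module_tpower[OF V] submodule_cyc_bd])

lemma coinv_class_cyc:
  assumes x: "x \<in> carrier (tpower R n V)"
  shows "coinv_class R n V (cyc R n V x) = coinv_class R n V x"
proof -
  interpret T: module R "tpower R n V" by (rule module_tpower[OF V])
  show ?thesis
    using coset_eq_iff[OF module_tpower[OF V] submodule_cyc_bd cyc_closed[OF x] x] x
    by (auto simp: coinv_class_def cyc_bd_def)
qed

lemma coinv_descend: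
  assumes P: "module R P" and f: "lin_map R (tpower R n V) P f"
    and inv: "\<And>x. x \<in> carrier (tpower R n V) \<Longrightarrow> f (cyc R n V x) = f x"
  shows "x \<in> carrier (tpower R n V) \<Longrightarrow> the_elem (f ` coinv_class R n V x) = f x"
    and "lin_map R (coinv R n V) P (\<lambda>X. the_elem (f ` X))"
proof -
  interpret P: module R P by fact
  have kill: "f x = \<zero>\<^bsub>P\<^esub>" if "x \<in> cyc_bd R n V" for x
    using that inv lin_map_closed[OF f]
    by (auto simp: cyc_bd_def lin_map_minus[OF f module_tpower[OF V] P] cyc_closed P.minus_eq_zero_iff)
  show "x \<in> carrier (tpower R n V) \<Longrightarrow> the_elem (f ` coinv_class R n V x) = f x"
    and "lin_map R (coinv R n V) P (\<lambda>X. the_elem (f ` X))"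
    unfolding coinv_class_def coinv_def
    using quot_module_descend[OF module_tpower[OF V] submodule_cyc_bd P f kill] by auto
qed

lemma submodule_invar: "submodule {x \<in> carrier (tpower R n V). cyc R n V x = x} R (tpower R n V)"
proof -
  interpret T: module R "tpower R n V" by (rule module_tpower[OF V])
  show ?thesis
    by (rule T.submoduleI)
      (auto simp: lin_map_zero[OF cyc_lin_map] module_tpower[OF V] lin_map_neg[OF cyc_lin_map]
        lin_map_add[OF cyc_lin_map] lin_map_smult[OF cyc_lin_map])
qed

lemma module_invar: "module R (invar R n V)"
  unfolding invar_def by (rule submodule.submodule_is_module[OF submodule_invar module_tpower[OF V]])

lemma cyc_sum_lin_map: "lin_map R (tpower R n V) (tpower R n V) (cyc_sum V n)"
  unfolding cyc_sum_def[abs_def]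
  by (rule lin_map_sum[OF module_tpower[OF V] module_tpower[OF V] cyc_funpow_lin_map]) simp

text \<open>
  The summand that enters and the one that leaves agree because \<open>\<sigma>\<^sup>n = 1\<close>.
\<close>

lemma cyc_sum_shift:
  assumes x: "x \<in> carrier (tpower R n V)"
  shows "(\<Oplus>\<^bsub>tpower R n V\<^esub>i \<in> {..<n}. (cyc R n V ^^ Suc i) x) = cyc_sum V n x"
proof (cases n)
  case 0
  interpret T: module R "tpower R n V" by (rule module_tpower[OF V])
  have "{..<n} = {}" using 0 by simp
  then show ?thesis unfolding cyc_sum_def by (simp only: T.finsum_empty)
next
  case (Suc m)
  interpret T: module R "tpower R n V" by (rule module_tpower[OF V])
  let ?f = "\<lambda>i. (cyc R n V ^^ i) x"
  have cl: "?f i \<in> carrier (tpower R n V)" for i by (rule lin_map_closed[OF cyc_funpow_lin_map x])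
  have "(\<Oplus>\<^bsub>tpower R n V\<^esub>i \<in> {..m}. ?f (Suc i)) \<oplus>\<^bsub>tpower R n V\<^esub> ?f 0 = (\<Oplus>\<^bsub>tpower R n V\<^esub>i \<in> {..Suc m}. ?f i)"
    by (rule T.finsum_Suc2[symmetric]) (use cl in auto)
  also have "\<dots> = ?f (Suc m) \<oplus>\<^bsub>tpower R n V\<^esub> (\<Oplus>\<^bsub>tpower R n V\<^esub>i \<in> {..m}. ?f i)"
    by (rule T.finsum_Suc) (use cl in auto)
  also have "?f (Suc m) = ?f 0" using cyc_funpow_n[OF x] Suc by simp
  also have "?f 0 \<oplus>\<^bsub>tpower R n V\<^esub> (\<Oplus>\<^bsub>tpower R n V\<^esub>i \<in> {..m}. ?f i) =
      (\<Oplus>\<^bsub>tpower R n V\<^esub>i \<in> {..m}. ?f i) \<oplus>\<^bsub>tpower R n V\<^esub> ?f 0"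
    using cl x by (intro T.a_comm T.finsum_closed) auto
  finally have "(\<Oplus>\<^bsub>tpower R n V\<^esub>i \<in> {..m}. ?f (Suc i)) = (\<Oplus>\<^bsub>tpower R n V\<^esub>i \<in> {..m}. ?f i)"
    by (rule T.add.right_cancel[THEN iffD1, rotated -1])
      (use cl x cl[of "Suc _"] in \<open>auto intro!: T.finsum_closed simp del: funpow.simps\<close>)
  then show ?thesis unfolding cyc_sum_def by (simp only: Suc lessThan_Suc_atMost)
qed

lemma cyc_cyc_sum:
  assumes x: "x \<in> carrier (tpower R n V)"
  shows "cyc R n V (cyc_sum V n x) = cyc_sum V n x"
proof -
  have "cyc R n V (cyc_sum V n x) = (\<Oplus>\<^bsub>tpower R n V\<^esub>i \<in> {..<n}. (cyc R n V ^^ Suc i) x)"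
    unfolding cyc_sum_def
    by (subst lin_map_finsum[OF cyc_lin_map module_tpower[OF V] module_tpower[OF V]])
      (auto intro: lin_map_closed[OF cyc_funpow_lin_map x])
  then show ?thesis using cyc_sum_shift[OF x] by simp
qed

lemma cyc_sum_cyc:
  assumes x: "x \<in> carrier (tpower R n V)"
  shows "cyc_sum V n (cyc R n V x) = cyc_sum V n x"
  using cyc_sum_shift[OF x] by (simp add: cyc_sum_def funpow_Suc_right del: funpow.simps)

lemma trace_coinv_class:
  assumes x: "x \<in> carrier (tpower R n V)"
  shows "trace R n V (coinv_class R n V x) = cyc_sum V n x"
  using coinv_descend(1)[OF module_tpower[OF V] cyc_sum_lin_map cyc_sum_cyc x] x
  by (simp add: trace_def carrier_coinv cyc_sum_def[abs_def])

text \<open>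
  All rotations of a tensor have the same class in the coinvariants.
\<close>

lemma coinv_class_cyc_sum:
  assumes x: "x \<in> carrier (tpower R n V)"
  shows "coinv_class R n V (cyc_sum V n x) = [n] \<cdot>\<^bsub>coinv R n V\<^esub> coinv_class R n V x"
proof -
  interpret C: module R "coinv R n V" by (rule module_coinv)
  have "coinv_class R n V ((cyc R n V ^^ i) x) = coinv_class R n V x" for i
    by (induction i) (auto simp: coinv_class_cyc lin_map_closed[OF cyc_funpow_lin_map x])
  moreover have "coinv_class R n V x \<in> carrier (coinv R n V)"
    using x by (simp add: carrier_coinv)
  ultimately show ?thesis
    unfolding cyc_sum_def
    by (subst lin_map_finsum[OF coinv_class_lin_map module_tpower[OF V] module_coinv])
      (auto intro: lin_map_closed[OF cyc_funpow_lin_map x] simp: C.add.finprod_const)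
qed

end

end

section \<open>Free modules and their tensor powers\<close>

lemma (in cring) module_reg_module: "module R (reg_module R)"
  by (rule moduleI)
    (auto simp: reg_module_def is_cring l_distr r_distr m_assoc a_ac
      intro!: abelian_groupI intro: bexI[of _ "\<ominus> _"] simp: l_neg)

lemma reg_module_simps [simp]:
  "carrier (reg_module R) = carrier R" "\<zero>\<^bsub>reg_module R\<^esub> = \<zero>\<^bsub>R\<^esub>"
  "x \<oplus>\<^bsub>reg_module R\<^esub> y = x \<oplus>\<^bsub>R\<^esub> y" "r \<odot>\<^bsub>reg_module R\<^esub> x = r \<otimes>\<^bsub>R\<^esub> x"
  by (simp_all add: reg_module_def)

text \<open>
  The basis is a family indexed by \<open>I\<close> and not a set of elements: over the zero ring all its members
  coincide, and the coordinates are still indexed correctly.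
\<close>

locale free_with_basis = cring R for R :: "('a, 'k) ring_scheme" (structure) +
  fixes F :: "('a, 'f, 'x) module_scheme" and I :: "'i set" and b :: "'i \<Rightarrow> 'f" and \<kappa> :: "'i \<Rightarrow> 'f \<Rightarrow> 'a"
  assumes F: "module R F"
    and finite_basis: "finite I"
    and basis_closed: "i \<in> I \<Longrightarrow> b i \<in> carrier F"
    and \<kappa>_lin_map: "i \<in> I \<Longrightarrow> lin_map R F (reg_module R) (\<kappa> i)"
    and \<kappa>_basis: "i \<in> I \<Longrightarrow> j \<in> I \<Longrightarrow> \<kappa> i (b j) = (if i = j then \<one> else \<zero>)"
    and basis_generates: "submodule_hull R F (b ` I) = carrier F"
begin

lemma \<kappa>_closed: "i \<in> I \<Longrightarrow> v \<in> carrier F \<Longrightarrow> \<kappa> i v \<in> carrier R"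
  using lin_map_closed[OF \<kappa>_lin_map] by simp

lemma basis_expansion:
  assumes v: "v \<in> carrier F"
  shows "v = (\<Oplus>\<^bsub>F\<^esub>i\<in>I. \<kappa> i v \<odot>\<^bsub>F\<^esub> b i)"
proof (rule lin_map_eq_on_generators[OF F F _ _ basis_generates _ v])
  interpret FM: module R F by (rule F)
  show "lin_map R F F (\<lambda>v. v)" by (simp add: lin_map_def)
  have *: "lin_map R (reg_module R) F (\<lambda>r. r \<odot>\<^bsub>F\<^esub> b i)" if "i \<in> I" for i
    by (rule lin_mapI) (use that basis_closed in \<open>auto simp: FM.smult_l_distr FM.smult_assoc1\<close>)
  show "lin_map R F F (\<lambda>v. \<Oplus>\<^bsub>F\<^esub>i\<in>I. \<kappa> i v \<odot>\<^bsub>F\<^esub> b i)"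
    by (rule lin_map_sum[OF F F lin_map_comp[OF \<kappa>_lin_map *] finite_basis])
  fix x assume "x \<in> b ` I"
  then obtain j where j: "j \<in> I" "x = b j" by auto
  have "(\<Oplus>\<^bsub>F\<^esub>i\<in>I. \<kappa> i x \<odot>\<^bsub>F\<^esub> b i) = (\<Oplus>\<^bsub>F\<^esub>i\<in>I. if j = i then b i else \<zero>\<^bsub>F\<^esub>)"
    by (rule FM.finsum_cong') (use j basis_closed in \<open>auto simp: \<kappa>_basis\<close>)
  also have "\<dots> = b j"
    by (rule FM.finsum_singleton[OF j(1) finite_basis]) (use basis_closed in auto)
  finally show "x = (\<Oplus>\<^bsub>F\<^esub>i\<in>I. \<kappa> i x \<odot>\<^bsub>F\<^esub> b i)" using j by simp
qed

definition index_words :: "nat \<Rightarrow> 'i list set" where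
  "index_words n = {w. set w \<subseteq> I \<and> length w = n}"

lemma finite_index_words: "finite (index_words n)"
  unfolding index_words_def by (rule finite_lists_length_eq[OF finite_basis])

lemma basis_word: "w \<in> index_words n \<Longrightarrow> map b w \<in> words n F"
  using basis_closed by (auto simp: index_words_def words_def)

text \<open>
  The coordinate of a tensor at the basis word given by \<open>w\<close>.
\<close>

definition coord :: "nat \<Rightarrow> 'i list \<Rightarrow> ('f list \<Rightarrow> 'a) set \<Rightarrow> 'a" where
  "coord n w X = the_elem (lin_ext R (reg_module R) (\<lambda>vs. \<Otimes>j\<in>{..<n}. \<kappa> (w ! j) (vs ! j)) ` X)"

context
  fixes w :: "'i list" and n :: nat
  assumes w: "w \<in> index_words n"
begin

lemma coord_multilinear: "multilinear n F (reg_module R) (\<lambda>vs. \<Otimes>j\<in>{..<n}. \<kappa> (w ! j) (vs ! j))"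
proof -
  have wI: "w ! j \<in> I" if "j < n" for j using w that by (auto simp: index_words_def)
  have cl: "(\<lambda>j. \<kappa> (w ! j) (vs ! j)) \<in> A \<rightarrow> carrier R" if "vs \<in> words n F" "A \<subseteq> {..<n}" for vs A
    using that wI \<kappa>_closed words_nth[OF that(1)] by (auto simp: subset_eq)
  show ?thesis
    unfolding multilinear_def
  proof (intro conjI ballI allI impI)
    show "(\<lambda>vs. \<Otimes>j\<in>{..<n}. \<kappa> (w ! j) (vs ! j)) \<in> words n F \<rightarrow> carrier (reg_module R)"
      using cl by (auto intro!: finprod_closed)
    fix vs i assume vs: "vs \<in> words n F" and i: "i < n"
    let ?c = "\<Otimes>j\<in>{..<n} - {i}. \<kappa> (w ! j) (vs ! j)"
    have c: "?c \<in> carrier R" by (rule finprod_closed[OF cl[OF vs]]) auto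
    have eq: "(\<Otimes>j\<in>{..<n}. \<kappa> (w ! j) (vs[i := x] ! j)) = \<kappa> (w ! i) x \<otimes> ?c" if x: "x \<in> carrier F" for x
    proof -
      have len: "length vs = n" using vs by (simp add: words_def)
      have "{..<n} = insert i ({..<n} - {i})" using i by auto
      then have "(\<Otimes>j\<in>{..<n}. \<kappa> (w ! j) (vs[i := x] ! j)) =
          (\<Otimes>j\<in>insert i ({..<n} - {i}). \<kappa> (w ! j) (vs[i := x] ! j))" by simp
      also have "\<dots> = \<kappa> (w ! i) (vs[i := x] ! i) \<otimes> (\<Otimes>j\<in>{..<n} - {i}. \<kappa> (w ! j) (vs[i := x] ! j))"
        by (rule finprod_insert) (use cl[OF words_update[OF vs x]] i len wI x \<kappa>_closed in auto)
      also have "(\<Otimes>j\<in>{..<n} - {i}. \<kappa> (w ! j) (vs[i := x] ! j)) = ?c"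
        by (rule finprod_cong') (use cl[OF vs] in auto)
      finally show ?thesis using i len by simp
    qed
    show "lin_map R F (reg_module R) (\<lambda>x. \<Otimes>j\<in>{..<n}. \<kappa> (w ! j) (vs[i := x] ! j))"
    proof (rule lin_map_cong[OF _ F eq[symmetric]])
      show "lin_map R F (reg_module R) (\<lambda>x. \<kappa> (w ! i) x \<otimes> ?c)"
        using \<kappa>_lin_map[OF wI[OF i]] c by (auto simp: lin_map_def Pi_def l_distr m_assoc)
    qed
  qed
qed

lemma coord_lin_map: "lin_map R (tpower R n F) (reg_module R) (coord n w)"
  unfolding coord_def[abs_def] by (rule tpower_lift(1)[OF F module_reg_module coord_multilinear])

lemma coord_closed: "t \<in> carrier (tpower R n F) \<Longrightarrow> coord n w t \<in> carrier R"
  using lin_map_closed[OF coord_lin_map] by simp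

lemma coord_tpure:
  "vs \<in> words n F \<Longrightarrow> coord n w (tpure R n F vs) = (\<Otimes>j\<in>{..<n}. \<kappa> (w ! j) (vs ! j))"
  unfolding coord_def by (rule tpower_lift(2)[OF F module_reg_module coord_multilinear])

lemma coord_basis_word:
  assumes w': "w' \<in> index_words n"
  shows "coord n w (tpure R n F (map b w')) = (if w = w' then \<one> else \<zero>)"
proof -
  have wI: "w ! j \<in> I" "w' ! j \<in> I" if "j < n" for j
    using w w' that by (auto simp: index_words_def)
  have len: "length w = n" "length w' = n" using w w' by (auto simp: index_words_def)
  let ?d = "\<lambda>j. if w ! j = w' ! j then \<one> else \<zero>"
  have "coord n w (tpure R n F (map b w')) = (\<Otimes>j\<in>{..<n}. \<kappa> (w ! j) (map b w' ! j))"
    by (rule coord_tpure[OF basis_word[OF w']])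
  also have "\<dots> = (\<Otimes>j\<in>{..<n}. ?d j)"
    by (rule finprod_cong') (use wI len in \<open>auto simp: \<kappa>_basis\<close>)
  also have "\<dots> = (if w = w' then \<one> else \<zero>)"
  proof (cases "w = w'")
    case False
    then obtain i where i: "i < n" "w ! i \<noteq> w' ! i" using len by (metis nth_equalityI)
    have "{..<n} = insert i ({..<n} - {i})" using i by auto
    then have "(\<Otimes>j\<in>{..<n}. ?d j) = (\<Otimes>j\<in>insert i ({..<n} - {i}). ?d j)" by simp
    also have "\<dots> = ?d i \<otimes> (\<Otimes>j\<in>{..<n} - {i}. ?d j)"
      by (rule finprod_insert) auto
    also have "\<dots> = \<zero>" using i by (auto intro!: l_null finprod_closed)
    finally show ?thesis using False by simp
  qed simp
  finally show ?thesis .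
qed

end

lemma tpower_lin_map_eq_on_basis:
  assumes M: "module R M" and f: "lin_map R (tpower R n F) M f" and g: "lin_map R (tpower R n F) M g"
    and eq: "\<And>w. w \<in> index_words n \<Longrightarrow> f (tpure R n F (map b w)) = g (tpure R n F (map b w))"
    and t: "t \<in> carrier (tpower R n F)"
  shows "f t = g t"
proof (rule tpower_lin_map_eq[OF F M f g basis_generates _ t])
  fix vs assume vs: "vs \<in> words n F" "set vs \<subseteq> b ` I"
  have "map (\<lambda>x. b (inv_into I b x)) vs = vs"
    by (rule map_idI, rule f_inv_into_f) (use vs(2) in auto)
  then have "map b (map (inv_into I b) vs) = vs" by (simp add: o_def)
  moreover have "map (inv_into I b) vs \<in> index_words n"
    using vs by (auto simp: index_words_def words_def intro!: inv_into_into)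
  ultimately show "f (tpure R n F vs) = g (tpure R n F vs)" using eq by metis
qed

lemma tpower_expansion:
  assumes t: "t \<in> carrier (tpower R n F)"
  shows "t = (\<Oplus>\<^bsub>tpower R n F\<^esub>w\<in>index_words n. coord n w t \<odot>\<^bsub>tpower R n F\<^esub> tpure R n F (map b w))"
proof (rule tpower_lin_map_eq_on_basis[OF module_tpower[OF F] _ _ _ t])
  let ?T = "tpower R n F"
  interpret T: module R ?T by (rule module_tpower[OF F])
  have bc: "tpure R n F (map b w) \<in> carrier ?T" if "w \<in> index_words n" for w
    by (rule tpure_closed[OF F basis_word[OF that]])
  show "lin_map R ?T ?T (\<lambda>t. t)" by (simp add: lin_map_def)
  have *: "lin_map R (reg_module R) ?T (\<lambda>r. r \<odot>\<^bsub>?T\<^esub> tpure R n F (map b w))" if "w \<in> index_words n" for w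
    by (rule lin_mapI) (use bc[OF that] in \<open>auto simp: T.smult_l_distr T.smult_assoc1\<close>)
  show "lin_map R ?T ?T (\<lambda>t. \<Oplus>\<^bsub>?T\<^esub>w\<in>index_words n. coord n w t \<odot>\<^bsub>?T\<^esub> tpure R n F (map b w))"
    by (rule lin_map_sum[OF module_tpower[OF F] module_tpower[OF F]
        lin_map_comp[OF coord_lin_map *] finite_index_words])
  fix v assume v: "v \<in> index_words n"
  have "(\<Oplus>\<^bsub>?T\<^esub>w\<in>index_words n. coord n w (tpure R n F (map b v)) \<odot>\<^bsub>?T\<^esub> tpure R n F (map b w)) =
      (\<Oplus>\<^bsub>?T\<^esub>w\<in>index_words n. if v = w then tpure R n F (map b w) else \<zero>\<^bsub>?T\<^esub>)"
    by (rule T.finsum_cong') (use v bc in \<open>auto simp: coord_basis_word\<close>)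
  also have "\<dots> = tpure R n F (map b v)"
    by (rule T.finsum_singleton[OF v finite_index_words]) (use bc in auto)
  finally show "tpure R n F (map b v) = (\<Oplus>\<^bsub>?T\<^esub>w\<in>index_words n.
      coord n w (tpure R n F (map b v)) \<odot>\<^bsub>?T\<^esub> tpure R n F (map b w))" by simp
qed

lemma index_words_rotate: "w \<in> index_words n \<Longrightarrow> rotate j w \<in> index_words n"
  by (auto simp: index_words_def)

text \<open>
  It suffices to compare both sides on basis words, where they are \<open>0\<close> or \<open>1\<close>.
\<close>

lemma coord_cyc:
  assumes w: "w \<in> index_words n" and t: "t \<in> carrier (tpower R n F)"
  shows "coord n (rotate1 w) (cyc R n F t) = coord n w t"
proof (rule tpower_lin_map_eq_on_basis[OF module_reg_module _ coord_lin_map[OF w] _ t])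
  have w1: "rotate1 v \<in> index_words n" if "v \<in> index_words n" for v
    using that by (auto simp: index_words_def)
  show "lin_map R (tpower R n F) (reg_module R) (\<lambda>t. coord n (rotate1 w) (cyc R n F t))"
    by (rule lin_map_comp[OF cyc_lin_map[OF F] coord_lin_map[OF w1[OF w]]])
  fix v assume v: "v \<in> index_words n"
  have "(rotate1 w = rotate1 v) = (w = v)" by (metis rotate1_rotate_swap inj_rotate1 injD)
  then show "coord n (rotate1 w) (cyc R n F (tpure R n F (map b v))) = coord n w (tpure R n F (map b v))"
    using coord_basis_word[OF w1[OF w] w1[OF v]] coord_basis_word[OF w v]
    by (simp add: cyc_tpure[OF F basis_word[OF v]] rotate1_map)
qed

lemma const_word: "i \<in> I \<Longrightarrow> replicate n i \<in> index_words n"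
  by (auto simp: index_words_def)

lemma coord_const_cyc:
  assumes "i \<in> I" and t: "t \<in> carrier (tpower R n F)"
  shows "coord n (replicate n i) (cyc R n F t) = coord n (replicate n i) t"
proof -
  show ?thesis using coord_cyc[OF const_word[OF assms(1)] t] by (simp add: rotate1_replicate)
qed

lemma coord_const_power:
  assumes i: "i \<in> I" and v: "v \<in> carrier F"
  shows "coord n (replicate n i) (tpure R n F (replicate n v)) = \<kappa> i v [^] n"
proof -
  have "coord n (replicate n i) (tpure R n F (replicate n v)) =
      (\<Otimes>j\<in>{..<n}. \<kappa> (replicate n i ! j) (replicate n v ! j))"
    by (rule coord_tpure[OF const_word[OF i] words_replicate[of v F n, OF v]])
  also have "\<dots> = (\<Otimes>j\<in>{..<n}. \<kappa> i v)"
    by (rule finprod_cong') (use \<kappa>_closed[OF i v] in auto)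
  finally show ?thesis using finprod_const[OF \<kappa>_closed[OF i v], of "{..<n}"] by simp
qed

lemma coord_rotate_invariant:
  assumes w: "w \<in> index_words n" and t: "t \<in> carrier (tpower R n F)" and inv: "cyc R n F t = t"
  shows "coord n (rotate j w) t = coord n w t"
proof (induction j)
  case (Suc j)
  then show ?case using coord_cyc[OF index_words_rotate[OF w, of j] t] inv by simp
qed simp

text \<open>
  An invariant tensor has the same coordinate on all words of a rotation class. Over a class with
  \<open>p\<close> elements this adds up to a trace, and the other classes consist of one constant word.
\<close>

lemma invariant_decomposition:
  assumes p: "prime p" and t: "t \<in> carrier (tpower R p F)" and inv: "cyc R p F t = t"
  shows "t = (\<Oplus>\<^bsub>tpower R p F\<^esub>i\<in>I. coord p (replicate p i) t \<odot>\<^bsub>tpower R p F\<^esub> tpure R p F (replicate p (b i)))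
    \<oplus>\<^bsub>tpower R p F\<^esub> cyc_sum F p (\<Oplus>\<^bsub>tpower R p F\<^esub>w\<in>necklaces p I.
        coord p w t \<odot>\<^bsub>tpower R p F\<^esub> tpure R p F (map b w))"
proof -
  let ?T = "tpower R p F" and ?c = "\<lambda>w. coord p w t \<odot>\<^bsub>tpower R p F\<^esub> tpure R p F (map b w)"
  interpret T: module R ?T by (rule module_tpower[OF F])
  have p0: "p > 0" using p by (rule prime_gt_0_nat)
  have ncw: "w \<in> index_words p" if "w \<in> nonconst_words p I" for w
    using that by (auto simp: index_words_def nonconst_words_def)
  have nkw: "w \<in> index_words p" if "w \<in> necklaces p I" for w
    using that ncw necklaces_subset by auto
  have cc: "?c w \<in> carrier ?T" if "w \<in> index_words p" for w
    using coord_closed[OF that t] tpure_closed[OF F basis_word[OF that]] by simp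
  have "t = (\<Oplus>\<^bsub>?T\<^esub>w\<in>index_words p. ?c w)" by (rule tpower_expansion[OF t])
  also have "index_words p = replicate p ` I \<union> nonconst_words p I"
  proof -
    have "w \<in> replicate p ` I \<union> nonconst_words p I" if w: "w \<in> index_words p" for w
    proof (cases "\<exists>i. w = replicate p i")
      case True
      then obtain i where i: "w = replicate p i" by auto
      then have "i \<in> set w" using p0 by simp
      then have "i \<in> I" using w by (auto simp: index_words_def)
      then show ?thesis using i by blast
    next
      case False
      then show ?thesis using w by (simp add: index_words_def nonconst_words_def)
    qed
    then show ?thesis using const_word ncw by auto
  qed
  also have "(\<Oplus>\<^bsub>?T\<^esub>w\<in>replicate p ` I \<union> nonconst_words p I. ?c w) =
      (\<Oplus>\<^bsub>?T\<^esub>w\<in>replicate p ` I. ?c w) \<oplus>\<^bsub>?T\<^esub> (\<Oplus>\<^bsub>?T\<^esub>w\<in>nonconst_words p I. ?c w)"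
  proof (rule T.finsum_Un_disjoint)
    show "?c \<in> replicate p ` I \<rightarrow> carrier ?T" "?c \<in> nonconst_words p I \<rightarrow> carrier ?T"
      using cc const_word ncw by blast+
    show "replicate p ` I \<inter> nonconst_words p I = {}" by (auto simp: nonconst_words_def)
  qed (auto simp: finite_basis finite_nonconst_words)
  also have "(\<Oplus>\<^bsub>?T\<^esub>w\<in>replicate p ` I. ?c w) = (\<Oplus>\<^bsub>?T\<^esub>i\<in>I. ?c (replicate p i))"
  proof (rule T.finsum_reindex)
    show "?c \<in> replicate p ` I \<rightarrow> carrier ?T" using cc const_word by blast
    show "inj_on (replicate p) I" using p0 by (auto simp: inj_on_def)
  qed
  also have "(\<Oplus>\<^bsub>?T\<^esub>w\<in>nonconst_words p I. ?c w) =
      (\<Oplus>\<^bsub>?T\<^esub>w\<in>necklaces p I. \<Oplus>\<^bsub>?T\<^esub>v\<in>(\<lambda>j. rotate j w) ` {..<p}. ?c v)"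
    unfolding nonconst_words_eq_UN[OF p0]
  proof (rule T.add.finprod_UN_disjoint)
    show "finite (necklaces p I)" by (rule finite_necklaces[OF finite_basis])
    show "pairwise (\<lambda>i j. disjnt ((\<lambda>j. rotate j i) ` {..<p}) ((\<lambda>i. rotate i j) ` {..<p})) (necklaces p I)"
      by (intro pairwiseI) (simp add: disjnt_def necklace_orbits_disjoint)
    show "?c v \<in> carrier ?T" if "w \<in> necklaces p I" "v \<in> (\<lambda>j. rotate j w) ` {..<p}" for w v
      using that cc index_words_rotate nkw by blast
  qed simp
  also have "\<dots> = (\<Oplus>\<^bsub>?T\<^esub>w\<in>necklaces p I. cyc_sum F p (?c w))"
  proof (rule T.finsum_cong')
    fix w assume w: "w \<in> necklaces p I"
    have wi: "w \<in> index_words p" and wn: "w \<in> nonconst_words p I" using w nkw necklaces_subset by auto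
    have bw: "map b w \<in> words p F" by (rule basis_word[OF wi])
    have "(\<Oplus>\<^bsub>?T\<^esub>v\<in>(\<lambda>j. rotate j w) ` {..<p}. ?c v) = (\<Oplus>\<^bsub>?T\<^esub>j\<in>{..<p}. ?c (rotate j w))"
    proof (rule T.finsum_reindex)
      show "?c \<in> (\<lambda>j. rotate j w) ` {..<p} \<rightarrow> carrier ?T" using cc index_words_rotate[OF wi] by blast
    qed (rule rotate_inj_on_nonconst[OF p wn])
    also have "\<dots> = (\<Oplus>\<^bsub>?T\<^esub>j\<in>{..<p}. (cyc R p F ^^ j) (?c w))"
    proof (rule T.finsum_cong'[OF refl])
      show "(\<lambda>j. (cyc R p F ^^ j) (?c w)) \<in> {..<p} \<rightarrow> carrier ?T"
        using lin_map_closed[OF cyc_funpow_lin_map[OF F] cc[OF wi]] by blast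
      show "?c (rotate j w) = (cyc R p F ^^ j) (?c w)" for j
        using coord_closed[OF wi t] bw
        by (simp add: coord_rotate_invariant[OF wi t inv] lin_map_smult[OF cyc_funpow_lin_map[OF F]]
            tpure_closed[OF F] cyc_funpow_tpure[OF F] rotate_map)
    qed
    finally show "(\<Oplus>\<^bsub>?T\<^esub>v\<in>(\<lambda>j. rotate j w) ` {..<p}. ?c v) = cyc_sum F p (?c w)"
      by (simp add: cyc_sum_def)
  qed (use lin_map_closed[OF cyc_sum_lin_map[OF F]] cc nkw in auto)
  also have "\<dots> = cyc_sum F p (\<Oplus>\<^bsub>?T\<^esub>w\<in>necklaces p I. ?c w)"
    by (rule lin_map_finsum[symmetric, OF cyc_sum_lin_map[OF F] module_tpower[OF F] module_tpower[OF F]])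
      (use finite_necklaces[OF finite_basis] cc nkw in auto)
  finally show ?thesis by simp
qed

end

lemma (in cring) free_module_with_basis:
  assumes "finite I"
  shows "free_with_basis R (free_module R I) I (basis_elt R) (\<lambda>i f. f i)"
  by (rule free_with_basis.intro[OF cring_axioms], rule free_with_basis_axioms.intro)
    (use assms free_module_generated module_free_module in
      \<open>auto simp: basis_elt_closed basis_elt_def free_module_simps lin_map_def\<close>)

section \<open>The Frobenius twist and the map \<psi>\<close>

lemma (in module) add_pow_smult:
  assumes "x \<in> carrier M"
  shows "[(n::nat)] \<cdot>\<^bsub>M\<^esub> x = ([n] \<cdot>\<^bsub>R\<^esub> \<one>\<^bsub>R\<^esub>) \<odot>\<^bsub>M\<^esub> x"
  by (induction n) (use assms in \<open>auto simp: M.add.nat_pow_Suc R.add.nat_pow_Suc smult_l_distr\<close>)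

locale cring_char = cring R for R :: "('a, 'k) ring_scheme" (structure) +
  fixes p :: nat
  assumes p: "prime p" and char: "x \<in> carrier R \<Longrightarrow> [p] \<cdot> x = \<zero>"
begin

lemma p_pos: "0 < p" using p by (rule prime_gt_0_nat)

lemma module_char:
  assumes "module R M" "x \<in> carrier M"
  shows "[p] \<cdot>\<^bsub>M\<^esub> x = \<zero>\<^bsub>M\<^esub>"
proof -
  interpret M: module R M by fact
  show ?thesis using M.add_pow_smult[OF assms(2), of p] char[OF one_closed] assms(2) by simp
qed

lemma tpower_map_cyc:
  assumes V: "module R V" and W: "module R W" and f: "lin_map R V W f"
    and t: "t \<in> carrier (tpower R n V)"
  shows "tpower_map R n V W f (cyc R n V t) = cyc R n W (tpower_map R n V W f t)"
proof (rule tpower_lin_map_eq[OF V module_tpower[OF W] _ _ submodule_hull_carrier[OF V] _ t])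
  have f': "f \<in> carrier V \<rightarrow> carrier W" using lin_map_closed[OF f] by auto
  show "lin_map R (tpower R n V) (tpower R n W) (\<lambda>t. tpower_map R n V W f (cyc R n V t))"
    by (rule lin_map_comp[OF cyc_lin_map[OF V] tpower_map_lin_map[OF V W f]])
  show "lin_map R (tpower R n V) (tpower R n W) (\<lambda>t. cyc R n W (tpower_map R n V W f t))"
    by (rule lin_map_comp[OF tpower_map_lin_map[OF V W f] cyc_lin_map[OF W]])
  fix vs assume vs: "vs \<in> words n V"
  show "tpower_map R n V W f (cyc R n V (tpure R n V vs)) = cyc R n W (tpower_map R n V W f (tpure R n V vs))"
    by (simp add: cyc_tpure[OF V vs] tpower_map_tpure[OF V W f] vs words_rotate1
        cyc_tpure[OF W words_map[OF vs f']] rotate1_map)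
qed

lemma tpower_map_cyc_sum:
  assumes V: "module R V" and W: "module R W" and f: "lin_map R V W f"
    and t: "t \<in> carrier (tpower R n V)"
  shows "tpower_map R n V W f (cyc_sum V n t) = cyc_sum W n (tpower_map R n V W f t)"
proof -
  interpret W: module R "tpower R n W" by (rule module_tpower[OF W])
  note cl = lin_map_closed[OF cyc_funpow_lin_map[OF V] t]
  have eq: "tpower_map R n V W f ((cyc R n V ^^ i) t) = (cyc R n W ^^ i) (tpower_map R n V W f t)" for i
    by (induction i) (simp_all add: tpower_map_cyc[OF V W f cl])
  show ?thesis
    unfolding cyc_sum_def
    by (subst lin_map_finsum[OF tpower_map_lin_map[OF V W f] module_tpower[OF V] module_tpower[OF W]])
      (use cl in \<open>auto simp: eq\<close>)
qed

text \<open>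
  The sum of the mixed monomials of \<open>(v + w) ^ p\<close>, one from each rotation class.
\<close>

definition necklace_sum :: "('a, 'v, 'x) module_scheme \<Rightarrow> 'v \<Rightarrow> 'v \<Rightarrow> ('v list \<Rightarrow> 'a) set" where
  "necklace_sum V v w =
    (\<Oplus>\<^bsub>tpower R p V\<^esub>\<epsilon>\<in>necklaces p UNIV. tpure R p V (map (\<lambda>i. if i then v else w) \<epsilon>))"

lemma necklace_length: "\<epsilon> \<in> necklaces p I \<Longrightarrow> length \<epsilon> = p"
  using necklaces_subset[of p I] by (auto simp: nonconst_words_def)

lemma finite_bool_necklaces: "finite (necklaces p (UNIV :: bool set))"
  by (rule finite_necklaces) simp

lemma necklace_words:
  assumes "v \<in> carrier V" "w \<in> carrier V" "\<epsilon> \<in> necklaces p UNIV"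
  shows "map (\<lambda>i. if i then v else w) \<epsilon> \<in> words p V"
  using assms necklace_length by (auto simp: words_def)

lemma necklace_sum_closed:
  assumes V: "module R V" and "v \<in> carrier V" "w \<in> carrier V"
  shows "necklace_sum V v w \<in> carrier (tpower R p V)"
proof -
  interpret T: module R "tpower R p V" by (rule module_tpower[OF V])
  show ?thesis
    unfolding necklace_sum_def
    by (rule T.finsum_closed) (use tpure_closed[OF V necklace_words] assms in auto)
qed

lemma tpower_map_necklace_sum:
  assumes V: "module R V" and W: "module R W" and f: "lin_map R V W f"
    and v: "v \<in> carrier V" and w: "w \<in> carrier V"
  shows "tpower_map R p V W f (necklace_sum V v w) = necklace_sum W (f v) (f w)"
proof -
  interpret W: module R "tpower R p W" by (rule module_tpower[OF W])
  have f': "f \<in> carrier V \<rightarrow> carrier W" using lin_map_closed[OF f] by auto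
  have "tpower_map R p V W f (necklace_sum V v w) = (\<Oplus>\<^bsub>tpower R p W\<^esub>\<epsilon>\<in>necklaces p UNIV.
      tpower_map R p V W f (tpure R p V (map (\<lambda>i. if i then v else w) \<epsilon>)))"
    unfolding necklace_sum_def
    by (rule lin_map_finsum[OF tpower_map_lin_map[OF V W f] module_tpower[OF V] module_tpower[OF W]
          finite_bool_necklaces])
      (use tpure_closed[OF V necklace_words] v w in auto)
  also have "\<dots> = (\<Oplus>\<^bsub>tpower R p W\<^esub>\<epsilon>\<in>necklaces p UNIV. tpure R p W (map (\<lambda>i. if i then f v else f w) \<epsilon>))"
  proof (rule W.finsum_cong'[OF refl])
    show "(\<lambda>\<epsilon>. tpure R p W (map (\<lambda>i. if i then f v else f w) \<epsilon>)) \<in> necklaces p UNIV \<rightarrow> carrier (tpower R p W)"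
      using tpure_closed[OF W necklace_words] f' v w by auto
    fix \<epsilon> :: "bool list" assume \<epsilon>: "\<epsilon> \<in> necklaces p UNIV"
    have "map f (map (\<lambda>i. if i then v else w) \<epsilon>) = map (\<lambda>i. if i then f v else f w) \<epsilon>" by simp
    then show "tpower_map R p V W f (tpure R p V (map (\<lambda>i. if i then v else w) \<epsilon>)) =
        tpure R p W (map (\<lambda>i. if i then f v else f w) \<epsilon>)"
      using tpower_map_tpure[OF V W f necklace_words[OF v w \<epsilon>]] by (simp only:)
  qed
  finally show ?thesis by (simp add: necklace_sum_def)
qed

text \<open>
  The binomial formula for \<open>p\<close>-th tensor powers. By naturality it suffices to treat the free module
  on two generators, where it is the decomposition of an invariant tensor all of whose coordinates
  are \<open>1\<close>.
\<close>

lemma tpure_power_add: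
  assumes V: "module R V" and v: "v \<in> carrier V" and w: "w \<in> carrier V"
  shows "tpure R p V (replicate p (v \<oplus>\<^bsub>V\<^esub> w)) =
    (tpure R p V (replicate p v) \<oplus>\<^bsub>tpower R p V\<^esub> tpure R p V (replicate p w))
      \<oplus>\<^bsub>tpower R p V\<^esub> cyc_sum V p (necklace_sum V v w)"
proof -
  let ?F = "free_module R (UNIV :: bool set)"
  let ?T = "tpower R p ?F"
  interpret V: module R V by fact
  interpret F: module R ?F by (rule module_free_module)
  interpret B: free_with_basis R ?F UNIV "basis_elt R" "\<lambda>i f. f i"
    by (rule free_module_with_basis) simp
  interpret T: module R ?T by (rule module_tpower[OF B.F])
  interpret TV: module R "tpower R p V" by (rule module_tpower[OF V])
  define e :: "bool \<Rightarrow> bool \<Rightarrow> 'a" where "e = basis_elt R"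
  have e: "e i \<in> carrier ?F" for i :: bool unfolding e_def by (rule B.basis_closed) simp
  have ec: "map e w \<in> words p ?F" if "length w = p" for w
    using that e by (auto simp: words_def)
  have pe: "tpure R p ?F (replicate p (e i)) \<in> carrier ?T" for i
    by (rule tpure_closed[OF B.F words_replicate[of _ ?F, OF e]])
  define x where "x = e True \<oplus>\<^bsub>?F\<^esub> e False"
  have x: "x \<in> carrier ?F" unfolding x_def using e by simp
  have xi: "x i = \<one>" for i
    by (cases i) (auto simp: x_def e_def free_module_simps basis_elt_def)
  define t where "t = tpure R p ?F (replicate p x)"
  have t: "t \<in> carrier ?T" unfolding t_def by (rule tpure_closed[OF B.F words_replicate[of _ ?F, OF x]])
  have inv: "cyc R p ?F t = t" unfolding t_def by (rule cyc_power[OF B.F x])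
  have c1: "B.coord p w t = \<one>" if w: "length w = p" for w
  proof -
    have "B.coord p w t = (\<Otimes>j\<in>{..<p}. (replicate p x ! j) (w ! j))"
      unfolding t_def
      by (rule B.coord_tpure[OF _ words_replicate[of _ ?F, OF x]]) (use w in \<open>simp add: B.index_words_def\<close>)
    also have "\<dots> = (\<Otimes>j\<in>{..<p}. \<one>)" by (rule finprod_cong') (auto simp: xi)
    finally show ?thesis by simp
  qed
  have "t = (\<Oplus>\<^bsub>?T\<^esub>i\<in>UNIV. B.coord p (replicate p i) t \<odot>\<^bsub>?T\<^esub> tpure R p ?F (replicate p (e i)))
      \<oplus>\<^bsub>?T\<^esub> cyc_sum ?F p (\<Oplus>\<^bsub>?T\<^esub>w\<in>necklaces p UNIV. B.coord p w t \<odot>\<^bsub>?T\<^esub> tpure R p ?F (map e w))"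
    unfolding e_def by (rule B.invariant_decomposition[OF p t inv])
  also have "(\<Oplus>\<^bsub>?T\<^esub>i\<in>UNIV. B.coord p (replicate p i) t \<odot>\<^bsub>?T\<^esub> tpure R p ?F (replicate p (e i))) =
      (\<Oplus>\<^bsub>?T\<^esub>i\<in>{True, False}. tpure R p ?F (replicate p (e i)))"
  proof (rule T.finsum_cong')
    show "(UNIV :: bool set) = {True, False}" by auto
  qed (use pe c1 in \<open>simp_all add: Pi_def\<close>)
  also have "\<dots> = tpure R p ?F (replicate p (e True)) \<oplus>\<^bsub>?T\<^esub> tpure R p ?F (replicate p (e False))"
    by (simp add: tpure_closed[OF B.F words_replicate[of _ ?F, OF e]])
  also have "(\<Oplus>\<^bsub>?T\<^esub>w\<in>necklaces p UNIV. B.coord p w t \<odot>\<^bsub>?T\<^esub> tpure R p ?F (map e w)) =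
      necklace_sum ?F (e True) (e False)"
    unfolding necklace_sum_def
  proof (rule T.finsum_cong'[OF refl])
    show "(\<lambda>\<epsilon>. tpure R p ?F (map (\<lambda>i. if i then e True else e False) \<epsilon>)) \<in> necklaces p UNIV \<rightarrow> carrier ?T"
      using tpure_closed[OF B.F necklace_words[OF e e]] by auto
    fix w :: "bool list" assume w: "w \<in> necklaces p UNIV"
    have "(\<lambda>i. if i then e True else e False) = e" by auto
    then show "B.coord p w t \<odot>\<^bsub>?T\<^esub> tpure R p ?F (map e w) =
        tpure R p ?F (map (\<lambda>i. if i then e True else e False) w)"
      using c1[OF necklace_length[OF w]] tpure_closed[OF B.F ec[OF necklace_length[OF w]]] by simp
  qed
  finally have univ: "t = (tpure R p ?F (replicate p (e True)) \<oplus>\<^bsub>?T\<^esub> tpure R p ?F (replicate p (e False)))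
      \<oplus>\<^bsub>?T\<^esub> cyc_sum ?F p (necklace_sum ?F (e True) (e False))" .
  define f where "f = lin_ext R V (\<lambda>i. if i then v else w)"
  have g: "(\<lambda>i. if i then v else w) \<in> UNIV \<rightarrow> carrier V" using v w by auto
  have f: "lin_map R ?F V f" unfolding f_def by (rule lin_ext_lin_map[OF V g])
  have fe: "f (e True) = v" "f (e False) = w"
    unfolding f_def e_def by (simp_all add: lin_ext_basis_elt[OF V g])
  have fx: "f x = v \<oplus>\<^bsub>V\<^esub> w" unfolding x_def by (simp add: lin_map_add[OF f e e] fe)
  note m = tpower_map_lin_map[OF B.F V f, of p]
  have ns: "necklace_sum ?F (e True) (e False) \<in> carrier ?T" by (rule necklace_sum_closed[OF B.F e e])
  have cs: "cyc_sum ?F p (necklace_sum ?F (e True) (e False)) \<in> carrier ?T"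
    by (rule lin_map_closed[OF cyc_sum_lin_map[OF B.F] ns])
  have "tpower_map R p ?F V f t = tpure R p V (replicate p (f x))"
    unfolding t_def by (simp add: tpower_map_tpure[OF B.F V f words_replicate[of _ ?F, OF x]])
  moreover have "tpower_map R p ?F V f t =
      (tpure R p V (replicate p (f (e True))) \<oplus>\<^bsub>tpower R p V\<^esub> tpure R p V (replicate p (f (e False))))
      \<oplus>\<^bsub>tpower R p V\<^esub> cyc_sum V p (necklace_sum V (f (e True)) (f (e False)))"
    by (subst univ)
      (simp add: lin_map_add[OF m] pe cs tpower_map_tpure[OF B.F V f words_replicate[of _ ?F, OF e]]
        tpower_map_cyc_sum[OF B.F V f ns] tpower_map_necklace_sum[OF B.F V f e e])
  ultimately show ?thesis by (simp only: fx fe)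
qed

text \<open>
  Rotation fixes constant words, so the coordinate of the trace is \<open>p\<close> times a coordinate.
\<close>

lemma coord_const_cyc_sum:
  assumes B: "free_with_basis R F I b \<kappa>" and i: "i \<in> I" and t: "t \<in> carrier (tpower R p F)"
  shows "free_with_basis.coord R \<kappa> p (replicate p i) (cyc_sum F p t) = \<zero>"
proof -
  interpret B: free_with_basis R F I b \<kappa> by fact
  interpret N: module R "reg_module R" by (rule module_reg_module)
  note cl = lin_map_closed[OF cyc_funpow_lin_map[OF B.F] t]
  have "B.coord p (replicate p i) ((cyc R p F ^^ j) t) = B.coord p (replicate p i) t" for j
    by (induction j) (simp_all add: B.coord_const_cyc[OF i cl])
  moreover have "B.coord p (replicate p i) t \<in> carrier (reg_module R)"
    using B.coord_closed[OF B.const_word[OF i] t] by simp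
  ultimately have "B.coord p (replicate p i) (cyc_sum F p t) =
      [p] \<cdot>\<^bsub>reg_module R\<^esub> B.coord p (replicate p i) t"
    unfolding cyc_sum_def
    by (subst lin_map_finsum[OF B.coord_lin_map[OF B.const_word[OF i]] module_tpower[OF B.F] module_reg_module])
      (use cl in \<open>auto simp: N.add.finprod_const\<close>)
  then show ?thesis
    using module_char[OF module_reg_module] B.coord_closed[OF B.const_word[OF i] t] by simp
qed

text \<open>
  In the binomial formula for the module \<open>R\<close>, multiplying the factors of a tensor kills the trace.
\<close>

lemma frobenius_add:
  assumes r: "r \<in> carrier R" and s: "s \<in> carrier R"
  shows "(r \<oplus> s) [^] p = r [^] p \<oplus> s [^] p"
proof -
  let ?M = "reg_module R"
  have "submodule_hull R ?M ((\<lambda>_. \<one>) ` {()}) = carrier ?M"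
  proof -
    interpret M: module R ?M by (rule module_reg_module)
    have sub: "submodule (submodule_hull R ?M {\<one>}) R ?M"
      by (rule submodule_submodule_hull[OF module_reg_module]) simp
    have "x \<in> submodule_hull R ?M {\<one>}" if "x \<in> carrier R" for x
      using M.submoduleE(4)[OF sub that, of \<one>] submodule_hull_superset[of "{\<one>}" ?M] that by simp
    then show ?thesis using M.submoduleE(1)[OF sub] by auto
  qed
  then have B: "free_with_basis R ?M {()} (\<lambda>_. \<one>) (\<lambda>_ x. x)"
    by (intro free_with_basis.intro[OF cring_axioms] free_with_basis_axioms.intro)
      (simp_all add: module_reg_module lin_map_def)
  interpret B: free_with_basis R ?M "{()}" "\<lambda>_. \<one>" "\<lambda>_ x. x" by (rule B)
  interpret T: module R "tpower R p ?M" by (rule module_tpower[OF B.F])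
  let ?c = "B.coord p (replicate p ())"
  have pw: "?c (tpure R p ?M (replicate p x)) = x [^] p" if "x \<in> carrier R" for x
    using B.coord_const_power[of "()" x p] that by simp
  have cl: "tpure R p ?M (replicate p x) \<in> carrier (tpower R p ?M)" if "x \<in> carrier R" for x
    by (rule tpure_closed[OF B.F words_replicate]) (use that in simp)
  have n: "necklace_sum ?M r s \<in> carrier (tpower R p ?M)"
    by (rule necklace_sum_closed[OF B.F]) (use r s in simp_all)
  note c = B.coord_lin_map[OF B.const_word[of "()" p, simplified]]
  have "(r \<oplus> s) [^] p = ?c (tpure R p ?M (replicate p (r \<oplus> s)))" using pw r s by simp
  also have "tpure R p ?M (replicate p (r \<oplus> s)) =
      (tpure R p ?M (replicate p r) \<oplus>\<^bsub>tpower R p ?M\<^esub> tpure R p ?M (replicate p s))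
      \<oplus>\<^bsub>tpower R p ?M\<^esub> cyc_sum ?M p (necklace_sum ?M r s)"
    using tpure_power_add[OF B.F, of r s] r s by simp
  also have "?c \<dots> = r [^] p \<oplus> s [^] p"
    using r s coord_const_cyc_sum[OF B _ n, of "()"]
    by (simp add: lin_map_add[OF c] cl pw lin_map_closed[OF cyc_sum_lin_map[OF B.F] n])
  finally show ?thesis .
qed

lemma frob_simps [simp]:
  "carrier (frob R p M) = carrier M" "add (frob R p M) = add M" "zero (frob R p M) = zero M"
  "r \<odot>\<^bsub>frob R p M\<^esub> x = (r [^] p) \<odot>\<^bsub>M\<^esub> x"
  by (simp_all add: frob_def)

lemma module_frob:
  assumes "module R M" shows "module R (frob R p M)"
proof -
  interpret M: module R M by fact
  have "add_monoid (frob R p M) = add_monoid M" by (simp add: frob_def)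
  then have "abelian_group (frob R p M)"
    using M.abelian_group_axioms
    by (simp add: abelian_group_def abelian_monoid_def abelian_group_axioms_def)
  then show ?thesis
    by (rule moduleI[OF is_cring])
      (auto simp: M.smult_l_distr M.smult_r_distr M.smult_assoc1[symmetric] frobenius_add nat_pow_distrib nat_pow_one)
qed

lemma module_R1: "module R (R1 R p)"
  unfolding R1_def by (rule module_frob[OF module_reg_module])

lemma R1_simps [simp]:
  "carrier (R1 R p) = carrier R" "\<zero>\<^bsub>R1 R p\<^esub> = \<zero>" "x \<oplus>\<^bsub>R1 R p\<^esub> y = x \<oplus> y"
  "r \<odot>\<^bsub>R1 R p\<^esub> x = (r [^] p) \<otimes> x"
  by (simp_all add: R1_def)

lemma module_V1: "module R V \<Longrightarrow> module R (V1 R p V)"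
  unfolding V1_def by (rule module_tensor[OF module_R1])

lemma scaled_power_closed:
  "module R V \<Longrightarrow> r \<in> carrier R \<Longrightarrow> v \<in> carrier V \<Longrightarrow> scaled_power R p V r v \<in> carrier (tpower R p V)"
  unfolding scaled_power_def
  by (intro module.smult_closed[OF module_tpower] tpure_closed words_replicate)

lemma tpower_map_scaled_power:
  assumes V: "module R V" and W: "module R W" and f: "lin_map R V W f"
    and r: "r \<in> carrier R" and v: "v \<in> carrier V"
  shows "tpower_map R p V W f (scaled_power R p V r v) = scaled_power R p W r (f v)"
  unfolding scaled_power_def
  using words_replicate[OF v, of p]
  by (simp add: lin_map_smult[OF tpower_map_lin_map[OF V W f] r] tpure_closed[OF V] tpower_map_tpure[OF V W f])

lemma scaled_power_smult:
  assumes V: "module R V" and r: "r \<in> carrier R" and s: "s \<in> carrier R" and v: "v \<in> carrier V"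
  shows "scaled_power R p V r (s \<odot>\<^bsub>V\<^esub> v) = (s [^] p) \<odot>\<^bsub>tpower R p V\<^esub> scaled_power R p V r v"
proof -
  interpret T: module R "tpower R p V" by (rule module_tpower[OF V])
  show ?thesis
    using tpure_smult_all[OF V s words_replicate[OF v, of p]] r s tpure_closed[OF V words_replicate[OF v, of p]]
    by (simp add: scaled_power_def T.smult_assoc1[symmetric] m_comm)
qed

text \<open>
  For the additivity in \<open>v\<close>, the mixed terms of the binomial formula add up to a trace, and a trace
  becomes divisible by \<open>p\<close> in the coinvariants.
\<close>

lemma psi_bilinear:
  assumes V: "module R V"
  shows "bilinear (R1 R p) V (frob R p (coinv R p V)) (\<lambda>(r, v). coinv_class R p V (scaled_power R p V r v))"
proof -
  interpret V: module R V by fact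
  interpret T: module R "tpower R p V" by (rule module_tpower[OF V])
  interpret C: module R "coinv R p V" by (rule module_coinv[OF V])
  note q = coinv_class_lin_map[OF V, of p]
  note pc = tpure_closed[OF V words_replicate[of _ V p]]
  have cs: "cyc_sum V p (necklace_sum V v w) \<in> carrier (tpower R p V)"
    if "v \<in> carrier V" "w \<in> carrier V" for v w
    by (rule lin_map_closed[OF cyc_sum_lin_map[OF V] necklace_sum_closed[OF V that]])
  have z: "coinv_class R p V (cyc_sum V p (necklace_sum V v w)) = \<zero>\<^bsub>coinv R p V\<^esub>"
    if "v \<in> carrier V" "w \<in> carrier V" for v w
    using coinv_class_cyc_sum[OF V necklace_sum_closed[OF V that]]
      module_char[OF module_coinv[OF V]] lin_map_closed[OF q necklace_sum_closed[OF V that]] by simp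
  show ?thesis
    unfolding bilinear_def
  proof (intro conjI ballI)
    fix r assume "r \<in> carrier (R1 R p)"
    then have r: "r \<in> carrier R" by simp
    show "lin_map R V (frob R p (coinv R p V)) (\<lambda>v. case (r, v) of (r, v) \<Rightarrow> coinv_class R p V (scaled_power R p V r v))"
    proof (rule lin_mapI; simp only: frob_simps split)
      fix v w assume vw: "v \<in> carrier V" "w \<in> carrier V"
      show "coinv_class R p V (scaled_power R p V r (v \<oplus>\<^bsub>V\<^esub> w)) =
          coinv_class R p V (scaled_power R p V r v) \<oplus>\<^bsub>coinv R p V\<^esub> coinv_class R p V (scaled_power R p V r w)"
        using r vw
        by (simp add: scaled_power_def tpure_power_add[OF V] lin_map_smult[OF q] lin_map_add[OF q] pc cs z
            lin_map_closed[OF q] C.smult_r_distr)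
    qed (use r in \<open>simp_all add: lin_map_closed[OF q] scaled_power_closed[OF V] scaled_power_smult[OF V] lin_map_smult[OF q]\<close>)
  next
    fix v assume v: "v \<in> carrier V"
    show "lin_map R (R1 R p) (frob R p (coinv R p V)) (\<lambda>r. case (r, v) of (r, v) \<Rightarrow> coinv_class R p V (scaled_power R p V r v))"
      by (rule lin_mapI)
        (use v in \<open>simp_all add: lin_map_closed[OF q] scaled_power_closed[OF V] scaled_power_def pc
          lin_map_smult[OF q] C.smult_l_distr C.smult_assoc1\<close>)
  qed
qed

lemma psi_lin_map:
  assumes V: "module R V"
  shows "lin_map R (V1 R p V) (frob R p (coinv R p V)) (psi R p V)"
proof -
  have "psi R p V \<in> lin_hom R (V1 R p V) (frob R p (coinv R p V))"
    unfolding psi_def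
    by (rule lin_map_restrict[OF _ module_V1[OF V]])
      (unfold V1_def, rule tensor_lift(1)[OF module_R1 V module_frob[OF module_coinv[OF V]] psi_bilinear[OF V]])
  then show ?thesis by (simp add: lin_hom_iff)
qed

lemma pure_V1_closed: "module R V \<Longrightarrow> r \<in> carrier R \<Longrightarrow> v \<in> carrier V \<Longrightarrow> pure R (R1 R p) V r v \<in> carrier (V1 R p V)"
  unfolding V1_def by (rule pure_closed[OF module_R1]) auto

lemma psi_pure:
  assumes V: "module R V" and r: "r \<in> carrier R" and v: "v \<in> carrier V"
  shows "psi R p V (pure R (R1 R p) V r v) = coinv_class R p V (scaled_power R p V r v)"
  using tensor_lift(2)[OF module_R1 V module_frob[OF module_coinv[OF V]] psi_bilinear[OF V], of r v] r v
  by (simp add: psi_def pure_V1_closed[OF V])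

lemma pure_V1_add_left:
  "module R V \<Longrightarrow> r \<in> carrier R \<Longrightarrow> s \<in> carrier R \<Longrightarrow> v \<in> carrier V \<Longrightarrow>
    pure R (R1 R p) V (r \<oplus> s) v = pure R (R1 R p) V r v \<oplus>\<^bsub>V1 R p V\<^esub> pure R (R1 R p) V s v"
  using lin_map_add[OF pure_lin_left[OF module_R1], of V v r s] by (simp add: V1_def)

lemma pure_V1_balanced:
  assumes V: "module R V" and rs: "r \<in> carrier R" "s \<in> carrier R" and v: "v \<in> carrier V"
  shows "pure R (R1 R p) V r (s \<odot>\<^bsub>V\<^esub> v) = pure R (R1 R p) V ((s [^] p) \<otimes> r) v"
  using lin_map_smult[OF pure_lin_right[OF module_R1 V, of r] _ v, of s]
    lin_map_smult[OF pure_lin_left[OF module_R1 V v], of s r] rs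
  by simp


section \<open>Functoriality of the cyclic powers complex\<close>

lemma cycC1_simps [simp]:
  "carrier (cycC1 R p V) = carrier (coinv R p V)" "add (cycC1 R p V) = add (coinv R p V)"
  "zero (cycC1 R p V) = zero (coinv R p V)"
  "r \<odot>\<^bsub>cycC1 R p V\<^esub> x = (r [^] p) \<odot>\<^bsub>coinv R p V\<^esub> x"
  by (simp_all add: cycC1_def)

lemma module_cycC1: "module R V \<Longrightarrow> module R (cycC1 R p V)"
  unfolding cycC1_def by (rule module_frob[OF module_coinv])

lemma cycC1_map_class:
  assumes V: "module R V" and W: "module R W" and f: "lin_map R V W f" and x: "x \<in> carrier (tpower R p V)"
  shows "cycC1_map R p V W f (coinv_class R p V x) = coinv_class R p W (tpower_map R p V W f x)"
proof -
  note m = tpower_map_lin_map[OF V W f, of p]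
  have "the_elem ((\<lambda>x. coinv_class R p W (tpower_map R p V W f x)) ` coinv_class R p V x) =
      coinv_class R p W (tpower_map R p V W f x)"
    by (rule coinv_descend(1)[OF V module_coinv[OF W] lin_map_comp[OF m coinv_class_lin_map[OF W]] _ x])
      (simp add: tpower_map_cyc[OF V W f] coinv_class_cyc[OF W] lin_map_closed[OF m])
  then show ?thesis using x by (simp add: cycC1_map_def carrier_coinv[OF V])
qed

lemma cycC1_map_psi_pure:
  assumes V: "module R V" and W: "module R W" and f: "lin_map R V W f"
    and r: "r \<in> carrier R" and v: "v \<in> carrier V"
  shows "cycC1_map R p V W f (psi R p V (pure R (R1 R p) V r v)) = psi R p W (pure R (R1 R p) W r (f v))"
  by (simp add: psi_pure[OF V r v] psi_pure[OF W r lin_map_closed[OF f v]]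
      cycC1_map_class[OF V W f scaled_power_closed[OF V r v]] tpower_map_scaled_power[OF V W f r v])

lemma cycC1_map_homothety:
  assumes V: "module R V" and r: "r \<in> carrier R" and f: "\<And>v. v \<in> carrier V \<Longrightarrow> f v = r \<odot>\<^bsub>V\<^esub> v"
    and y: "y \<in> carrier (cycC1 R p V)"
  shows "cycC1_map R p V V f y = r \<odot>\<^bsub>cycC1 R p V\<^esub> y"
proof -
  have fl: "lin_map R V V f" by (rule lin_map_cong[OF homothety_lin_map[OF V r] V]) (simp add: f)
  obtain x where x: "x \<in> carrier (tpower R p V)" "y = coinv_class R p V x"
    using y by (auto simp: carrier_coinv[OF V])
  show ?thesis
    using r by (simp add: x(2) cycC1_map_class[OF V V fl x(1)] tpower_map_homothety[OF V r x(1) f]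
        lin_map_smult[OF coinv_class_lin_map[OF V] _ x(1)])
qed

end

section \<open>The map \<psi>-hat and the fibre product for free modules\<close>

lemma invar_simps [simp]:
  "carrier (invar R n V) = {x \<in> carrier (tpower R n V). cyc R n V x = x}"
  "add (invar R n V) = add (tpower R n V)" "zero (invar R n V) = zero (tpower R n V)"
  "r \<odot>\<^bsub>invar R n V\<^esub> x = r \<odot>\<^bsub>tpower R n V\<^esub> x"
  by (simp_all add: invar_def)

context cring_char
begin

lemma cycC0_carrier_iff:
  "X \<in> carrier (cycC0 R p V) \<longleftrightarrow> fst X \<in> carrier (tpower R p V) \<and> cyc R p V (fst X) = fst X \<and>
    snd X \<in> carrier V \<and> psi_hat R p V (fst X) = Fr R p V (snd X)"
  by (cases X) (auto simp: cycC0_def Let_def)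

lemma cycC0_simps [simp]:
  "\<zero>\<^bsub>cycC0 R p V\<^esub> = (\<zero>\<^bsub>tpower R p V\<^esub>, \<zero>\<^bsub>V\<^esub>)"
  "X \<oplus>\<^bsub>cycC0 R p V\<^esub> Y = (fst X \<oplus>\<^bsub>tpower R p V\<^esub> fst Y, snd X \<oplus>\<^bsub>V\<^esub> snd Y)"
  "r \<odot>\<^bsub>cycC0 R p V\<^esub> X = ((r [^] p) \<odot>\<^bsub>tpower R p V\<^esub> fst X, r \<odot>\<^bsub>V\<^esub> snd X)"
  by (simp_all add: cycC0_def Let_def case_prod_beta)

lemma scaled_power_one:
  assumes V: "module R V" and v: "v \<in> carrier V"
  shows "scaled_power R p V \<one> v = tpure R p V (replicate p v)"
proof -
  interpret T: module R "tpower R p V" by (rule module_tpower[OF V])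
  show ?thesis using tpure_closed[OF V words_replicate[OF v]] by (simp add: scaled_power_def)
qed

lemma scaled_power_invariant:
  assumes V: "module R V" and r: "r \<in> carrier R" and v: "v \<in> carrier V"
  shows "cyc R p V (scaled_power R p V r v) = scaled_power R p V r v"
  unfolding scaled_power_def
  by (simp add: lin_map_smult[OF cyc_lin_map[OF V] r tpure_closed[OF V words_replicate[OF v]]] cyc_power[OF V v])

end

locale char_free = cring_char R p + free_with_basis R F I b \<kappa>
  for R :: "('a, 'k) ring_scheme" (structure) and p and F :: "('a, 'f, 'x) module_scheme"
    and I :: "'i set" and b and \<kappa>
begin

lemma basis_char: "free_with_basis R F I b \<kappa>" by (rule free_with_basis_axioms)

text \<open>
  The coordinate dual to \<open>1 \<otimes> b i\<close>. It is Frobenius-semilinear in \<open>v\<close>, as the twist requires.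
\<close>

definition V1_coord :: "'i \<Rightarrow> ('a \<times> 'f \<Rightarrow> 'a) set \<Rightarrow> 'a" where
  "V1_coord i X = the_elem (lin_ext R (R1 R p) (\<lambda>(m, v). (\<kappa> i v [^] p) \<otimes> m) ` X)"

context
  fixes i assumes i: "i \<in> I"
begin

lemma V1_coord_bilinear: "bilinear (R1 R p) F (R1 R p) (\<lambda>(m, v). (\<kappa> i v [^] p) \<otimes> m)"
proof -
  interpret FM: module R F by (rule F)
  have add: "\<kappa> i (v \<oplus>\<^bsub>F\<^esub> w) = \<kappa> i v \<oplus> \<kappa> i w" if "v \<in> carrier F" "w \<in> carrier F" for v w
    using lin_map_add[OF \<kappa>_lin_map[OF i]] that by simp
  have smult: "\<kappa> i (r \<odot>\<^bsub>F\<^esub> v) = r \<otimes> \<kappa> i v" if "r \<in> carrier R" "v \<in> carrier F" for r v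
    using lin_map_smult[OF \<kappa>_lin_map[OF i]] that by simp
  note cl = \<kappa>_closed[OF i]
  show ?thesis
    unfolding bilinear_def
  proof (intro conjI ballI)
    fix m assume "m \<in> carrier (R1 R p)"
    then have m: "m \<in> carrier R" by simp
    show "lin_map R F (R1 R p) (\<lambda>v. case (m, v) of (m, v) \<Rightarrow> (\<kappa> i v [^] p) \<otimes> m)"
      by (rule lin_mapI) (use m in \<open>simp_all add: cl add smult frobenius_add l_distr nat_pow_distrib m_assoc\<close>)
  next
    fix v assume v: "v \<in> carrier F"
    show "lin_map R (R1 R p) (R1 R p) (\<lambda>m. case (m, v) of (m, v) \<Rightarrow> (\<kappa> i v [^] p) \<otimes> m)"
      by (rule lin_mapI) (use v in \<open>simp_all add: cl r_distr m_lcomm\<close>)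
  qed
qed

lemma V1_coord_lin_map: "lin_map R (V1 R p F) (R1 R p) (V1_coord i)"
  unfolding V1_def V1_coord_def[abs_def] by (rule tensor_lift(1)[OF module_R1 F module_R1 V1_coord_bilinear])

lemma V1_coord_pure:
  "m \<in> carrier R \<Longrightarrow> v \<in> carrier F \<Longrightarrow> V1_coord i (pure R (R1 R p) F m v) = (\<kappa> i v [^] p) \<otimes> m"
  unfolding V1_coord_def using tensor_lift(2)[OF module_R1 F module_R1 V1_coord_bilinear, of m v] by simp

end

lemma pure_basis_lin_map: "i \<in> I \<Longrightarrow> lin_map R (R1 R p) (V1 R p F) (\<lambda>m. pure R (R1 R p) F m (b i))"
  unfolding V1_def by (rule pure_lin_left[OF module_R1 F basis_closed])

lemma pure_expansion:
  assumes r: "r \<in> carrier R" and v: "v \<in> carrier F"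
  shows "pure R (R1 R p) F r v = (\<Oplus>\<^bsub>V1 R p F\<^esub>i\<in>I. pure R (R1 R p) F ((\<kappa> i v [^] p) \<otimes> r) (b i))"
proof -
  interpret FM: module R F by (rule F)
  interpret V1: module R "V1 R p F" by (rule module_V1[OF F])
  have L: "lin_map R F (V1 R p F) (pure R (R1 R p) F r)"
    unfolding V1_def by (rule pure_lin_right[OF module_R1 F]) (use r in simp)
  have "pure R (R1 R p) F r v = pure R (R1 R p) F r (\<Oplus>\<^bsub>F\<^esub>i\<in>I. \<kappa> i v \<odot>\<^bsub>F\<^esub> b i)"
    using basis_expansion[OF v] by simp
  also have "\<dots> = (\<Oplus>\<^bsub>V1 R p F\<^esub>i\<in>I. pure R (R1 R p) F r (\<kappa> i v \<odot>\<^bsub>F\<^esub> b i))"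
    by (rule lin_map_finsum[OF L F module_V1[OF F] finite_basis]) (use \<kappa>_closed v basis_closed in auto)
  also have "\<dots> = (\<Oplus>\<^bsub>V1 R p F\<^esub>i\<in>I. pure R (R1 R p) F ((\<kappa> i v [^] p) \<otimes> r) (b i))"
    by (rule V1.finsum_cong')
      (use r v \<kappa>_closed basis_closed pure_V1_closed[OF F] in \<open>auto simp: pure_V1_balanced[OF F]\<close>)
  finally show ?thesis .
qed

lemma V1_expansion:
  assumes X: "X \<in> carrier (V1 R p F)"
  shows "X = (\<Oplus>\<^bsub>V1 R p F\<^esub>i\<in>I. pure R (R1 R p) F (V1_coord i X) (b i))"
proof (rule lin_map_eq_on_generators[OF module_V1[OF F] module_V1[OF F] _ _ _ _ X])
  show "lin_map R (V1 R p F) (V1 R p F) (\<lambda>X. X)" by (simp add: lin_map_def)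
  show "lin_map R (V1 R p F) (V1 R p F) (\<lambda>X. \<Oplus>\<^bsub>V1 R p F\<^esub>i\<in>I. pure R (R1 R p) F (V1_coord i X) (b i))"
    by (rule lin_map_sum[OF module_V1[OF F] module_V1[OF F]
        lin_map_comp[OF V1_coord_lin_map pure_basis_lin_map] finite_basis])
  show "submodule_hull R (V1 R p F) ((\<lambda>(x, y). pure R (R1 R p) F x y) ` (carrier (R1 R p) \<times> carrier F)) =
      carrier (V1 R p F)"
    unfolding V1_def by (rule tensor_generated[OF module_R1 F])
  fix Y assume "Y \<in> (\<lambda>(x, y). pure R (R1 R p) F x y) ` (carrier (R1 R p) \<times> carrier F)"
  then obtain m v where mv: "m \<in> carrier R" "v \<in> carrier F" "Y = pure R (R1 R p) F m v" by auto
  interpret V1: module R "V1 R p F" by (rule module_V1[OF F])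
  have "Y = (\<Oplus>\<^bsub>V1 R p F\<^esub>i\<in>I. pure R (R1 R p) F ((\<kappa> i v [^] p) \<otimes> m) (b i))"
    unfolding mv(3) by (rule pure_expansion[OF mv(1,2)])
  also have "\<dots> = (\<Oplus>\<^bsub>V1 R p F\<^esub>i\<in>I. pure R (R1 R p) F (V1_coord i Y) (b i))"
    by (rule V1.finsum_cong')
      (use mv \<kappa>_closed basis_closed pure_V1_closed[OF F] in \<open>auto simp: V1_coord_pure\<close>)
  finally show "Y = (\<Oplus>\<^bsub>V1 R p F\<^esub>i\<in>I. pure R (R1 R p) F (V1_coord i Y) (b i))" .
qed

abbreviation const_coord :: "'i \<Rightarrow> ('f list \<Rightarrow> 'a) set \<Rightarrow> 'a" where
  "const_coord i \<equiv> coord p (replicate p i)"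

lemma const_coord_scaled_power:
  assumes i: "i \<in> I" and r: "r \<in> carrier R" and v: "v \<in> carrier F"
  shows "const_coord i (scaled_power R p F r v) = (\<kappa> i v [^] p) \<otimes> r"
  unfolding scaled_power_def
  by (subst lin_map_smult[OF coord_lin_map[OF const_word[OF i]] r tpure_closed[OF F words_replicate[OF v]]])
    (use i r v \<kappa>_closed in \<open>simp add: coord_const_power m_comm\<close>)

lemma invariant_decomposition':
  assumes t: "t \<in> carrier (tpower R p F)" and inv: "cyc R p F t = t"
  shows "\<exists>z\<in>carrier (tpower R p F). t =
    (\<Oplus>\<^bsub>tpower R p F\<^esub>i\<in>I. scaled_power R p F (const_coord i t) (b i)) \<oplus>\<^bsub>tpower R p F\<^esub> cyc_sum F p z"
proof
  interpret T: module R "tpower R p F" by (rule module_tpower[OF F])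
  let ?z = "\<Oplus>\<^bsub>tpower R p F\<^esub>w\<in>necklaces p I. coord p w t \<odot>\<^bsub>tpower R p F\<^esub> tpure R p F (map b w)"
  show "t = (\<Oplus>\<^bsub>tpower R p F\<^esub>i\<in>I. scaled_power R p F (const_coord i t) (b i))
      \<oplus>\<^bsub>tpower R p F\<^esub> cyc_sum F p ?z"
    unfolding scaled_power_def by (rule invariant_decomposition[OF p t inv])
  have "w \<in> index_words p" if "w \<in> necklaces p I" for w
    using that necklaces_subset[of p I] by (auto simp: index_words_def nonconst_words_def)
  then show "?z \<in> carrier (tpower R p F)"
    using coord_closed t tpure_closed[OF F basis_word] by (intro T.finsum_closed) auto
qed

text \<open>
  On a free module, \<open>\<psi>\<close>-hat reads off the coordinates at the constant words.
\<close>

definition psi_hat_formula :: "('f list \<Rightarrow> 'a) set \<Rightarrow> ('a \<times> 'f \<Rightarrow> 'a) set" where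
  "psi_hat_formula t = (\<Oplus>\<^bsub>V1 R p F\<^esub>i\<in>I. pure R (R1 R p) F (const_coord i t) (b i))"

lemma psi_hat_formula_lin_map: "lin_map R (frob R p (invar R p F)) (V1 R p F) psi_hat_formula"
proof -
  have "lin_map R (frob R p (invar R p F)) (R1 R p) (const_coord i)" if i: "i \<in> I" for i
    using coord_lin_map[OF const_word[OF i], of p] by (auto simp: lin_map_def Pi_def)
  then show ?thesis
    unfolding psi_hat_formula_def[abs_def]
    by (rule lin_map_sum[OF module_V1[OF F] module_frob[OF module_invar[OF F]]
        lin_map_comp[OF _ pure_basis_lin_map] finite_basis])
qed

lemma psi_hat_formula_scaled_power:
  assumes r: "r \<in> carrier R" and v: "v \<in> carrier F"
  shows "psi_hat_formula (scaled_power R p F r v) = pure R (R1 R p) F r v"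
proof -
  interpret V1: module R "V1 R p F" by (rule module_V1[OF F])
  show ?thesis
    unfolding psi_hat_formula_def pure_expansion[OF r v]
    by (rule V1.finsum_cong')
      (use r v \<kappa>_closed basis_closed pure_V1_closed[OF F] in \<open>auto simp: const_coord_scaled_power\<close>)
qed

lemma psi_hat_formula_trace:
  assumes X: "X \<in> carrier (coinv R p F)"
  shows "psi_hat_formula (trace R p F X) = \<zero>\<^bsub>V1 R p F\<^esub>"
proof -
  interpret V1: module R "V1 R p F" by (rule module_V1[OF F])
  obtain x where x: "x \<in> carrier (tpower R p F)" "X = coinv_class R p F x"
    using X by (auto simp: carrier_coinv[OF F])
  have "pure R (R1 R p) F \<zero> (b i) = \<zero>\<^bsub>V1 R p F\<^esub>" if "i \<in> I" for i
    using lin_map_zero[OF pure_basis_lin_map[OF that] module_R1 module_V1[OF F]] by simp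
  then show ?thesis
    unfolding psi_hat_formula_def x(2) trace_coinv_class[OF F x(1)]
    by (intro V1.add.finprod_one_eqI) (simp add: coord_const_cyc_sum[OF basis_char _ x(1)])
qed

text \<open>
  The formula satisfies the conditions that define \<open>\<psi>\<close>-hat. No other map does, because the invariants are
  generated by the multiples of the powers of basis elements and the traces.
\<close>

lemma psi_hat_eq:
  assumes t: "t \<in> carrier (tpower R p F)" "cyc R p F t = t"
  shows "psi_hat R p F t = psi_hat_formula t"
proof -
  let ?I = "frob R p (invar R p F)"
  interpret T: module R "tpower R p F" by (rule module_tpower[OF F])
  interpret IM: module R ?I by (rule module_frob[OF module_invar[OF F]])
  interpret V1: module R "V1 R p F" by (rule module_V1[OF F])
  let ?P = "\<lambda>h. h \<in> lin_hom R ?I (V1 R p F) \<and>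
     (\<forall>X \<in> carrier (coinv R p F). h (trace R p F X) = \<zero>\<^bsub>V1 R p F\<^esub>) \<and>
     (\<forall>r \<in> carrier R. \<forall>v \<in> carrier F. h (scaled_power R p F r v) = pure R (R1 R p) F r v)"
  define h where "h = restrict psi_hat_formula (carrier ?I)"
  have sI: "scaled_power R p F r v \<in> carrier ?I" if "r \<in> carrier R" "v \<in> carrier F" for r v
    using that by (simp add: scaled_power_closed[OF F] scaled_power_invariant[OF F])
  have tI: "cyc_sum F p x \<in> carrier ?I" if "x \<in> carrier (tpower R p F)" for x
    using that lin_map_closed[OF cyc_sum_lin_map[OF F]] cyc_cyc_sum[OF F] by simp
  have trI: "trace R p F X \<in> carrier ?I" if "X \<in> carrier (coinv R p F)" for X
    using that tI trace_coinv_class[OF F] by (auto simp: carrier_coinv[OF F])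
  have "psi_hat R p F = h"
    unfolding psi_hat_def
  proof (rule the_equality)
    show "?P h"
    proof (intro conjI ballI)
      show "h \<in> lin_hom R ?I (V1 R p F)"
        unfolding h_def by (rule lin_map_restrict[OF psi_hat_formula_lin_map module_frob[OF module_invar[OF F]]])
      show "h (trace R p F X) = \<zero>\<^bsub>V1 R p F\<^esub>" if "X \<in> carrier (coinv R p F)" for X
        unfolding h_def restrict_apply'[OF trI[OF that]] by (rule psi_hat_formula_trace[OF that])
      show "h (scaled_power R p F r v) = pure R (R1 R p) F r v" if "r \<in> carrier R" "v \<in> carrier F" for r v
        unfolding h_def restrict_apply'[OF sI[OF that]] by (rule psi_hat_formula_scaled_power[OF that])
    qed
    fix g assume g: "?P g"
    then have gl: "lin_map R ?I (V1 R p F) g" and ge: "g \<in> extensional (carrier ?I)"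
      by (auto simp: lin_hom_iff)
    have "g t = psi_hat_formula t" if t: "t \<in> carrier ?I" for t
    proof -
      have tT: "t \<in> carrier (tpower R p F)" "cyc R p F t = t" using t by simp_all
      let ?s = "\<lambda>i. scaled_power R p F (const_coord i t) (b i)"
      have cR: "const_coord i t \<in> carrier R" if "i \<in> I" for i
        by (rule coord_closed[OF const_word[OF that] tT(1)])
      have sc: "?s \<in> I \<rightarrow> carrier ?I" using sI cR basis_closed by blast
      obtain z where z: "z \<in> carrier (tpower R p F)"
        "t = (\<Oplus>\<^bsub>tpower R p F\<^esub>i\<in>I. ?s i) \<oplus>\<^bsub>tpower R p F\<^esub> cyc_sum F p z"
        using invariant_decomposition'[OF tT] by blast
      \<comment> \<open>The inclusion is linear, so sums of invariants may be formed in the tensor power.\<close>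
      have "lin_map R (invar R p F) (tpower R p F) (\<lambda>x. x)" by (simp add: lin_map_def)
      from lin_map_finsum[OF this module_invar[OF F] module_tpower[OF F] finite_basis, of ?s] sc
      have "(\<Oplus>\<^bsub>invar R p F\<^esub>i\<in>I. ?s i) = (\<Oplus>\<^bsub>tpower R p F\<^esub>i\<in>I. ?s i)" by simp
      moreover have "(\<Oplus>\<^bsub>?I\<^esub>i\<in>I. ?s i) = (\<Oplus>\<^bsub>invar R p F\<^esub>i\<in>I. ?s i)"
        by (simp add: finsum_def frob_def)
      ultimately have "g t = g ((\<Oplus>\<^bsub>?I\<^esub>i\<in>I. ?s i) \<oplus>\<^bsub>?I\<^esub> cyc_sum F p z)"
        using z(2) by simp
      also have "\<dots> = g (\<Oplus>\<^bsub>?I\<^esub>i\<in>I. ?s i) \<oplus>\<^bsub>V1 R p F\<^esub> g (cyc_sum F p z)"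
        by (rule lin_map_add[OF gl IM.finsum_closed[OF sc] tI[OF z(1)]])
      also have "g (cyc_sum F p z) = \<zero>\<^bsub>V1 R p F\<^esub>"
      proof -
        have "coinv_class R p F z \<in> carrier (coinv R p F)" using z(1) by (simp add: carrier_coinv[OF F])
        then show ?thesis using g trace_coinv_class[OF F z(1)] by metis
      qed
      also have "g (\<Oplus>\<^bsub>?I\<^esub>i\<in>I. ?s i) = (\<Oplus>\<^bsub>V1 R p F\<^esub>i\<in>I. g (?s i))"
        by (rule lin_map_finsum[OF gl module_frob[OF module_invar[OF F]] module_V1[OF F] finite_basis sc])
      also have "\<dots> = psi_hat_formula t"
        unfolding psi_hat_formula_def
        by (rule V1.finsum_cong') (use g cR basis_closed pure_V1_closed[OF F] in auto)
      finally show ?thesis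
        using lin_map_closed[OF psi_hat_formula_lin_map t] by simp
    qed
    then show "g = h"
      unfolding h_def by (intro extensionalityI[OF ge restrict_extensional]) simp
  qed
  then show ?thesis using t by (simp add: h_def)
qed

lemma power_in_cycC0:
  assumes v: "v \<in> carrier F"
  shows "(tpure R p F (replicate p v), v) \<in> carrier (cycC0 R p F)"
proof -
  have "psi_hat R p F (tpure R p F (replicate p v)) = Fr R p F v"
    using psi_hat_eq[OF tpure_closed[OF F words_replicate[OF v]] cyc_power[OF F v]]
      psi_hat_formula_scaled_power[OF one_closed v] v
    by (simp add: scaled_power_one[OF F v] Fr_def)
  then show ?thesis
    using v by (simp add: cycC0_carrier_iff tpure_closed[OF F words_replicate[OF v]] cyc_power[OF F v])
qed

text \<open>
  Since \<open>\<psi>\<close>-hat reads off the coordinates at constant words, membership of \<open>(t, v)\<close> in the fibre product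
  means that \<open>t\<close> and \<open>v \<otimes> \<dots> \<otimes> v\<close> have the same coordinates there. The difference of two such invariant
  tensors consists of a trace only.
\<close>

lemma cycC0_trace:
  assumes X: "(t, v) \<in> carrier (cycC0 R p F)"
  shows "\<exists>z\<in>carrier (tpower R p F). t = tpure R p F (replicate p v) \<oplus>\<^bsub>tpower R p F\<^esub> cyc_sum F p z"
proof -
  interpret T: module R "tpower R p F" by (rule module_tpower[OF F])
  interpret V1: module R "V1 R p F" by (rule module_V1[OF F])
  interpret R1: module R "R1 R p" by (rule module_R1)
  have t: "t \<in> carrier (tpower R p F)" "cyc R p F t = t" and v: "v \<in> carrier F"
    and eq: "psi_hat R p F t = Fr R p F v"
    using X by (auto simp: cycC0_carrier_iff)
  let ?w = "tpure R p F (replicate p v)"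
  have w: "?w \<in> carrier (tpower R p F)" "cyc R p F ?w = ?w"
    by (rule tpure_closed[OF F words_replicate[OF v]], rule cyc_power[OF F v])
  have c: "const_coord i t = \<kappa> i v [^] p" if i: "i \<in> I" for i
  proof -
    have cR: "const_coord j t \<in> carrier R" if "j \<in> I" for j
      by (rule coord_closed[OF const_word[OF that] t(1)])
    have "V1_coord i (psi_hat_formula t) =
        (\<Oplus>\<^bsub>R1 R p\<^esub>j\<in>I. V1_coord i (pure R (R1 R p) F (const_coord j t) (b j)))"
      unfolding psi_hat_formula_def
      by (rule lin_map_finsum[OF V1_coord_lin_map[OF i] module_V1[OF F] module_R1 finite_basis])
        (use cR basis_closed pure_V1_closed[OF F] in auto)
    also have "\<dots> = (\<Oplus>\<^bsub>R1 R p\<^esub>j\<in>I. if i = j then const_coord j t else \<zero>\<^bsub>R1 R p\<^esub>)"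
      by (rule R1.finsum_cong')
        (use cR i basis_closed p_pos in \<open>auto simp: V1_coord_pure[OF i] \<kappa>_basis nat_pow_zero\<close>)
    also have "\<dots> = const_coord i t"
      by (rule R1.finsum_singleton[OF i finite_basis]) (use cR in auto)
    finally show ?thesis
      using eq psi_hat_eq[OF t] v \<kappa>_closed[OF i v] V1_coord_pure[OF i one_closed v] by (simp add: Fr_def)
  qed
  have d: "t \<ominus>\<^bsub>tpower R p F\<^esub> ?w \<in> carrier (tpower R p F)" using t w by simp
  have dc: "const_coord i (t \<ominus>\<^bsub>tpower R p F\<^esub> ?w) = \<zero>" if i: "i \<in> I" for i
    using lin_map_minus[OF coord_lin_map[OF const_word[OF i]] module_tpower[OF F] module_reg_module t(1) w(1)]
      c[OF i] coord_const_power[OF i v] \<kappa>_closed[OF i v] 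
      abelian_group.minus_eq_zero_iff[OF module.axioms(2)[OF module_reg_module], of "\<kappa> i v [^] p" "\<kappa> i v [^] p"]
    by simp
  have di: "cyc R p F (t \<ominus>\<^bsub>tpower R p F\<^esub> ?w) = t \<ominus>\<^bsub>tpower R p F\<^esub> ?w"
    by (simp add: lin_map_minus[OF cyc_lin_map[OF F] module_tpower[OF F] module_tpower[OF F] t(1) w(1)] t w)
  obtain z where z: "z \<in> carrier (tpower R p F)" "t \<ominus>\<^bsub>tpower R p F\<^esub> ?w =
      (\<Oplus>\<^bsub>tpower R p F\<^esub>i\<in>I. scaled_power R p F (const_coord i (t \<ominus>\<^bsub>tpower R p F\<^esub> ?w)) (b i))
      \<oplus>\<^bsub>tpower R p F\<^esub> cyc_sum F p z"
    using invariant_decomposition'[OF d di] by blast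
  have "(\<Oplus>\<^bsub>tpower R p F\<^esub>i\<in>I. scaled_power R p F (const_coord i (t \<ominus>\<^bsub>tpower R p F\<^esub> ?w)) (b i)) =
      \<zero>\<^bsub>tpower R p F\<^esub>"
    by (rule T.add.finprod_one_eqI)
      (simp add: dc scaled_power_def tpure_closed[OF F words_replicate[OF basis_closed]])
  moreover have "cyc_sum F p z \<in> carrier (tpower R p F)" by (rule lin_map_closed[OF cyc_sum_lin_map[OF F] z(1)])
  ultimately have "t \<ominus>\<^bsub>tpower R p F\<^esub> ?w = cyc_sum F p z" using z(2) by simp
  moreover have "t = ?w \<oplus>\<^bsub>tpower R p F\<^esub> (t \<ominus>\<^bsub>tpower R p F\<^esub> ?w)"
    using t w by (simp add: T.minus_eq T.a_ac T.r_neg)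
  ultimately show ?thesis using z(1) by metis
qed

text \<open>
  Coordinates at constant words vanish on the boundaries \<open>\<sigma> z - z\<close>.
\<close>

lemma psi_basis_injective:
  assumes i: "i \<in> I" and m: "m \<in> carrier R"
    and eq: "psi R p F (pure R (R1 R p) F m (b i)) = \<zero>\<^bsub>coinv R p F\<^esub>"
  shows "m = \<zero>"
proof -
  note sp = scaled_power_closed[OF F m basis_closed[OF i]]
  have "scaled_power R p F m (b i) \<in> cyc_bd R p F"
    using eq coinv_class_eq_zero_iff[OF F sp] by (simp add: psi_pure[OF F m basis_closed[OF i]])
  then obtain z where z: "z \<in> carrier (tpower R p F)"
    "scaled_power R p F m (b i) = cyc R p F z \<ominus>\<^bsub>tpower R p F\<^esub> z"
    by (auto simp: cyc_bd_def)
  have "const_coord i (scaled_power R p F m (b i)) =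
      const_coord i (cyc R p F z) \<ominus>\<^bsub>reg_module R\<^esub> const_coord i z"
    unfolding z(2)
    by (rule lin_map_minus[OF coord_lin_map[OF const_word[OF i]] module_tpower[OF F] module_reg_module
      cyc_closed[OF F z(1)] z(1)])
  also have "\<dots> = \<zero>"
    using abelian_group.minus_eq_zero_iff[OF module.axioms(2)[OF module_reg_module]]
      coord_closed[OF const_word[OF i] z(1)] by (simp add: coord_const_cyc[OF i z(1)])
  finally show ?thesis
    using const_coord_scaled_power[OF i m basis_closed[OF i]] m i by (simp add: \<kappa>_basis)
qed

end

section \<open>The Witt vector cocycle\<close>

context cring_char
begin

definition witt_cocycle :: "'a \<Rightarrow> 'a \<Rightarrow> 'a" where
  "witt_cocycle r s = (\<Oplus>k \<in> {1..<p}. [((p choose k) div p)] \<cdot> ((r [^] k) \<otimes> (s [^] (p - k))))"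

lemma finprod_if:
  assumes "finite A" and r: "r \<in> carrier R" and s: "s \<in> carrier R"
  shows "(\<Otimes>j\<in>A. if P j then r else s) = r [^] card {j \<in> A. P j} \<otimes> s [^] card {j \<in> A. \<not> P j}"
  using assms(1)
proof (induction A)
  case (insert a A)
  have "{j \<in> insert a A. P j} = (if P a then insert a {j \<in> A. P j} else {j \<in> A. P j})"
    "{j \<in> insert a A. \<not> P j} = (if P a then {j \<in> A. \<not> P j} else insert a {j \<in> A. \<not> P j})" by auto
  then show ?case using insert r s by (simp add: m_ac)
qed simp

lemma necklace_positions:
  assumes "\<epsilon> \<in> necklaces p (UNIV :: bool set)"
  shows "card {j. j < p \<and> \<epsilon> ! j} \<in> {1..<p}"
proof -
  obtain i k where ik: "i < p" "\<epsilon> ! i" "k < p" "\<not> \<epsilon> ! k"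
    using necklace_letters[OF assms] necklace_length[OF assms] by (metis in_set_conv_nth)
  have fin: "finite {j. j < p \<and> \<epsilon> ! j}" by simp
  then have i: "card {j. j < p \<and> \<epsilon> ! j} \<noteq> 0" using ik by auto
  have "k \<in> {..<p} - {j. j < p \<and> \<epsilon> ! j}" "{j. j < p \<and> \<epsilon> ! j} \<subseteq> {..<p}" using ik by auto
  then have "{j. j < p \<and> \<epsilon> ! j} \<subset> {..<p}" by blast
  then have "card {j. j < p \<and> \<epsilon> ! j} < card {..<p}" by (intro psubset_card_mono) simp
  then show ?thesis using i unfolding atLeastLessThan_iff card_lessThan by arith
qed

text \<open>
  The representatives are grouped by the number \<open>k\<close> of letters \<open>True\<close>; each of them contributes \<open>r\<^sup>k s\<^sup>p\<^sup>-\<^sup>k\<close>.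
\<close>

lemma witt_cocycle_necklaces:
  assumes r: "r \<in> carrier R" and s: "s \<in> carrier R"
  shows "(\<Oplus>\<epsilon>\<in>necklaces p UNIV. \<Otimes>j\<in>{..<p}. if \<epsilon> ! j then r else s) = witt_cocycle r s"
proof -
  let ?N = "necklaces p (UNIV :: bool set)"
  let ?g = "\<lambda>k. (r [^] k) \<otimes> (s [^] (p - k))"
  let ?k = "\<lambda>\<epsilon> :: bool list. card {j. j < p \<and> \<epsilon> ! j}"
  let ?Nk = "\<lambda>k. {\<epsilon> \<in> ?N. ?k \<epsilon> = k}"
  have g: "?g k \<in> carrier R" for k using r s by simp
  have monomial: "(\<Otimes>j\<in>{..<p}. if \<epsilon> ! j then r else s) = ?g (?k \<epsilon>)" for \<epsilon> :: "bool list"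
  proof -
    have "{j \<in> {..<p}. \<not> \<epsilon> ! j} = {..<p} - {j. j < p \<and> \<epsilon> ! j}" by auto
    moreover have "{j \<in> {..<p}. \<epsilon> ! j} = {j. j < p \<and> \<epsilon> ! j}" by auto
    moreover have "card ({..<p} - {j. j < p \<and> \<epsilon> ! j}) = p - ?k \<epsilon>"
      by (subst card_Diff_subset) auto
    ultimately show ?thesis using finprod_if[OF _ r s, of "{..<p}" "\<lambda>j. \<epsilon> ! j"] by simp
  qed
  have "?N = (\<Union>k\<in>{1..<p}. ?Nk k)" using necklace_positions by auto
  then have "(\<Oplus>\<epsilon>\<in>?N. \<Otimes>j\<in>{..<p}. if \<epsilon> ! j then r else s) = (\<Oplus>\<epsilon>\<in>(\<Union>k\<in>{1..<p}. ?Nk k). ?g (?k \<epsilon>))"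
    by (simp only: monomial)
  also have "\<dots> = (\<Oplus>k\<in>{1..<p}. \<Oplus>\<epsilon>\<in>?Nk k. ?g (?k \<epsilon>))"
    by (rule add.finprod_UN_disjoint)
      (use finite_bool_necklaces g in \<open>auto simp: pairwise_def disjnt_def\<close>)
  also have "\<dots> = witt_cocycle r s"
    unfolding witt_cocycle_def
  proof (rule finsum_cong'[OF refl])
    fix k assume k: "k \<in> {1..<p}"
    have "(\<Oplus>\<epsilon>\<in>?Nk k. ?g (?k \<epsilon>)) = (\<Oplus>\<epsilon>\<in>?Nk k. ?g k)"
      by (rule finsum_cong'[OF refl]) (use g in auto)
    also have "\<dots> = [card (?Nk k)] \<cdot> ?g k" by (rule add.finprod_const[OF g])
    finally show "(\<Oplus>\<epsilon>\<in>?Nk k. ?g (?k \<epsilon>)) = [((p choose k) div p)] \<cdot> ?g k"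
      using card_necklaces[OF p, of k] k by simp
  qed (use g in auto)
  finally show ?thesis .
qed

lemma witt_cocycle_closed: "r \<in> carrier R \<Longrightarrow> s \<in> carrier R \<Longrightarrow> witt_cocycle r s \<in> carrier R"
  unfolding witt_cocycle_def by (intro finsum_closed) auto

end

text \<open>
  In rank one the tensor power is free on the \<open>p\<close>-th power of the generator, so only one coordinate has
  to be computed.
\<close>

lemma (in char_free) necklace_sum_rank_one:
  assumes I: "I = {i}" and r: "r \<in> carrier R" and s: "s \<in> carrier R"
  shows "necklace_sum F (r \<odot>\<^bsub>F\<^esub> b i) (s \<odot>\<^bsub>F\<^esub> b i) = scaled_power R p F (witt_cocycle r s) (b i)"
proof -
  interpret FM: module R F by (rule F)
  interpret N: module R "reg_module R" by (rule module_reg_module)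
  have i: "i \<in> I" by (simp add: I)
  have iw: "index_words p = {replicate p i}"
  proof
    show "index_words p \<subseteq> {replicate p i}"
    proof
      fix w assume "w \<in> index_words p"
      then have w: "length w = p" "\<And>x. x \<in> set w \<Longrightarrow> x = i"
        unfolding index_words_def by (auto simp: I)
      have "w = replicate p i" by (rule replicate_eqI) (rule w)+
      then show "w \<in> {replicate p i}" by blast
    qed
  qed (use const_word[OF i] in simp)
  let ?v = "r \<odot>\<^bsub>F\<^esub> b i" and ?w = "s \<odot>\<^bsub>F\<^esub> b i"
  have vw: "?v \<in> carrier F" "?w \<in> carrier F" using r s basis_closed[OF i] by auto
  have kv: "\<kappa> i ?v = r" "\<kappa> i ?w = s"
    using lin_map_smult[OF \<kappa>_lin_map[OF i] _ basis_closed[OF i]] r s i by (simp_all add: \<kappa>_basis)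
  let ?t = "necklace_sum F ?v ?w"
  have t: "?t \<in> carrier (tpower R p F)" by (rule necklace_sum_closed[OF F vw])
  interpret T: module R "tpower R p F" by (rule module_tpower[OF F])
  have c: "const_coord i ?t = witt_cocycle r s"
  proof -
    have "const_coord i ?t = (\<Oplus>\<^bsub>reg_module R\<^esub>\<epsilon>\<in>necklaces p UNIV.
        const_coord i (tpure R p F (map (\<lambda>i. if i then ?v else ?w) \<epsilon>)))"
      unfolding necklace_sum_def
      by (rule lin_map_finsum[OF coord_lin_map[OF const_word[OF i]] module_tpower[OF F] module_reg_module
            finite_bool_necklaces])
        (use tpure_closed[OF F necklace_words[OF vw]] in auto)
    also have "\<dots> = (\<Oplus>\<^bsub>reg_module R\<^esub>\<epsilon>\<in>necklaces p UNIV. \<Otimes>j\<in>{..<p}. if \<epsilon> ! j then r else s)"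
    proof (rule N.finsum_cong'[OF refl])
      show "(\<lambda>\<epsilon>. \<Otimes>j\<in>{..<p}. if \<epsilon> ! j then r else s) \<in> necklaces p UNIV \<rightarrow> carrier (reg_module R)"
        using r s by (auto intro!: finprod_closed)
      fix \<epsilon> :: "bool list" assume \<epsilon>: "\<epsilon> \<in> necklaces p UNIV"
      have "const_coord i (tpure R p F (map (\<lambda>i. if i then ?v else ?w) \<epsilon>)) =
          (\<Otimes>j\<in>{..<p}. \<kappa> (replicate p i ! j) (map (\<lambda>i. if i then ?v else ?w) \<epsilon> ! j))"
        by (rule coord_tpure[OF const_word[OF i] necklace_words[OF vw \<epsilon>]])
      also have "\<dots> = (\<Otimes>j\<in>{..<p}. if \<epsilon> ! j then r else s)"
        by (rule finprod_cong'[OF refl]) (use r s kv necklace_length[OF \<epsilon>] in auto)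
      finally show "const_coord i (tpure R p F (map (\<lambda>i. if i then ?v else ?w) \<epsilon>)) =
          (\<Otimes>j\<in>{..<p}. if \<epsilon> ! j then r else s)" .
    qed
    also have "\<dots> = (\<Oplus>\<epsilon>\<in>necklaces p UNIV. \<Otimes>j\<in>{..<p}. if \<epsilon> ! j then r else s)"
      by (simp add: finsum_def finprod_def reg_module_def)
    finally show ?thesis using witt_cocycle_necklaces[OF r s] by simp
  qed
  have "?t = (\<Oplus>\<^bsub>tpower R p F\<^esub>w\<in>{replicate p i}. coord p w ?t \<odot>\<^bsub>tpower R p F\<^esub> tpure R p F (map b w))"
    using tpower_expansion[OF t] iw by simp
  also have "\<dots> = const_coord i ?t \<odot>\<^bsub>tpower R p F\<^esub> tpure R p F (replicate p (b i))"
    using coord_closed[OF const_word[OF i] t] tpure_closed[OF F words_replicate[OF basis_closed[OF i]]]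
    by simp
  finally show ?thesis by (simp add: c scaled_power_def)
qed

section \<open>Free modules inside a given type\<close>

text \<open>
  The objects of \<open>R\<close>-proj have their carriers in one given type, into which free modules have to be
  copied along an injection \<open>h\<close>.
\<close>

definition transport_module :: "('b \<Rightarrow> 'c) \<Rightarrow> ('a, 'b, 'x) module_scheme \<Rightarrow> ('a, 'c) module" where
  "transport_module h M = (let g = inv_into (carrier M) h in
    \<lparr>carrier = h ` carrier M, mult = undefined, one = undefined, zero = h \<zero>\<^bsub>M\<^esub>,
     add = (\<lambda>x y. h (g x \<oplus>\<^bsub>M\<^esub> g y)), smult = (\<lambda>r x. h (r \<odot>\<^bsub>M\<^esub> g x))\<rparr>)"

context cring
begin

context
  fixes h :: "'m \<Rightarrow> 'n" and M :: "('a, 'm, 'x) module_scheme"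
  assumes M: "module R M" and h: "inj_on h (carrier M)"
begin

lemma transport_module_simps:
  "carrier (transport_module h M) = h ` carrier M"
  "\<zero>\<^bsub>transport_module h M\<^esub> = h \<zero>\<^bsub>M\<^esub>"
  "x \<in> carrier M \<Longrightarrow> y \<in> carrier M \<Longrightarrow> h x \<oplus>\<^bsub>transport_module h M\<^esub> h y = h (x \<oplus>\<^bsub>M\<^esub> y)"
  "x \<in> carrier M \<Longrightarrow> r \<odot>\<^bsub>transport_module h M\<^esub> h x = h (r \<odot>\<^bsub>M\<^esub> x)"
  using h by (simp_all add: transport_module_def Let_def)

lemma module_transport: "module R (transport_module h M)"
proof -
  interpret M: module R M by fact
  note s = transport_module_simps
  show ?thesis
  proof (rule moduleI[OF is_cring])
    show "abelian_group (transport_module h M)"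
    proof (rule abelian_groupI)
      fix x assume "x \<in> carrier (transport_module h M)"
      then obtain x' where x': "x' \<in> carrier M" "x = h x'" by (auto simp: s)
      then show "\<exists>y\<in>carrier (transport_module h M). y \<oplus>\<^bsub>transport_module h M\<^esub> x = \<zero>\<^bsub>transport_module h M\<^esub>"
        by (intro bexI[of _ "h (\<ominus>\<^bsub>M\<^esub> x')"]) (auto simp: s M.l_neg)
    qed (auto simp: s M.a_ac)
  qed (auto simp: s M.smult_l_distr M.smult_r_distr M.smult_assoc1)
qed

lemma transport_lin_map: "lin_map R M (transport_module h M) h"
  by (rule lin_mapI) (auto simp: transport_module_simps)

lemma transport_inv_lin_map: "lin_map R (transport_module h M) M (inv_into (carrier M) h)"
proof -
  interpret M: module R M by fact
  show ?thesis
    by (rule lin_mapI) (use h in \<open>auto simp: transport_module_simps\<close>)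
qed

lemma transport_generated:
  assumes B: "submodule_hull R M B = carrier M"
  shows "submodule_hull R (transport_module h M) (h ` B) = carrier (transport_module h M)" (is "?H = _")
proof
  interpret T: module R "transport_module h M" by (rule module_transport)
  have BM: "B \<subseteq> carrier M" using B submodule_hull_superset[of B M] by simp
  then have hB: "h ` B \<subseteq> carrier (transport_module h M)" by (auto simp: transport_module_simps)
  have sub: "submodule ?H R (transport_module h M)"
    by (rule submodule_submodule_hull[OF module_transport hB])
  show "?H \<subseteq> carrier (transport_module h M)" by (rule T.submoduleE(1)[OF sub])
  have "submodule_hull R M B \<subseteq> {x \<in> carrier M. h x \<in> ?H}"
    by (rule submodule_hull_least[OF submodule_preimage[OF M module_transport transport_lin_map sub]])
      (use BM submodule_hull_superset[of "h ` B" "transport_module h M"] in auto)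
  then show "carrier (transport_module h M) \<subseteq> ?H"
    unfolding B by (auto simp: transport_module_simps)
qed

end

lemma free_module_mono:
  assumes "I \<subseteq> J"
  shows "lin_map R (free_module R I) (free_module R J) (\<lambda>f. f)"
  by (rule lin_mapI) (use assms in \<open>auto simp: free_module_simps\<close>)

text \<open>
  The coefficient lists of finitely supported functions embed free modules of finite rank into any
  type that contains the lists over \<open>R\<close>.
\<close>

context
  fixes code :: "'a list \<Rightarrow> 'v"
  assumes code: "inj_on code (lists (carrier R))"
begin

definition free_code :: "'v set \<Rightarrow> ('v \<Rightarrow> 'a) \<Rightarrow> 'v" where
  "free_code I f = code (map f (SOME xs. set xs = I))"

definition std_free :: "'v set \<Rightarrow> ('a, 'v) module" where
  "std_free I = transport_module (free_code I) (free_module R I)"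

definition std_basis :: "'v set \<Rightarrow> 'v \<Rightarrow> 'v" where
  "std_basis I i = free_code I (basis_elt R i)"

definition std_coord :: "'v set \<Rightarrow> 'v \<Rightarrow> 'v \<Rightarrow> 'a" where
  "std_coord I i x = inv_into (carrier (free_module R I)) (free_code I) x i"

context
  fixes I :: "'v set"
  assumes I: "finite I"
begin

lemma inj_on_free_code: "inj_on (free_code I) (carrier (free_module R I))"
proof (rule inj_onI)
  fix f g assume f: "f \<in> carrier (free_module R I)" and g: "g \<in> carrier (free_module R I)"
    and eq: "free_code I f = free_code I g"
  define xs where "xs = (SOME xs. set xs = I)"
  have xs: "set xs = I" unfolding xs_def by (rule someI_ex[OF finite_list[OF I]])
  have "map f xs = map g xs"
    by (rule inj_onD[OF code])
      (use eq f g in \<open>auto simp: free_code_def xs_def free_module_simps\<close>)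
  then have "f i = g i" if "i \<in> I" for i using that xs by auto
  moreover have "f i = g i" if "i \<notin> I" for i
  proof -
    have "f i = \<zero>" "g i = \<zero>" using that f g by (auto simp: free_module_simps)
    then show ?thesis by simp
  qed
  ultimately show "f = g" by blast
qed

lemma module_std_free: "module R (std_free I)"
  unfolding std_free_def by (rule module_transport[OF module_free_module inj_on_free_code])

lemma free_code_lin_map: "lin_map R (free_module R I) (std_free I) (free_code I)"
  unfolding std_free_def by (rule transport_lin_map[OF module_free_module inj_on_free_code])

lemma free_code_inv_lin_map:
  "lin_map R (std_free I) (free_module R I) (inv_into (carrier (free_module R I)) (free_code I))"
  unfolding std_free_def by (rule transport_inv_lin_map[OF module_free_module inj_on_free_code])

lemma carrier_std_free: "carrier (std_free I) = free_code I ` carrier (free_module R I)"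
  unfolding std_free_def by (rule transport_module_simps[OF module_free_module inj_on_free_code])

lemma std_free_generated: "submodule_hull R (std_free I) (std_basis I ` I) = carrier (std_free I)"
  using transport_generated[OF module_free_module inj_on_free_code free_module_generated]
  by (simp add: std_free_def std_basis_def[abs_def] image_image)

lemma std_free_with_basis: "free_with_basis R (std_free I) I (std_basis I) (std_coord I)"
proof (rule free_with_basis.intro[OF cring_axioms], rule free_with_basis_axioms.intro)
  show "std_basis I i \<in> carrier (std_free I)" if "i \<in> I" for i
    using basis_elt_closed[OF that] by (simp add: std_basis_def carrier_std_free)
  show "lin_map R (std_free I) (reg_module R) (std_coord I i)" if "i \<in> I" for i
    using free_code_inv_lin_map by (auto simp: lin_map_def std_coord_def free_module_simps Pi_def)
  show "std_coord I i (std_basis I j) = (if i = j then \<one> else \<zero>)" if "i \<in> I" "j \<in> I" for i j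
    using inv_into_f_f[OF inj_on_free_code basis_elt_closed[OF that(2)]]
    by (simp add: std_coord_def std_basis_def basis_elt_def)
qed (use I module_std_free std_free_generated in auto)

lemma std_free_proj: "std_free I \<in> proj_modules R"
proof -
  have "finitely_generated R (std_free I)"
    unfolding finitely_generated_def
    using std_free_generated I submodule_hull_superset[of "std_basis I ` I" "std_free I"]
    by (intro exI[of _ "std_basis I ` I"]) auto
  moreover have "projective R (std_free I)"
    unfolding projective_def
  proof (intro exI bexI ballI)
    let ?s = "restrict (inv_into (carrier (free_module R I)) (free_code I)) (carrier (std_free I))"
    let ?q = "restrict (free_code I) (carrier (free_module R I))"
    show "?s \<in> lin_hom R (std_free I) (free_module R I)"
      by (rule lin_map_restrict[OF free_code_inv_lin_map module_std_free])
    show "?q \<in> lin_hom R (free_module R I) (std_free I)"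
      by (rule lin_map_restrict[OF free_code_lin_map module_free_module])
    show "?q (?s v) = v" if "v \<in> carrier (std_free I)" for v
      using that by (auto simp: carrier_std_free inv_into_f_f[OF inj_on_free_code])
  qed
  ultimately show ?thesis using module_std_free by (simp add: proj_modules_def)
qed

lemma std_free_map:
  assumes V: "module R V" and g: "g \<in> I \<rightarrow> carrier V"
  shows "\<exists>f \<in> lin_hom R (std_free I) V. \<forall>i\<in>I. f (std_basis I i) = g i"
proof -
  let ?f = "\<lambda>x. lin_ext R V g (inv_into (carrier (free_module R I)) (free_code I) x)"
  have f: "lin_map R (std_free I) V ?f"
    by (rule lin_map_comp[OF free_code_inv_lin_map lin_ext_lin_map[OF V g]])
  have "std_basis I i \<in> carrier (std_free I)" "?f (std_basis I i) = g i" if i: "i \<in> I" for i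
    using inv_into_f_f[OF inj_on_free_code basis_elt_closed[OF i]] basis_elt_closed[OF i]
    by (auto simp: std_basis_def lin_ext_basis_elt[OF V g i] carrier_std_free)
  then show ?thesis
    by (intro bexI[OF _ lin_map_restrict[OF f module_std_free]]) auto
qed

end

text \<open>
  The coordinates of finitely many generators in a free module of any rank involve only finitely many
  basis elements.
\<close>

lemma proj_module_retract:
  fixes V :: "('a, 'v) module"
  assumes V: "V \<in> proj_modules R"
  shows "\<exists>I. finite I \<and> (\<exists>s \<in> lin_hom R V (std_free I). \<exists>q \<in> lin_hom R (std_free I) V.
    \<forall>v\<in>carrier V. q (s v) = v)"
proof -
  have VM: "module R V" using V by (simp add: proj_modules_def)
  obtain S where S: "finite S" "S \<subseteq> carrier V" "submodule_hull R V S = carrier V"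
    using V by (auto simp: proj_modules_def finitely_generated_def)
  have "projective R V" using V by (simp add: proj_modules_def)
  then obtain J :: "'v set" and s q where s: "s \<in> lin_hom R V (free_module R J)"
    and q: "q \<in> lin_hom R (free_module R J) V" and "\<forall>v\<in>carrier V. q (s v) = v"
    unfolding projective_def by (elim exE bexE) (rule that; assumption)
  then have qs: "\<And>v. v \<in> carrier V \<Longrightarrow> q (s v) = v" by simp
  have sl: "lin_map R V (free_module R J) s" and ql: "lin_map R (free_module R J) V q"
    using s q by (auto simp: lin_hom_iff)
  define I where "I = (\<Union>x\<in>S. {i. s x i \<noteq> \<zero>})"
  have sc: "s x \<in> carrier (free_module R J)" if "x \<in> carrier V" for x
    by (rule lin_map_closed[OF sl that])
  have I: "finite I" "I \<subseteq> J" using S sc by (auto simp: I_def free_module_simps subset_eq)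
  interpret FJ: module R "free_module R J" by (rule module_free_module)
  have sub: "submodule (carrier (free_module R I)) R (free_module R J)"
  proof -
    have "submodule ((\<lambda>f. f) ` carrier (free_module R I)) R (free_module R J)"
      by (rule submodule_image[OF module_free_module module_free_module free_module_mono[OF I(2)]])
    then show ?thesis by simp
  qed
  have "submodule_hull R V S \<subseteq> {x \<in> carrier V. s x \<in> carrier (free_module R I)}"
    by (rule submodule_hull_least[OF submodule_preimage[OF VM module_free_module sl sub]])
      (use S sc in \<open>auto simp: I_def free_module_simps subset_eq\<close>)
  then have sI: "s x \<in> carrier (free_module R I)" if "x \<in> carrier V" for x
    using that S(3) by auto
  have sl': "lin_map R V (free_module R I) s"
    using sl sI by (auto simp: lin_map_def free_module_simps(3,4))
  have ql': "lin_map R (free_module R I) V q"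
    by (rule lin_map_comp[OF free_module_mono[OF I(2)] ql])
  let ?g = "inv_into (carrier (free_module R I)) (free_code I)"
  have s'': "lin_map R V (std_free I) (\<lambda>x. free_code I (s x))"
    by (rule lin_map_comp[OF sl' free_code_lin_map[OF I(1)]])
  have q'': "lin_map R (std_free I) V (\<lambda>x. q (?g x))"
    by (rule lin_map_comp[OF free_code_inv_lin_map[OF I(1)] ql'])
  show ?thesis
  proof (intro exI conjI bexI ballI)
    show "finite I" by (rule I)
    show "restrict (\<lambda>x. free_code I (s x)) (carrier V) \<in> lin_hom R V (std_free I)"
      by (rule lin_map_restrict[OF s'' VM])
    show "restrict (\<lambda>x. q (?g x)) (carrier (std_free I)) \<in> lin_hom R (std_free I) V"
      by (rule lin_map_restrict[OF q'' module_std_free[OF I(1)]])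
    fix v assume v: "v \<in> carrier V"
    then show "restrict (\<lambda>x. q (?g x)) (carrier (std_free I)) (restrict (\<lambda>x. free_code I (s x)) (carrier V) v) = v"
      using lin_map_closed[OF s'' v] inv_into_f_f[OF inj_on_free_code[OF I(1)] sI[OF v]] qs by simp
  qed
qed

lemma two_codes: "code [] \<noteq> code [\<zero>]"
  using inj_onD[OF code, of "[]" "[\<zero>]"] by auto

end

end

section \<open>Splittings of the cyclic powers extension\<close>

locale cyc_splitting = cring_char R p for R :: "('a, 'k) ring_scheme" (structure) and p +
  fixes code :: "'a list \<Rightarrow> 'v"
    and C01 :: "('a, 'v, ('c, 'x) ring_scheme, 'c) proj_functor"
    and c1 :: "('a, 'v) module \<Rightarrow> ('v list \<Rightarrow> 'a) set set \<Rightarrow> 'c"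
    and c0 :: "('a, 'v) module \<Rightarrow> 'c \<Rightarrow> ('v list \<Rightarrow> 'a) set \<times> 'v"
  assumes code: "inj_on code (lists (carrier R))"
    and splitting: "splitting R (cyclic_powers_ext R p) C01 c1 c0"
begin

abbreviation "\<P> \<equiv> proj_modules R :: ('a, 'v) module set"
abbreviation "G \<equiv> obj C01"
abbreviation "\<tau> V x \<equiv> fst (c0 V x)"
abbreviation "\<alpha> V x \<equiv> snd (c0 V x)"

lemma ext_simps [simp]:
  "coeff (cyclic_powers_ext R p) = R1 R p"
  "obj (C1 (cyclic_powers_ext R p)) V = cycC1 R p V" "arr (C1 (cyclic_powers_ext R p)) V W f = cycC1_map R p V W f"
  "obj (C0 (cyclic_powers_ext R p)) V = cycC0 R p V" "arr (C0 (cyclic_powers_ext R p)) V W f = cycC0_map R p V W f"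
  "bmap (cyclic_powers_ext R p) = psi R p"
  by (simp_all add: cyclic_powers_ext_def)

lemma dmap_eq: "y \<in> carrier (coinv R p V) \<Longrightarrow> dmap (cyclic_powers_ext R p) V y = (trace R p V y, \<zero>\<^bsub>V\<^esub>)"
  by (simp add: cyclic_powers_ext_def)

lemma amap_eq: "X \<in> carrier (cycC0 R p V) \<Longrightarrow> amap (cyclic_powers_ext R p) V X = snd X"
  by (simp add: cyclic_powers_ext_def case_prod_beta)

lemma proj_module: "V \<in> \<P> \<Longrightarrow> module R V"
  by (simp add: proj_modules_def)

lemma C01_functor: "pointed_functor R C01"
  using splitting by (simp add: splitting_def)

lemma G_group: "V \<in> \<P> \<Longrightarrow> abelian_group (G V)"
  using C01_functor by (simp add: pointed_functor_def)

lemma arr_add_map: "V \<in> \<P> \<Longrightarrow> W \<in> \<P> \<Longrightarrow> f \<in> lin_hom R V W \<Longrightarrow> add_map (G V) (G W) (arr C01 V W f)"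
  using C01_functor by (simp add: pointed_functor_def ab_hom_iff)

lemma arr_closed:
  "V \<in> \<P> \<Longrightarrow> W \<in> \<P> \<Longrightarrow> f \<in> lin_hom R V W \<Longrightarrow> x \<in> carrier (G V) \<Longrightarrow> arr C01 V W f x \<in> carrier (G W)"
  by (rule add_map_closed[OF arr_add_map])

lemma arr_id: "V \<in> \<P> \<Longrightarrow> x \<in> carrier (G V) \<Longrightarrow> arr C01 V V (\<lambda>v \<in> carrier V. v) x = x"
  using C01_functor by (simp add: pointed_functor_def)

lemma arr_comp:
  assumes "U \<in> \<P>" "V \<in> \<P>" "W \<in> \<P>" "f \<in> lin_hom R U V" "g \<in> lin_hom R V W" "x \<in> carrier (G U)"
  shows "arr C01 V W g (arr C01 U V f x) = arr C01 U W (compose (carrier U) g f) x"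
proof -
  have "arr C01 U W (compose (carrier U) g f) =
      compose (carrier (G U)) (arr C01 V W g) (arr C01 U V f)"
    using C01_functor assms(1-5) unfolding pointed_functor_def by blast
  then show ?thesis using assms(6) by (simp add: compose_def)
qed

lemma arr_zero_module: "V \<in> \<P> \<Longrightarrow> carrier V = {\<zero>\<^bsub>V\<^esub>} \<Longrightarrow> carrier (G V) = {\<zero>\<^bsub>G V\<^esub>}"
  using C01_functor by (simp add: pointed_functor_def)

lemma c1_nat_trans: "c1 \<in> nat_trans R (C1 (cyclic_powers_ext R p)) C01"
  using splitting by (simp add: splitting_def)

lemma c0_nat_trans: "c0 \<in> nat_trans R C01 (C0 (cyclic_powers_ext R p))"
  using splitting by (simp add: splitting_def)

lemma c1_add_map: "V \<in> \<P> \<Longrightarrow> add_map (cycC1 R p V) (G V) (c1 V)"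
  using c1_nat_trans by (auto simp: nat_trans_def ab_hom_iff dest!: PiE_mem)

lemma c0_add_map: "V \<in> \<P> \<Longrightarrow> add_map (G V) (cycC0 R p V) (c0 V)"
  using c0_nat_trans by (auto simp: nat_trans_def ab_hom_iff dest!: PiE_mem)

lemma c1_closed: "V \<in> \<P> \<Longrightarrow> y \<in> carrier (coinv R p V) \<Longrightarrow> c1 V y \<in> carrier (G V)"
  using add_map_closed[OF c1_add_map] by simp

lemma c0_closed: "V \<in> \<P> \<Longrightarrow> x \<in> carrier (G V) \<Longrightarrow> c0 V x \<in> carrier (cycC0 R p V)"
  by (rule add_map_closed[OF c0_add_map])

lemma c1_natural:
  "V \<in> \<P> \<Longrightarrow> W \<in> \<P> \<Longrightarrow> f \<in> lin_hom R V W \<Longrightarrow> y \<in> carrier (coinv R p V) \<Longrightarrow>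
    arr C01 V W f (c1 V y) = c1 W (cycC1_map R p V W f y)"
  using c1_nat_trans by (simp add: nat_trans_def)

lemma c1_injective: "V \<in> \<P> \<Longrightarrow> inj_on (c1 V) (carrier (coinv R p V))"
  using splitting by (simp add: splitting_def)

lemma c0_surjective: "V \<in> \<P> \<Longrightarrow> X \<in> carrier (cycC0 R p V) \<Longrightarrow> \<exists>x\<in>carrier (G V). c0 V x = X"
  using splitting unfolding splitting_def ext_simps by (metis imageE)

lemma \<tau>_add_map: "V \<in> \<P> \<Longrightarrow> add_map (G V) (tpower R p V) (\<lambda>x. \<tau> V x)"
  using c0_add_map[of V] by (auto simp: add_map_def Pi_def cycC0_carrier_iff)

lemma \<alpha>_add_map: "V \<in> \<P> \<Longrightarrow> add_map (G V) V (\<lambda>x. \<alpha> V x)"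
  using c0_add_map[of V] by (auto simp: add_map_def Pi_def cycC0_carrier_iff)

lemma \<alpha>_closed: "V \<in> \<P> \<Longrightarrow> x \<in> carrier (G V) \<Longrightarrow> \<alpha> V x \<in> carrier V"
  by (rule add_map_closed[OF \<alpha>_add_map])

lemma \<tau>_closed: "V \<in> \<P> \<Longrightarrow> x \<in> carrier (G V) \<Longrightarrow> \<tau> V x \<in> carrier (tpower R p V)"
  by (rule add_map_closed[OF \<tau>_add_map])

lemma c0_natural:
  assumes "V \<in> \<P>" "W \<in> \<P>" "f \<in> lin_hom R V W" "x \<in> carrier (G V)"
  shows "\<tau> W (arr C01 V W f x) = tpower_map R p V W f (\<tau> V x)"
    and "\<alpha> W (arr C01 V W f x) = f (\<alpha> V x)"
proof -
  have "c0 W (arr C01 V W f x) = cycC0_map R p V W f (c0 V x)"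
    using c0_nat_trans assms by (simp add: nat_trans_def)
  then show "\<tau> W (arr C01 V W f x) = tpower_map R p V W f (\<tau> V x)"
    and "\<alpha> W (arr C01 V W f x) = f (\<alpha> V x)"
    using c0_closed[OF assms(1,4)] by (simp_all add: cycC0_map_def case_prod_beta)
qed

lemma c0_c1:
  assumes "V \<in> \<P>" "y \<in> carrier (coinv R p V)"
  shows "\<tau> V (c1 V y) = trace R p V y" "\<alpha> V (c1 V y) = \<zero>\<^bsub>V\<^esub>"
proof -
  have "c0 V (c1 V y) = dmap (cyclic_powers_ext R p) V y"
    using splitting assms by (simp add: splitting_def)
  then show "\<tau> V (c1 V y) = trace R p V y" "\<alpha> V (c1 V y) = \<zero>\<^bsub>V\<^esub>"
    using dmap_eq[OF assms(2)] by simp_all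
qed

lemma c0_kernel:
  assumes "V \<in> \<P>"
  shows "{x \<in> carrier (G V). \<tau> V x = \<zero>\<^bsub>tpower R p V\<^esub> \<and> \<alpha> V x = \<zero>\<^bsub>V\<^esub>} =
    (\<lambda>X. c1 V (psi R p V X)) ` carrier (V1 R p V)"
proof -
  have "a_kernel (G V) (cycC0 R p V) (c0 V) = c1 V ` psi R p V ` carrier (V1 R p V)"
    using splitting assms unfolding splitting_def ext_simps by (simp add: V1_def)
  then show ?thesis
    by (auto simp: a_kernel_def' prod_eq_iff image_image)
qed

lemma c0_difference:
  assumes V: "V \<in> \<P>" and x: "x \<in> carrier (G V)" and y: "y \<in> carrier (G V)"
    and eq: "\<tau> V x = \<tau> V y" "\<alpha> V x = \<alpha> V y"
  shows "\<exists>X\<in>carrier (V1 R p V). x \<ominus>\<^bsub>G V\<^esub> y = c1 V (psi R p V X) \<and> x = y \<oplus>\<^bsub>G V\<^esub> c1 V (psi R p V X)"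
proof -
  interpret GV: abelian_group "G V" by (rule G_group[OF V])
  interpret VM: module R V by (rule proj_module[OF V])
  interpret T: module R "tpower R p V" by (rule module_tpower[OF proj_module[OF V]])
  have "x \<ominus>\<^bsub>G V\<^esub> y \<in> {x \<in> carrier (G V). \<tau> V x = \<zero>\<^bsub>tpower R p V\<^esub> \<and> \<alpha> V x = \<zero>\<^bsub>V\<^esub>}"
    using x y eq \<tau>_closed[OF V y] \<alpha>_closed[OF V y]
      add_map_minus[OF G_group[OF V] T.abelian_group_axioms \<tau>_add_map[OF V] x y]
      add_map_minus[OF G_group[OF V] VM.abelian_group_axioms \<alpha>_add_map[OF V] x y]
    by (simp add: T.minus_eq_zero_iff VM.minus_eq_zero_iff)
  then obtain X where "X \<in> carrier (V1 R p V)" "x \<ominus>\<^bsub>G V\<^esub> y = c1 V (psi R p V X)"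
    unfolding c0_kernel[OF V] by auto
  moreover have "x = y \<oplus>\<^bsub>G V\<^esub> (x \<ominus>\<^bsub>G V\<^esub> y)" using x y by (simp add: GV.minus_eq GV.a_ac GV.r_neg)
  ultimately show ?thesis by metis
qed

lemma coinv_group: "V \<in> \<P> \<Longrightarrow> abelian_group (cycC1 R p V)"
  by (rule module.axioms(2)[OF module_cycC1[OF proj_module]])

lemma psi_closed: "V \<in> \<P> \<Longrightarrow> X \<in> carrier (V1 R p V) \<Longrightarrow> psi R p V X \<in> carrier (coinv R p V)"
  using lin_map_closed[OF psi_lin_map[OF proj_module]] by simp

lemma c1_psi_add_map: "V \<in> \<P> \<Longrightarrow> add_map (V1 R p V) (G V) (\<lambda>X. c1 V (psi R p V X))"
  using c1_add_map[of V] lin_map_add_map[OF psi_lin_map[OF proj_module], of V]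
  by (auto simp: add_map_def Pi_def)

lemma V1_group: "V \<in> \<P> \<Longrightarrow> abelian_group (V1 R p V)"
  by (rule module.axioms(2)[OF module_V1[OF proj_module]])

lemma c1_psi_kernel:
  assumes V: "V \<in> \<P>" and X: "X \<in> carrier (V1 R p V)"
  shows "\<tau> V (c1 V (psi R p V X)) = \<zero>\<^bsub>tpower R p V\<^esub>" "\<alpha> V (c1 V (psi R p V X)) = \<zero>\<^bsub>V\<^esub>"
  using c0_kernel[OF V] X by auto


section \<open>Lifting elements along a choice over the rank one module\<close>

text \<open>
  \<open>U\<close> plays the role of \<open>R\<close> as an object of \<open>R\<close>-proj: a linear map out of \<open>U\<close> is the choice of the image of
  \<open>u\<close>. Any element of the carrier type can serve as the index \<open>pt\<close> of its one basis element.
\<close>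

abbreviation pt :: 'v where "pt \<equiv> code []"

definition U :: "('a, 'v) module" where "U = std_free code {pt}"
definition u :: 'v where "u = std_basis code {pt} pt"
definition \<kappa>U :: "'v \<Rightarrow> 'a" where "\<kappa>U = std_coord code {pt} pt"

lemma char_free_std:
  "finite I \<Longrightarrow> char_free R p (std_free code I) I (std_basis code I) (std_coord code I)"
  by (rule char_free.intro[OF cring_char_axioms std_free_with_basis[OF code]])

lemma U_free: "char_free R p U {pt} (std_basis code {pt}) (std_coord code {pt})"
  unfolding U_def by (rule char_free_std) simp

lemma std_proj: "finite I \<Longrightarrow> std_free code I \<in> \<P>"
  by (rule std_free_proj[OF code])

lemma U_proj: "U \<in> \<P>" unfolding U_def by (rule std_proj) simp

lemma U_module: "module R U" by (rule proj_module[OF U_proj])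

lemma u_closed: "u \<in> carrier U"
proof -
  interpret U: char_free R p U "{pt}" "std_basis code {pt}" "std_coord code {pt}" by (rule U_free)
  show ?thesis using U.basis_closed[of pt] by (simp add: u_def)
qed

lemma \<kappa>U_smult: "r \<in> carrier R \<Longrightarrow> \<kappa>U (r \<odot>\<^bsub>U\<^esub> u) = r"
proof -
  assume r: "r \<in> carrier R"
  interpret U: char_free R p U "{pt}" "std_basis code {pt}" "std_coord code {pt}" by (rule U_free)
  show ?thesis
    using lin_map_smult[OF U.\<kappa>_lin_map[of pt] r u_closed] U.\<kappa>_basis[of pt pt] r
    by (simp add: \<kappa>U_def u_def)
qed

lemma U_smult_closed: "r \<in> carrier R \<Longrightarrow> r \<odot>\<^bsub>U\<^esub> u \<in> carrier U"
  using module.smult_closed[OF U_module] u_closed by simp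

lemma psi_u_injective:
  assumes "m \<in> carrier R" "psi R p U (pure R (R1 R p) U m u) = \<zero>\<^bsub>coinv R p U\<^esub>"
  shows "m = \<zero>"
proof -
  interpret U: char_free R p U "{pt}" "std_basis code {pt}" "std_coord code {pt}" by (rule U_free)
  show ?thesis using U.psi_basis_injective[of pt m] assms by (simp add: u_def)
qed

lemma V1_U:
  assumes "X \<in> carrier (V1 R p U)"
  shows "\<exists>m\<in>carrier R. X = pure R (R1 R p) U m u"
proof -
  interpret U: char_free R p U "{pt}" "std_basis code {pt}" "std_coord code {pt}" by (rule U_free)
  interpret V1: module R "V1 R p U" by (rule module_V1[OF U_module])
  have "U.V1_coord pt X \<in> carrier R" using lin_map_closed[OF U.V1_coord_lin_map assms] by simp
  then show ?thesis
    using U.V1_expansion[OF assms] pure_V1_closed[OF U_module _ u_closed]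
    by (intro bexI[of _ "U.V1_coord pt X"]) (simp_all add: u_def)
qed

lemma U_map_exists:
  assumes V: "V \<in> \<P>" and v: "v \<in> carrier V"
  shows "\<exists>f\<in>lin_hom R U V. f u = v"
  using std_free_map[OF code _ proj_module[OF V], of "{pt}" "\<lambda>_. v"] v by (simp add: U_def u_def)

lemma U_map_unique:
  assumes V: "V \<in> \<P>" and f: "f \<in> lin_hom R U V" and g: "g \<in> lin_hom R U V" and eq: "f u = g u"
  shows "f = g"
proof (rule extensionalityI)
  interpret U: char_free R p U "{pt}" "std_basis code {pt}" "std_coord code {pt}" by (rule U_free)
  show "f \<in> extensional (carrier U)" "g \<in> extensional (carrier U)"
    using f g by (auto simp: lin_hom_iff)
  show "f x = g x" if "x \<in> carrier U" for x
    by (rule lin_map_eq_on_generators[OF U_module proj_module[OF V] _ _ U.basis_generates _ that])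
      (use f g eq in \<open>auto simp: lin_hom_iff u_def\<close>)
qed

definition e :: 'c where
  "e = (SOME x. x \<in> carrier (G U) \<and> c0 U x = (tpure R p U (replicate p u), u))"

lemma e: "e \<in> carrier (G U)" "\<tau> U e = tpure R p U (replicate p u)" "\<alpha> U e = u"
proof -
  interpret U: char_free R p U "{pt}" "std_basis code {pt}" "std_coord code {pt}" by (rule U_free)
  have "\<exists>x. x \<in> carrier (G U) \<and> c0 U x = (tpure R p U (replicate p u), u)"
    using c0_surjective[OF U_proj U.power_in_cycC0[OF u_closed]] by auto
  from someI_ex[OF this] show "e \<in> carrier (G U)" "\<tau> U e = tpure R p U (replicate p u)" "\<alpha> U e = u"
    by (simp_all add: e_def[symmetric])
qed

text \<open>
  The value at \<open>e\<close> of the map \<open>C01(U) \<rightarrow> C01(V)\<close> induced by the linear map with \<open>u \<mapsto> v\<close>.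
\<close>

definition lift :: "('a, 'v) module \<Rightarrow> 'v \<Rightarrow> 'c" where
  "lift V v = arr C01 U V (SOME f. f \<in> lin_hom R U V \<and> f u = v) e"

lemma arr_e:
  assumes V: "V \<in> \<P>" and f: "f \<in> lin_hom R U V"
  shows "arr C01 U V f e = lift V (f u)"
proof -
  have "\<exists>g. g \<in> lin_hom R U V \<and> g u = f u" using f by auto
  from someI_ex[OF this] have "(SOME g. g \<in> lin_hom R U V \<and> g u = f u) = f"
    using U_map_unique[OF V _ f] by blast
  then show ?thesis by (simp add: lift_def)
qed

context
  fixes V v assumes V: "V \<in> \<P>" and v: "v \<in> carrier V"
begin

lemma lift_closed: "lift V v \<in> carrier (G V)"
  using U_map_exists[OF V v] arr_e[OF V] arr_closed[OF U_proj V _ e(1)] by auto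

lemma \<alpha>_lift: "\<alpha> V (lift V v) = v"
  using U_map_exists[OF V v] arr_e[OF V] c0_natural(2)[OF U_proj V _ e(1)] e(3) by metis

lemma \<tau>_lift: "\<tau> V (lift V v) = tpure R p V (replicate p v)"
proof -
  obtain f where f: "f \<in> lin_hom R U V" "f u = v" using U_map_exists[OF V v] by auto
  then have "\<tau> V (lift V v) = tpower_map R p U V f (tpure R p U (replicate p u))"
    using arr_e[OF V f(1)] c0_natural(1)[OF U_proj V f(1) e(1)] e(2) by simp
  then show ?thesis
    using f tpower_map_tpure[OF U_module proj_module[OF V] _ words_replicate[OF u_closed]]
    by (simp add: lin_hom_iff)
qed

end

lemma lin_hom_compose:
  assumes "U' \<in> \<P>" "f \<in> lin_hom R U' V" "g \<in> lin_hom R V W"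
  shows "compose (carrier U') g f \<in> lin_hom R U' W"
proof -
  have "compose (carrier U') g f = restrict (\<lambda>x. g (f x)) (carrier U')" by (simp add: compose_def)
  moreover have "lin_map R U' V f" "lin_map R V W g" using assms(2,3) by (auto simp: lin_hom_iff)
  ultimately show ?thesis
    using lin_map_restrict[OF lin_map_comp proj_module[OF assms(1)]] by metis
qed

lemma arr_lift:
  assumes V: "V \<in> \<P>" and W: "W \<in> \<P>" and g: "g \<in> lin_hom R V W" and v: "v \<in> carrier V"
  shows "arr C01 V W g (lift V v) = lift W (g v)"
proof -
  obtain f where f: "f \<in> lin_hom R U V" "f u = v" using U_map_exists[OF V v] by auto
  have "arr C01 V W g (lift V v) = arr C01 U W (compose (carrier U) g f) e"
    using arr_e[OF V f(1)] f(2) arr_comp[OF U_proj V W f(1) g e(1)] by simp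
  also have "\<dots> = lift W (compose (carrier U) g f u)"
    by (rule arr_e[OF W lin_hom_compose[OF U_proj f(1) g]])
  finally show ?thesis using u_closed f(2) by (simp add: compose_def)
qed

text \<open>
  The zero element is the image of zero under a map from the zero module, on which a pointed functor
  vanishes.
\<close>

lemma lift_zero:
  assumes V: "V \<in> \<P>"
  shows "lift V \<zero>\<^bsub>V\<^esub> = \<zero>\<^bsub>G V\<^esub>"
proof -
  let ?O = "std_free code {}"
  have O: "?O \<in> \<P>" by (rule std_proj) simp
  have "carrier (free_module R ({} :: 'v set)) = {\<zero>\<^bsub>free_module R {}\<^esub>}"
    by (auto simp: free_module_simps fun_eq_iff)
  then have "carrier ?O = {\<zero>\<^bsub>?O\<^esub>}"
    using lin_map_zero[OF free_code_lin_map[OF code] module_free_module proj_module[OF O]]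
    by (simp add: carrier_std_free[OF code])
  then have GO: "carrier (G ?O) = {\<zero>\<^bsub>G ?O\<^esub>}" by (rule arr_zero_module[OF O])
  obtain g where g: "g \<in> lin_hom R ?O V"
    using std_free_map[OF code finite.emptyI proj_module[OF V], of undefined] by auto
  have z: "\<zero>\<^bsub>?O\<^esub> \<in> carrier ?O"
    by (rule abelian_monoid.zero_closed[OF abelian_group.axioms(1)[OF module.axioms(2)[OF proj_module[OF O]]]])
  have "lift V (g \<zero>\<^bsub>?O\<^esub>) = arr C01 ?O V g (lift ?O \<zero>\<^bsub>?O\<^esub>)" by (rule arr_lift[OF O V g z, symmetric])
  also have "lift ?O \<zero>\<^bsub>?O\<^esub> = \<zero>\<^bsub>G ?O\<^esub>" using lift_closed[OF O z] GO by simp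
  also have "arr C01 ?O V g \<zero>\<^bsub>G ?O\<^esub> = \<zero>\<^bsub>G V\<^esub>"
    by (rule add_map_zero[OF G_group[OF O] G_group[OF V] arr_add_map[OF O V g]])
  also have "g \<zero>\<^bsub>?O\<^esub> = \<zero>\<^bsub>V\<^esub>"
    using lin_map_zero[OF _ proj_module[OF O] proj_module[OF V]] g by (simp add: lin_hom_iff)
  finally show ?thesis .
qed

text \<open>
  By exactness at \<open>C0\<close>, the images of \<open>x\<close> and of the lift of \<open>\<alpha> x\<close> in \<open>C0\<close> differ by \<open>d y\<close> for some \<open>y\<close>. After
  correction by \<open>c1 y\<close> the difference is in the kernel of \<open>c0\<close>, which is again contained in the image of
  \<open>c1\<close>.
\<close>

lemma lift_decomposition:
  assumes I: "finite I" and x: "x \<in> carrier (G (std_free code I))"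
  shows "\<exists>y\<in>carrier (coinv R p (std_free code I)).
    x = lift (std_free code I) (\<alpha> (std_free code I) x) \<oplus>\<^bsub>G (std_free code I)\<^esub> c1 (std_free code I) y"
proof -
  let ?F = "std_free code I" and ?T = "tpower R p (std_free code I)"
  interpret B: char_free R p ?F I "std_basis code I" "std_coord code I" by (rule char_free_std[OF I])
  have F: "?F \<in> \<P>" by (rule std_proj[OF I])
  interpret GF: abelian_group "G ?F" by (rule G_group[OF F])
  interpret FM: module R ?F by (rule B.F)
  interpret T: module R ?T by (rule module_tpower[OF B.F])
  interpret C: abelian_group "cycC1 R p ?F" by (rule coinv_group[OF F])
  let ?v = "\<alpha> ?F x"
  have v: "?v \<in> carrier ?F" by (rule \<alpha>_closed[OF F x])
  have "(\<tau> ?F x, ?v) \<in> carrier (cycC0 R p ?F)" using c0_closed[OF F x] by simp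
  then obtain z where z: "z \<in> carrier ?T" "\<tau> ?F x = tpure R p ?F (replicate p ?v) \<oplus>\<^bsub>?T\<^esub> cyc_sum ?F p z"
    using B.cycC0_trace by blast
  let ?y = "coinv_class R p ?F z"
  have y: "?y \<in> carrier (coinv R p ?F)" using z(1) by (simp add: carrier_coinv[OF B.F])
  let ?s = "lift ?F ?v \<oplus>\<^bsub>G ?F\<^esub> c1 ?F ?y"
  have l: "lift ?F ?v \<in> carrier (G ?F)" by (rule lift_closed[OF F v])
  have cy: "c1 ?F ?y \<in> carrier (G ?F)" by (rule c1_closed[OF F y])
  have s: "?s \<in> carrier (G ?F)" using l cy by simp
  have ts: "\<tau> ?F ?s = \<tau> ?F x" "\<alpha> ?F ?s = \<alpha> ?F x"
    using add_map_add[OF \<tau>_add_map[OF F] l cy] add_map_add[OF \<alpha>_add_map[OF F] l cy] v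
    by (simp_all add: \<tau>_lift[OF F v] \<alpha>_lift[OF F v] c0_c1[OF F y] trace_coinv_class[OF B.F z(1)] z(2))
  obtain X where X: "X \<in> carrier (V1 R p ?F)" "x = ?s \<oplus>\<^bsub>G ?F\<^esub> c1 ?F (psi R p ?F X)"
    using c0_difference[OF F x s] ts by auto
  have pX: "psi R p ?F X \<in> carrier (coinv R p ?F)" by (rule psi_closed[OF F X(1)])
  have cX: "c1 ?F (psi R p ?F X) \<in> carrier (G ?F)" by (rule c1_closed[OF F pX])
  have "x = ?s \<oplus>\<^bsub>G ?F\<^esub> c1 ?F (psi R p ?F X)" by (rule X(2))
  also have "\<dots> = lift ?F ?v \<oplus>\<^bsub>G ?F\<^esub> (c1 ?F ?y \<oplus>\<^bsub>G ?F\<^esub> c1 ?F (psi R p ?F X))"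
    using l cy cX by (simp add: GF.a_assoc)
  also have "c1 ?F ?y \<oplus>\<^bsub>G ?F\<^esub> c1 ?F (psi R p ?F X) = c1 ?F (?y \<oplus>\<^bsub>coinv R p ?F\<^esub> psi R p ?F X)"
    using add_map_add[OF c1_add_map[OF F], of ?y "psi R p ?F X"] y pX by simp
  finally show ?thesis
    using C.a_closed[of ?y "psi R p ?F X"] y pX by (intro bexI) simp_all
qed

lemma nat_trans_add_map: "t \<in> nat_trans R C01 C01 \<Longrightarrow> V \<in> \<P> \<Longrightarrow> add_map (G V) (G V) (t V)"
  by (auto simp: nat_trans_def ab_hom_iff dest!: PiE_mem)

lemma nat_trans_natural:
  "t \<in> nat_trans R C01 C01 \<Longrightarrow> V \<in> \<P> \<Longrightarrow> W \<in> \<P> \<Longrightarrow> f \<in> lin_hom R V W \<Longrightarrow> x \<in> carrier (G V) \<Longrightarrow>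
    t W (arr C01 V W f x) = arr C01 V W f (t V x)"
  by (simp add: nat_trans_def)

lemma nat_trans_ext:
  assumes s: "s \<in> nat_trans R C01 C01" and t: "t \<in> nat_trans R C01 C01"
    and eq: "\<And>V x. V \<in> \<P> \<Longrightarrow> x \<in> carrier (G V) \<Longrightarrow> s V x = t V x"
  shows "s = t"
proof (rule PiE_ext)
  show "s \<in> (\<Pi>\<^sub>E V \<in> \<P>. ab_hom (G V) (G V))" "t \<in> (\<Pi>\<^sub>E V \<in> \<P>. ab_hom (G V) (G V))"
    using s t by (auto simp: nat_trans_def)
  then have "s V \<in> extensional (carrier (G V))" "t V \<in> extensional (carrier (G V))" if "V \<in> \<P>" for V
    using that by (auto simp: ab_hom_iff dest!: PiE_mem)
  then show "s V = t V" if "V \<in> \<P>" for V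
    using eq that by (intro extensionalityI[of "s V" "carrier (G V)" "t V"]) auto
qed

text \<open>
  On free modules this holds because the lifts, which are images of \<open>e\<close>, and the image of \<open>c1\<close> generate;
  on their direct summands it follows by naturality.
\<close>

lemma nat_trans_determined:
  assumes s: "s \<in> nat_trans R C01 C01" and t: "t \<in> nat_trans R C01 C01"
    and c: "\<And>V y. V \<in> \<P> \<Longrightarrow> y \<in> carrier (coinv R p V) \<Longrightarrow> s V (c1 V y) = t V (c1 V y)"
    and e_eq: "s U e = t U e"
  shows "s = t"
proof (rule nat_trans_ext[OF s t])
  have free: "s (std_free code I) x = t (std_free code I) x"
    if I: "finite I" and x: "x \<in> carrier (G (std_free code I))" for I x
  proof -
    let ?F = "std_free code I"
    have F: "?F \<in> \<P>" by (rule std_proj[OF I])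
    have v: "\<alpha> ?F x \<in> carrier ?F" by (rule \<alpha>_closed[OF F x])
    obtain y where y: "y \<in> carrier (coinv R p ?F)" "x = lift ?F (\<alpha> ?F x) \<oplus>\<^bsub>G ?F\<^esub> c1 ?F y"
      using lift_decomposition[OF I x] by blast
    obtain f where f: "f \<in> lin_hom R U ?F" "f u = \<alpha> ?F x" using U_map_exists[OF F v] by auto
    have "s ?F (lift ?F (\<alpha> ?F x)) = t ?F (lift ?F (\<alpha> ?F x))"
      using nat_trans_natural[OF s U_proj F f(1) e(1)] nat_trans_natural[OF t U_proj F f(1) e(1)]
        arr_e[OF F f(1)] f(2) e_eq by simp
    then show ?thesis
      using add_map_add[OF nat_trans_add_map[OF s F] lift_closed[OF F v] c1_closed[OF F y(1)]]
        add_map_add[OF nat_trans_add_map[OF t F] lift_closed[OF F v] c1_closed[OF F y(1)]] c[OF F y(1)]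
        y(2) by metis
  qed
  fix V x assume V: "V \<in> \<P>" and x: "x \<in> carrier (G V)"
  obtain I f g where I: "finite I" and f: "f \<in> lin_hom R V (std_free code I)"
    and g: "g \<in> lin_hom R (std_free code I) V" and gf: "\<forall>v\<in>carrier V. g (f v) = v"
    using proj_module_retract[OF code V] by blast
  let ?F = "std_free code I"
  have F: "?F \<in> \<P>" by (rule std_proj[OF I])
  have "compose (carrier V) g f = (\<lambda>v\<in>carrier V. v)"
    using gf by (auto simp: compose_def fun_eq_iff)
  then have x': "arr C01 ?F V g (arr C01 V ?F f x) = x"
    using arr_comp[OF V F V f g x] arr_id[OF V x] by simp
  have fx: "arr C01 V ?F f x \<in> carrier (G ?F)" by (rule arr_closed[OF V F f x])
  show "s V x = t V x"
    using nat_trans_natural[OF s F V g fx] nat_trans_natural[OF t F V g fx] free[OF I fx] x' by simp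
qed


section \<open>The addition cocycle\<close>

abbreviation mixed where "mixed V v w \<equiv> coinv_class R p V (necklace_sum V v w)"

lemma mixed_closed: "V \<in> \<P> \<Longrightarrow> v \<in> carrier V \<Longrightarrow> w \<in> carrier V \<Longrightarrow> mixed V v w \<in> carrier (coinv R p V)"
  using necklace_sum_closed[OF proj_module] by (simp add: carrier_coinv[OF proj_module])

lemma mixed_natural:
  assumes "V \<in> \<P>" "W \<in> \<P>" "f \<in> lin_hom R V W" "v \<in> carrier V" "w \<in> carrier V"
  shows "arr C01 V W f (c1 V (mixed V v w)) = c1 W (mixed W (f v) (f w))"
  using assms necklace_sum_closed[OF proj_module[OF assms(1)] assms(4,5)]
  by (simp add: c1_natural mixed_closed lin_hom_iff proj_module cycC1_map_class tpower_map_necklace_sum)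

lemma necklace_sum_zero:
  assumes V: "module R V" and v: "v \<in> carrier V" and w: "w \<in> carrier V" and z: "v = \<zero>\<^bsub>V\<^esub> \<or> w = \<zero>\<^bsub>V\<^esub>"
  shows "necklace_sum V v w = \<zero>\<^bsub>tpower R p V\<^esub>"
proof -
  interpret T: module R "tpower R p V" by (rule module_tpower[OF V])
  show ?thesis
    unfolding necklace_sum_def
  proof (rule T.add.finprod_one_eqI)
    fix \<epsilon> :: "bool list" assume \<epsilon>: "\<epsilon> \<in> necklaces p UNIV"
    show "tpure R p V (map (\<lambda>i. if i then v else w) \<epsilon>) = \<zero>\<^bsub>tpower R p V\<^esub>"
      by (rule tpure_zero[OF V necklace_words[OF v w \<epsilon>]]) (use z necklace_letters[OF \<epsilon>] in force)
  qed
qed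

definition defect :: "('a, 'v) module \<Rightarrow> 'v \<Rightarrow> 'v \<Rightarrow> 'c" where
  "defect V v w = lift V (v \<oplus>\<^bsub>V\<^esub> w) \<ominus>\<^bsub>G V\<^esub> (lift V v \<oplus>\<^bsub>G V\<^esub> lift V w \<oplus>\<^bsub>G V\<^esub> c1 V (mixed V v w))"

lemma defect_natural:
  assumes V: "V \<in> \<P>" and W: "W \<in> \<P>" and f: "f \<in> lin_hom R V W" and v: "v \<in> carrier V" and w: "w \<in> carrier V"
  shows "arr C01 V W f (defect V v w) = defect W (f v) (f w)"
proof -
  interpret VM: module R V by (rule proj_module[OF V])
  interpret GV: abelian_group "G V" by (rule G_group[OF V])
  have fl: "lin_map R V W f" using f by (simp add: lin_hom_iff)
  note a = arr_add_map[OF V W f]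
  note cl = lift_closed[OF V] c1_closed[OF V mixed_closed[OF V v w]] v w
  show ?thesis
    unfolding defect_def
    using cl by (simp add: add_map_minus[OF G_group[OF V] G_group[OF W] a] add_map_add[OF a]
        arr_lift[OF V W f] mixed_natural[OF V W f] lin_map_add[OF fl])
qed

text \<open>
  The trace of the mixed monomials is the difference of the tensor powers by the binomial formula.
\<close>

lemma defect_kernel:
  assumes V: "V \<in> \<P>" and v: "v \<in> carrier V" and w: "w \<in> carrier V"
  shows "\<exists>X\<in>carrier (V1 R p V). defect V v w = c1 V (psi R p V X)"
proof -
  have VM: "module R V" by (rule proj_module[OF V])
  interpret VM: module R V by (rule VM)
  interpret GV: abelian_group "G V" by (rule G_group[OF V])
  interpret T: module R "tpower R p V" by (rule module_tpower[OF VM])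
  have vw: "v \<oplus>\<^bsub>V\<^esub> w \<in> carrier V" using v w by simp
  have n: "mixed V v w \<in> carrier (coinv R p V)" by (rule mixed_closed[OF V v w])
  have ns: "necklace_sum V v w \<in> carrier (tpower R p V)" by (rule necklace_sum_closed[OF VM v w])
  note cl = lift_closed[OF V vw] lift_closed[OF V v] lift_closed[OF V w] c1_closed[OF V n]
  note t = \<tau>_add_map[OF V] and a = \<alpha>_add_map[OF V]
  have tc: "tpure R p V (replicate p v) \<in> carrier (tpower R p V)" if "v \<in> carrier V" for v
    by (rule tpure_closed[OF VM words_replicate[OF that]])
  have cs: "cyc_sum V p (necklace_sum V v w) \<in> carrier (tpower R p V)"
    by (rule lin_map_closed[OF cyc_sum_lin_map[OF VM] ns])
  let ?s = "lift V v \<oplus>\<^bsub>G V\<^esub> lift V w \<oplus>\<^bsub>G V\<^esub> c1 V (mixed V v w)"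
  have s: "?s \<in> carrier (G V)" using cl by simp
  have "\<tau> V ?s = \<tau> V (lift V (v \<oplus>\<^bsub>V\<^esub> w))"
    using cl by (simp add: add_map_add[OF t] \<tau>_lift[OF V] v w vw c0_c1[OF V n] trace_coinv_class[OF VM ns]
        tpure_power_add[OF VM v w])
  moreover have "\<alpha> V ?s = \<alpha> V (lift V (v \<oplus>\<^bsub>V\<^esub> w))"
    using cl by (simp add: add_map_add[OF a] \<alpha>_lift[OF V] v w vw c0_c1[OF V n])
  ultimately show ?thesis
    unfolding defect_def using c0_difference[OF V cl(1) s] by auto
qed

text \<open>
  Every mixed monomial contains the letter \<open>0\<close>, and the lift of \<open>0\<close> is \<open>0\<close>.
\<close>

lemma defect_axis:
  assumes w: "w = \<zero>\<^bsub>U\<^esub> \<and> v = u \<or> v = \<zero>\<^bsub>U\<^esub> \<and> w = u"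
  shows "defect U v w = \<zero>\<^bsub>G U\<^esub>"
proof -
  interpret UM: module R U by (rule U_module)
  interpret GU: abelian_group "G U" by (rule G_group[OF U_proj])
  have vw: "v \<in> carrier U" "w \<in> carrier U" using w u_closed by auto
  have "mixed U v w = \<zero>\<^bsub>coinv R p U\<^esub>"
    using necklace_sum_zero[OF U_module vw] w
      lin_map_zero[OF coinv_class_lin_map[OF U_module] module_tpower[OF U_module] module_coinv[OF U_module]]
    by auto
  then have "c1 U (mixed U v w) = \<zero>\<^bsub>G U\<^esub>"
    using add_map_zero[OF coinv_group[OF U_proj] G_group[OF U_proj] c1_add_map[OF U_proj]] by simp
  then show ?thesis
    unfolding defect_def
    using w lift_closed[OF U_proj u_closed] u_closed by (auto simp: lift_zero[OF U_proj] GU.minus_eq GU.r_neg)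
qed

text \<open>
  In the universal case of two free generators \<open>x\<close> and \<open>y\<close> the defect is \<open>\<psi>(\<xi> \<otimes> x + \<eta> \<otimes> y)\<close>. Setting \<open>y = 0\<close>
  shows \<open>\<xi> = 0\<close>, and setting \<open>x = 0\<close> shows \<open>\<eta> = 0\<close>, because the defect vanishes on the axes.
\<close>

lemma defect_zero:
  assumes V: "V \<in> \<P>" and v: "v \<in> carrier V" and w: "w \<in> carrier V"
  shows "defect V v w = \<zero>\<^bsub>G V\<^esub>"
proof -
  define a b where "a = code []" and "b = code [\<zero>]"
  have ab: "a \<noteq> b" unfolding a_def b_def by (rule two_codes[OF code])
  let ?F = "std_free code {a, b}"
  have fin: "finite {a, b}" by simp
  interpret B: char_free R p ?F "{a, b}" "std_basis code {a, b}" "std_coord code {a, b}"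
    by (rule char_free_std[OF fin])
  have F: "?F \<in> \<P>" by (rule std_proj[OF fin])
  define x y where "x = std_basis code {a, b} a" and "y = std_basis code {a, b} b"
  have xy: "x \<in> carrier ?F" "y \<in> carrier ?F"
    using B.basis_closed by (simp_all add: x_def y_def)
  have maps: "\<exists>f\<in>lin_hom R ?F W. f x = v' \<and> f y = w'" if "W \<in> \<P>" "v' \<in> carrier W" "w' \<in> carrier W" for W v' w'
    using std_free_map[OF code fin proj_module[OF that(1)], of "\<lambda>i. if i = a then v' else w'"] that ab
    by (auto simp: x_def y_def)
  interpret V1F: module R "V1 R p ?F" by (rule module_V1[OF B.F])
  interpret V1U: module R "V1 R p U" by (rule module_V1[OF U_module])
  interpret UM: module R U by (rule U_module)
  obtain X where X: "X \<in> carrier (V1 R p ?F)" "defect ?F x y = c1 ?F (psi R p ?F X)"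
    using defect_kernel[OF F xy] by blast
  define \<xi> \<eta> where "\<xi> = B.V1_coord a X" and "\<eta> = B.V1_coord b X"
  have c: "\<xi> \<in> carrier R" "\<eta> \<in> carrier R"
    using lin_map_closed[OF B.V1_coord_lin_map X(1)] by (simp_all add: \<xi>_def \<eta>_def)
  have Xd: "X = pure R (R1 R p) ?F \<xi> x \<oplus>\<^bsub>V1 R p ?F\<^esub> pure R (R1 R p) ?F \<eta> y"
  proof -
    have "X = (\<Oplus>\<^bsub>V1 R p ?F\<^esub>i\<in>{a, b}. pure R (R1 R p) ?F (B.V1_coord i X) (std_basis code {a, b} i))"
      by (rule B.V1_expansion[OF X(1)])
    then show ?thesis
      using ab pure_V1_closed[OF B.F] c xy by (simp add: \<xi>_def \<eta>_def x_def y_def)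
  qed
  have pure0: "pure R (R1 R p) U m \<zero>\<^bsub>U\<^esub> = \<zero>\<^bsub>V1 R p U\<^esub>" if "m \<in> carrier R" for m
    using lin_map_zero[OF pure_lin_right[OF module_R1 U_module, of m] U_module] module_V1[OF U_module] that
    by (simp add: V1_def)
  have axis: "psi R p U (pure R (R1 R p) U \<xi> (f x) \<oplus>\<^bsub>V1 R p U\<^esub> pure R (R1 R p) U \<eta> (f y)) = \<zero>\<^bsub>coinv R p U\<^esub>"
    if f: "f \<in> lin_hom R ?F U" and d: "defect U (f x) (f y) = \<zero>\<^bsub>G U\<^esub>" for f
  proof -
    have fl: "lin_map R ?F U f" using f by (simp add: lin_hom_iff)
    note nat = cycC1_map_psi_pure[OF B.F U_module fl]
    let ?P = "\<lambda>V m v. psi R p V (pure R (R1 R p) V m v)"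
    have pc: "?P ?F \<xi> x \<in> carrier (coinv R p ?F)" "?P ?F \<eta> y \<in> carrier (coinv R p ?F)"
      "?P U \<xi> (f x) \<in> carrier (coinv R p U)" "?P U \<eta> (f y) \<in> carrier (coinv R p U)"
      using psi_closed[OF F pure_V1_closed[OF B.F]] psi_closed[OF U_proj pure_V1_closed[OF U_module]]
        c xy lin_map_closed[OF fl] by simp_all
    have pF: "psi R p ?F X = ?P ?F \<xi> x \<oplus>\<^bsub>coinv R p ?F\<^esub> ?P ?F \<eta> y"
      unfolding Xd using lin_map_add[OF psi_lin_map[OF B.F]] pure_V1_closed[OF B.F] c xy by simp
    have pU: "psi R p U (pure R (R1 R p) U \<xi> (f x) \<oplus>\<^bsub>V1 R p U\<^esub> pure R (R1 R p) U \<eta> (f y)) =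
        ?P U \<xi> (f x) \<oplus>\<^bsub>coinv R p U\<^esub> ?P U \<eta> (f y)"
      using lin_map_add[OF psi_lin_map[OF U_module]] pure_V1_closed[OF U_module] c xy lin_map_closed[OF fl] by simp
    interpret CF: module R "coinv R p ?F" by (rule module_coinv[OF B.F])
    interpret CU: module R "coinv R p U" by (rule module_coinv[OF U_module])
    note c1F = add_map_add[OF c1_add_map[OF F], simplified] and c1U = add_map_add[OF c1_add_map[OF U_proj], simplified]
    have "\<zero>\<^bsub>G U\<^esub> = arr C01 ?F U f (defect ?F x y)"
      using defect_natural[OF F U_proj f xy] d by simp
    also have "\<dots> = arr C01 ?F U f (c1 ?F (?P ?F \<xi> x) \<oplus>\<^bsub>G ?F\<^esub> c1 ?F (?P ?F \<eta> y))"
      unfolding X(2) pF by (simp add: c1F[OF pc(1,2)])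
    also have "\<dots> = c1 U (?P U \<xi> (f x)) \<oplus>\<^bsub>G U\<^esub> c1 U (?P U \<eta> (f y))"
      using c xy by (simp add: add_map_add[OF arr_add_map[OF F U_proj f]] c1_closed[OF F] pc
          c1_natural[OF F U_proj f] nat)
    also have "\<dots> = c1 U (?P U \<xi> (f x) \<oplus>\<^bsub>coinv R p U\<^esub> ?P U \<eta> (f y))"
      by (simp add: c1U[OF pc(3,4)])
    finally have "c1 U (?P U \<xi> (f x) \<oplus>\<^bsub>coinv R p U\<^esub> ?P U \<eta> (f y)) = c1 U \<zero>\<^bsub>coinv R p U\<^esub>"
      using add_map_zero[OF coinv_group[OF U_proj] G_group[OF U_proj] c1_add_map[OF U_proj]] by simp
    then have "?P U \<xi> (f x) \<oplus>\<^bsub>coinv R p U\<^esub> ?P U \<eta> (f y) = \<zero>\<^bsub>coinv R p U\<^esub>"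
      by (rule inj_onD[OF c1_injective[OF U_proj]]) (use pc in auto)
    then show ?thesis by (simp add: pU)
  qed
  have "\<xi> = \<zero>"
  proof -
    obtain f where f: "f \<in> lin_hom R ?F U" "f x = u" "f y = \<zero>\<^bsub>U\<^esub>"
      using maps[OF U_proj u_closed UM.zero_closed] by blast
    have "defect U (f x) (f y) = \<zero>\<^bsub>G U\<^esub>" by (rule defect_axis) (use f in auto)
    from axis[OF f(1) this] show ?thesis
      using psi_u_injective[OF c(1)] f pure0[OF c(2)] pure_V1_closed[OF U_module c(1) u_closed] by simp
  qed
  moreover have "\<eta> = \<zero>"
  proof -
    obtain f where f: "f \<in> lin_hom R ?F U" "f x = \<zero>\<^bsub>U\<^esub>" "f y = u"
      using maps[OF U_proj UM.zero_closed u_closed] by blast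
    have "defect U (f x) (f y) = \<zero>\<^bsub>G U\<^esub>" by (rule defect_axis) (use f in auto)
    from axis[OF f(1) this] show ?thesis
      using psi_u_injective[OF c(2)] f pure0[OF c(1)] pure_V1_closed[OF U_module c(2) u_closed] by simp
  qed
  moreover have "pure R (R1 R p) ?F \<zero> z = \<zero>\<^bsub>V1 R p ?F\<^esub>" if "z \<in> carrier ?F" for z
    using lin_map_zero[OF pure_lin_left[OF module_R1 B.F that] module_R1] module_V1[OF B.F]
    by (simp add: V1_def)
  ultimately have "X = \<zero>\<^bsub>V1 R p ?F\<^esub>" using Xd xy by simp
  then have d0: "defect ?F x y = \<zero>\<^bsub>G ?F\<^esub>"
    using X(2) add_map_zero[OF V1_group[OF F] G_group[OF F] c1_psi_add_map[OF F]] by simp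
  obtain f where f: "f \<in> lin_hom R ?F V" "f x = v" "f y = w" using maps[OF V v w] by blast
  then show ?thesis
    using defect_natural[OF F V f(1) xy] d0
      add_map_zero[OF G_group[OF F] G_group[OF V] arr_add_map[OF F V f(1)]] by simp
qed

lemma lift_add:
  assumes V: "V \<in> \<P>" and v: "v \<in> carrier V" and w: "w \<in> carrier V"
  shows "lift V v \<oplus>\<^bsub>G V\<^esub> lift V w = lift V (v \<oplus>\<^bsub>V\<^esub> w) \<ominus>\<^bsub>G V\<^esub> c1 V (mixed V v w)"
proof -
  interpret VM: module R V by (rule proj_module[OF V])
  interpret GV: abelian_group "G V" by (rule G_group[OF V])
  note cl = lift_closed[OF V v] lift_closed[OF V w] lift_closed[OF V VM.a_closed[OF v w]]
    c1_closed[OF V mixed_closed[OF V v w]]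
  have "lift V (v \<oplus>\<^bsub>V\<^esub> w) = lift V v \<oplus>\<^bsub>G V\<^esub> lift V w \<oplus>\<^bsub>G V\<^esub> c1 V (mixed V v w)"
    using defect_zero[OF V v w] cl unfolding defect_def by (simp add: GV.minus_eq_zero_iff)
  then show ?thesis using cl by (simp add: GV.minus_eq GV.a_assoc GV.r_neg)
qed


section \<open>The endomorphism ring of a splitting\<close>

abbreviation "E \<equiv> cyclic_powers_ext R p :: ('a, 'v, 'a, ('v list \<Rightarrow> 'a) set set, ('v list \<Rightarrow> 'a) set \<times> 'v) elementary_extension"
abbreviation "R' \<equiv> sqz_ring R E C01 c1 c0"
abbreviation "over \<equiv> lies_over R E C01 c1 c0"
abbreviation "\<iota> m V v \<equiv> c1 V (psi R p V (pure R (R1 R p) V m v))"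

definition homothety :: "'a \<Rightarrow> ('a, 'v) module \<Rightarrow> 'v \<Rightarrow> 'v" where
  "homothety r V = (\<lambda>v\<in>carrier V. r \<odot>\<^bsub>V\<^esub> v)"

text \<open>
  This is \<open>[r] + i(m)\<close>, where \<open>[r]\<close> is the functor \<open>C01\<close> applied to multiplication by \<open>r\<close>.
\<close>

definition elt :: "'a \<Rightarrow> 'a \<Rightarrow> ('a, 'v) module \<Rightarrow> 'c \<Rightarrow> 'c" where
  "elt r m = (\<lambda>V\<in>\<P>. \<lambda>x\<in>carrier (G V). arr C01 V V (homothety r V) x \<oplus>\<^bsub>G V\<^esub> \<iota> m V (\<alpha> V x))"

lemma homothety: "V \<in> \<P> \<Longrightarrow> r \<in> carrier R \<Longrightarrow> homothety r V \<in> lin_hom R V V"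
  unfolding homothety_def by (rule lin_map_restrict[OF homothety_lin_map[OF proj_module] proj_module])

lemma over_iff:
  "over t r \<longleftrightarrow> (\<forall>V\<in>\<P>. (\<forall>x\<in>carrier (G V). \<tau> V (t V x) = (r [^] p) \<odot>\<^bsub>tpower R p V\<^esub> \<tau> V x \<and> \<alpha> V (t V x) = r \<odot>\<^bsub>V\<^esub> \<alpha> V x) \<and>
    (\<forall>y\<in>carrier (coinv R p V). t V (c1 V y) = c1 V ((r [^] p) \<odot>\<^bsub>coinv R p V\<^esub> y)))"
  unfolding lies_over_def ext_simps by (simp add: prod_eq_iff)

lemma pure_lin: "V \<in> \<P> \<Longrightarrow> m \<in> carrier R \<Longrightarrow> lin_map R V (V1 R p V) (pure R (R1 R p) V m)"
  unfolding V1_def by (rule pure_lin_right[OF module_R1 proj_module]) auto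

lemma \<iota>_add_map: "V \<in> \<P> \<Longrightarrow> m \<in> carrier R \<Longrightarrow> add_map V (G V) (\<iota> m V)"
  using c1_psi_add_map[of V] lin_map_add_map[OF pure_lin, of V m] by (auto simp: add_map_def Pi_def)

lemma \<iota>_closed: "V \<in> \<P> \<Longrightarrow> m \<in> carrier R \<Longrightarrow> v \<in> carrier V \<Longrightarrow> \<iota> m V v \<in> carrier (G V)"
  by (rule add_map_closed[OF \<iota>_add_map])

lemma \<iota>_add_left:
  assumes V: "V \<in> \<P>" and "m \<in> carrier R" "n \<in> carrier R" "v \<in> carrier V"
  shows "\<iota> (m \<oplus> n) V v = \<iota> m V v \<oplus>\<^bsub>G V\<^esub> \<iota> n V v"
  using add_map_add[OF c1_psi_add_map[OF V]] pure_V1_closed[OF proj_module[OF V]] assms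
  by (simp add: pure_V1_add_left[OF proj_module[OF V]])

lemma \<iota>_balanced:
  "V \<in> \<P> \<Longrightarrow> m \<in> carrier R \<Longrightarrow> r \<in> carrier R \<Longrightarrow> v \<in> carrier V \<Longrightarrow>
    \<iota> m V (r \<odot>\<^bsub>V\<^esub> v) = \<iota> ((r [^] p) \<otimes> m) V v"
  by (simp add: pure_V1_balanced proj_module)

lemma \<iota>_zero_left: "V \<in> \<P> \<Longrightarrow> v \<in> carrier V \<Longrightarrow> \<iota> \<zero> V v = \<zero>\<^bsub>G V\<^esub>"
  using lin_map_zero[OF pure_lin_left[OF module_R1 proj_module, of V v] module_R1] module_V1[OF proj_module, of V]
    add_map_zero[OF V1_group G_group c1_psi_add_map, of V]
  by (simp add: V1_def)

lemma \<iota>_zero_right: "V \<in> \<P> \<Longrightarrow> m \<in> carrier R \<Longrightarrow> \<iota> m V \<zero>\<^bsub>V\<^esub> = \<zero>\<^bsub>G V\<^esub>"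
  by (rule add_map_zero[OF module.axioms(2)[OF proj_module] G_group \<iota>_add_map])

lemma \<iota>_natural:
  assumes "V \<in> \<P>" "W \<in> \<P>" "f \<in> lin_hom R V W" "m \<in> carrier R" "v \<in> carrier V"
  shows "arr C01 V W f (\<iota> m V v) = \<iota> m W (f v)"
  using assms by (simp add: c1_natural psi_closed pure_V1_closed proj_module cycC1_map_psi_pure lin_hom_iff)

lemma \<iota>_kernel:
  assumes "V \<in> \<P>" "m \<in> carrier R" "v \<in> carrier V"
  shows "\<tau> V (\<iota> m V v) = \<zero>\<^bsub>tpower R p V\<^esub>" "\<alpha> V (\<iota> m V v) = \<zero>\<^bsub>V\<^esub>"
  using c1_psi_kernel[OF assms(1) pure_V1_closed[OF proj_module[OF assms(1)] assms(2,3)]] by auto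

lemma elt_apply:
  "V \<in> \<P> \<Longrightarrow> x \<in> carrier (G V) \<Longrightarrow> elt r m V x = arr C01 V V (homothety r V) x \<oplus>\<^bsub>G V\<^esub> \<iota> m V (\<alpha> V x)"
  by (simp add: elt_def)

lemma nat_transI:
  assumes "\<And>V. V \<in> \<P> \<Longrightarrow> add_map (G V) (G V) (t V)"
    and "\<And>V W f x. V \<in> \<P> \<Longrightarrow> W \<in> \<P> \<Longrightarrow> f \<in> lin_hom R V W \<Longrightarrow> x \<in> carrier (G V) \<Longrightarrow>
      t W (arr C01 V W f x) = arr C01 V W f (t V x)"
  shows "(\<lambda>V\<in>\<P>. \<lambda>x\<in>carrier (G V). t V x) \<in> nat_trans R C01 C01"
proof -
  have "restrict (t V) (carrier (G V)) \<in> ab_hom (G V) (G V)" if V: "V \<in> \<P>" for V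
  proof -
    interpret GV: abelian_group "G V" by (rule G_group[OF V])
    show ?thesis using assms(1)[OF V] by (auto simp: ab_hom_iff add_map_def)
  qed
  then show ?thesis
    unfolding nat_trans_def
    using assms(2) arr_closed by (auto intro!: restrict_PiE_iff[THEN iffD2])
qed

lemma add_map_sum:
  assumes A: "abelian_group A" and B: "abelian_group B" and f: "add_map A B f" and g: "add_map A B g"
  shows "add_map A B (\<lambda>x. f x \<oplus>\<^bsub>B\<^esub> g x)"
proof -
  interpret B: abelian_group B by (rule B)
  show ?thesis
    unfolding add_map_def
    using f g by (auto simp: add_map_add[OF f] add_map_add[OF g] add_map_closed[OF f] add_map_closed[OF g] B.a_ac)
qed

lemma homothety_natural:
  assumes V: "V \<in> \<P>" and W: "W \<in> \<P>" and f: "f \<in> lin_hom R V W" and r: "r \<in> carrier R" and x: "x \<in> carrier (G V)"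
  shows "arr C01 W W (homothety r W) (arr C01 V W f x) = arr C01 V W f (arr C01 V V (homothety r V) x)"
proof -
  interpret VM: module R V by (rule proj_module[OF V])
  have fl: "lin_map R V W f" using f by (simp add: lin_hom_iff)
  have "compose (carrier V) (homothety r W) f = compose (carrier V) f (homothety r V)"
    using r by (auto simp: compose_def homothety_def fun_eq_iff lin_map_closed[OF fl] lin_map_smult[OF fl])
  then show ?thesis
    using arr_comp[OF V W W f homothety[OF W r] x] arr_comp[OF V V W homothety[OF V r] f x] by simp
qed

context
  fixes r m assumes r: "r \<in> carrier R" and m: "m \<in> carrier R"
begin

lemma elt_nat_trans: "elt r m \<in> nat_trans R C01 C01"
  unfolding elt_def
proof (rule nat_transI)
  fix V assume V: "V \<in> \<P>"
  have "add_map (G V) (G V) (\<lambda>x. \<iota> m V (\<alpha> V x))"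
    using \<iota>_add_map[OF V m] \<alpha>_add_map[OF V] by (auto simp: add_map_def Pi_def)
  then show "add_map (G V) (G V) (\<lambda>x. arr C01 V V (homothety r V) x \<oplus>\<^bsub>G V\<^esub> \<iota> m V (\<alpha> V x))"
    by (rule add_map_sum[OF G_group[OF V] G_group[OF V] arr_add_map[OF V V homothety[OF V r]]])
next
  fix V W f x assume V: "V \<in> \<P>" and W: "W \<in> \<P>" and f: "f \<in> lin_hom R V W" and x: "x \<in> carrier (G V)"
  have h: "arr C01 V V (homothety r V) x \<in> carrier (G V)" by (rule arr_closed[OF V V homothety[OF V r] x])
  show "arr C01 W W (homothety r W) (arr C01 V W f x) \<oplus>\<^bsub>G W\<^esub> \<iota> m W (\<alpha> W (arr C01 V W f x)) =
      arr C01 V W f (arr C01 V V (homothety r V) x \<oplus>\<^bsub>G V\<^esub> \<iota> m V (\<alpha> V x))"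
    by (simp add: add_map_add[OF arr_add_map[OF V W f] h \<iota>_closed[OF V m \<alpha>_closed[OF V x]]]
        homothety_natural[OF V W f r x] \<iota>_natural[OF V W f m \<alpha>_closed[OF V x]] c0_natural(2)[OF V W f x])
qed

lemma elt_over: "over (elt r m) r"
  unfolding over_iff
proof (intro ballI conjI)
  fix V assume V: "V \<in> \<P>"
  have VM: "module R V" by (rule proj_module[OF V])
  interpret VM: module R V by (rule VM)
  interpret T: module R "tpower R p V" by (rule module_tpower[OF VM])
  interpret C: module R "coinv R p V" by (rule module_coinv[OF VM])
  interpret GV: abelian_group "G V" by (rule G_group[OF V])
  have hr: "homothety r V v = r \<odot>\<^bsub>V\<^esub> v" if "v \<in> carrier V" for v using that by (simp add: homothety_def)
  show "\<tau> V (elt r m V x) = (r [^] p) \<odot>\<^bsub>tpower R p V\<^esub> \<tau> V x" "\<alpha> V (elt r m V x) = r \<odot>\<^bsub>V\<^esub> \<alpha> V x"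
    if x: "x \<in> carrier (G V)" for x
  proof -
    have h: "arr C01 V V (homothety r V) x \<in> carrier (G V)" by (rule arr_closed[OF V V homothety[OF V r] x])
    have i: "\<iota> m V (\<alpha> V x) \<in> carrier (G V)" by (rule \<iota>_closed[OF V m \<alpha>_closed[OF V x]])
    note k = \<iota>_kernel[OF V m \<alpha>_closed[OF V x]]
    have "\<tau> V (arr C01 V V (homothety r V) x) = (r [^] p) \<odot>\<^bsub>tpower R p V\<^esub> \<tau> V x"
      using c0_natural(1)[OF V V homothety[OF V r] x] tpower_map_homothety[OF VM r \<tau>_closed[OF V x] hr] by simp
    then show "\<tau> V (elt r m V x) = (r [^] p) \<odot>\<^bsub>tpower R p V\<^esub> \<tau> V x"
      using r \<tau>_closed[OF V x] by (simp add: elt_apply[OF V x] add_map_add[OF \<tau>_add_map[OF V] h i] k)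
    show "\<alpha> V (elt r m V x) = r \<odot>\<^bsub>V\<^esub> \<alpha> V x"
      using r \<alpha>_closed[OF V x] by (simp add: elt_apply[OF V x] add_map_add[OF \<alpha>_add_map[OF V] h i] k
          c0_natural(2)[OF V V homothety[OF V r] x] hr)
  qed
  fix y assume y: "y \<in> carrier (coinv R p V)"
  have "arr C01 V V (homothety r V) (c1 V y) = c1 V ((r [^] p) \<odot>\<^bsub>coinv R p V\<^esub> y)"
    using c1_natural[OF V V homothety[OF V r] y] cycC1_map_homothety[OF VM r hr] y by simp
  then show "elt r m V (c1 V y) = c1 V ((r [^] p) \<odot>\<^bsub>coinv R p V\<^esub> y)"
    using elt_apply[OF V c1_closed[OF V y]] c1_closed[OF V] y r
    by (simp add: c0_c1[OF V y] \<iota>_zero_right[OF V m])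
qed

lemma elt_e: "elt r m U e = lift U (r \<odot>\<^bsub>U\<^esub> u) \<oplus>\<^bsub>G U\<^esub> \<iota> m U u"
  using elt_apply[OF U_proj e(1)] arr_e[OF U_proj homothety[OF U_proj r]] u_closed
  by (simp add: e(3) homothety_def)

lemma elt_carrier: "elt r m \<in> carrier R'"
  using elt_nat_trans elt_over r by (auto simp: sqz_ring_def)

lemma elt_eqI:
  assumes t: "t \<in> nat_trans R C01 C01" and o: "over t r"
    and v: "t U e = lift U (r \<odot>\<^bsub>U\<^esub> u) \<oplus>\<^bsub>G U\<^esub> \<iota> m U u"
  shows "t = elt r m"
proof (rule nat_trans_determined[OF t elt_nat_trans])
  show "t V (c1 V y) = elt r m V (c1 V y)" if "V \<in> \<P>" "y \<in> carrier (coinv R p V)" for V y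
    using o elt_over that unfolding over_iff by auto
  show "t U e = elt r m U e" using v elt_e by simp
qed

end

lemma over_unique:
  assumes "over t r" "over t s" "r \<in> carrier R" "s \<in> carrier R"
  shows "r = s"
proof -
  have "r \<odot>\<^bsub>U\<^esub> u = s \<odot>\<^bsub>U\<^esub> u"
    using assms(1,2) U_proj e(1) e(3) unfolding over_iff by metis
  then show ?thesis using \<kappa>U_smult assms(3,4) by metis
qed

lemma elt_q:
  assumes "r \<in> carrier R" "m \<in> carrier R"
  shows "sqz_q R E C01 c1 c0 (elt r m) = r"
  unfolding sqz_q_def by (rule the_equality) (use assms elt_over over_unique in blast)+

text \<open>
  If \<open>t\<close> lies over \<open>r\<close>, the values of \<open>t\<close> and \<open>[r]\<close> at \<open>e\<close> have the same image in \<open>C0(U)\<close>. They differ by an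
  element of \<open>\<psi>(V1(U))\<close>, and \<open>V1(U)\<close> consists of the elements \<open>m \<otimes> u\<close>.
\<close>

lemma elt_surj:
  assumes "t \<in> carrier R'"
  shows "\<exists>r\<in>carrier R. \<exists>m\<in>carrier R. t = elt r m"
proof -
  obtain r where t: "t \<in> nat_trans R C01 C01" and r: "r \<in> carrier R" and o: "over t r"
    using assms by (auto simp: sqz_ring_def)
  interpret UM: module R U by (rule U_module)
  interpret T: module R "tpower R p U" by (rule module_tpower[OF U_module])
  interpret GU: abelian_group "G U" by (rule G_group[OF U_proj])
  have te: "t U e \<in> carrier (G U)" by (rule add_map_closed[OF nat_trans_add_map[OF t U_proj] e(1)])
  have oe: "over (elt r \<zero>) r" by (rule elt_over[OF r zero_closed])
  have se: "elt r \<zero> U e \<in> carrier (G U)"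
    by (rule add_map_closed[OF nat_trans_add_map[OF elt_nat_trans[OF r zero_closed] U_proj] e(1)])
  have "\<tau> U (t U e) = \<tau> U (elt r \<zero> U e)" "\<alpha> U (t U e) = \<alpha> U (elt r \<zero> U e)"
    using o oe U_proj e(1) unfolding over_iff by auto
  then obtain X where X: "X \<in> carrier (V1 R p U)" "t U e = elt r \<zero> U e \<oplus>\<^bsub>G U\<^esub> c1 U (psi R p U X)"
    using c0_difference[OF U_proj te se] by auto
  obtain m where m: "m \<in> carrier R" "X = pure R (R1 R p) U m u" using V1_U[OF X(1)] by blast
  have "t U e = lift U (r \<odot>\<^bsub>U\<^esub> u) \<oplus>\<^bsub>G U\<^esub> \<iota> m U u"
    unfolding X(2) m(2) using lift_closed[OF U_proj U_smult_closed[OF r]]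
    by (simp add: elt_e[OF r zero_closed] \<iota>_zero_left[OF U_proj u_closed])
  then show ?thesis using elt_eqI[OF r m(1) t o] r m(1) by blast
qed

lemma elt_inject:
  assumes "r \<in> carrier R" "m \<in> carrier R" "s \<in> carrier R" "n \<in> carrier R" and eq: "elt r m = elt s n"
  shows "r = s \<and> m = n"
proof
  show rs: "r = s" using elt_q assms by metis
  interpret GU: abelian_group "G U" by (rule G_group[OF U_proj])
  have "lift U (r \<odot>\<^bsub>U\<^esub> u) \<oplus>\<^bsub>G U\<^esub> \<iota> m U u = lift U (r \<odot>\<^bsub>U\<^esub> u) \<oplus>\<^bsub>G U\<^esub> \<iota> n U u"
    using elt_e[OF assms(1,2)] elt_e[OF assms(3,4)] eq rs by simp
  then have mn: "\<iota> m U u = \<iota> n U u"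
    using lift_closed[OF U_proj U_smult_closed[OF assms(1)]] \<iota>_closed[OF U_proj _ u_closed] assms by simp
  have c: "m \<ominus> n \<in> carrier R" using assms by simp
  have "m = (m \<ominus> n) \<oplus> n" using assms by (simp add: minus_eq a_assoc l_neg)
  then have "\<iota> m U u = \<iota> (m \<ominus> n) U u \<oplus>\<^bsub>G U\<^esub> \<iota> n U u"
    using \<iota>_add_left[OF U_proj c assms(4) u_closed] by simp
  then have "\<iota> (m \<ominus> n) U u = \<zero>\<^bsub>G U\<^esub>"
    using mn \<iota>_closed[OF U_proj c u_closed] \<iota>_closed[OF U_proj assms(4) u_closed]
    by (metis GU.add.r_cancel_one')
  then have "c1 U (psi R p U (pure R (R1 R p) U (m \<ominus> n) u)) = c1 U \<zero>\<^bsub>coinv R p U\<^esub>"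
    using add_map_zero[OF coinv_group[OF U_proj] G_group[OF U_proj] c1_add_map[OF U_proj]] by simp
  then have "psi R p U (pure R (R1 R p) U (m \<ominus> n) u) = \<zero>\<^bsub>coinv R p U\<^esub>"
    by (rule inj_onD[OF c1_injective[OF U_proj]])
      (use psi_closed[OF U_proj pure_V1_closed[OF U_module c u_closed]]
        abelian_monoid.zero_closed[OF abelian_group.axioms(1)[OF coinv_group[OF U_proj]]] in auto)
  then have "m \<ominus> n = \<zero>" by (rule psi_u_injective[OF c])
  then show "m = n" using assms(2,4) by (simp add: minus_eq_zero_iff)
qed

lemma sum_nat_trans:
  assumes s: "s \<in> nat_trans R C01 C01" and t: "t \<in> nat_trans R C01 C01"
  shows "s \<oplus>\<^bsub>R'\<^esub> t \<in> nat_trans R C01 C01"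
proof -
  have "(\<lambda>V\<in>\<P>. \<lambda>x\<in>carrier (G V). s V x \<oplus>\<^bsub>G V\<^esub> t V x) \<in> nat_trans R C01 C01"
  proof (rule nat_transI)
    show "add_map (G V) (G V) (\<lambda>x. s V x \<oplus>\<^bsub>G V\<^esub> t V x)" if "V \<in> \<P>" for V
      by (rule add_map_sum[OF G_group[OF that] G_group[OF that] nat_trans_add_map[OF s that] nat_trans_add_map[OF t that]])
    fix V W f x assume V: "V \<in> \<P>" and W: "W \<in> \<P>" and f: "f \<in> lin_hom R V W" and x: "x \<in> carrier (G V)"
    show "s W (arr C01 V W f x) \<oplus>\<^bsub>G W\<^esub> t W (arr C01 V W f x) = arr C01 V W f (s V x \<oplus>\<^bsub>G V\<^esub> t V x)"
      by (simp add: nat_trans_natural[OF s V W f x] nat_trans_natural[OF t V W f x]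
          add_map_add[OF arr_add_map[OF V W f] add_map_closed[OF nat_trans_add_map[OF s V] x]
            add_map_closed[OF nat_trans_add_map[OF t V] x]])
  qed
  then show ?thesis by (simp add: sqz_ring_def)
qed

lemma comp_nat_trans:
  assumes s: "s \<in> nat_trans R C01 C01" and t: "t \<in> nat_trans R C01 C01"
  shows "s \<otimes>\<^bsub>R'\<^esub> t \<in> nat_trans R C01 C01"
proof -
  have "(\<lambda>V\<in>\<P>. \<lambda>x\<in>carrier (G V). s V (t V x)) \<in> nat_trans R C01 C01"
  proof (rule nat_transI)
    show "add_map (G V) (G V) (\<lambda>x. s V (t V x))" if "V \<in> \<P>" for V
      using nat_trans_add_map[OF s that] nat_trans_add_map[OF t that] by (auto simp: add_map_def Pi_def)
    fix V W f x assume V: "V \<in> \<P>" and W: "W \<in> \<P>" and f: "f \<in> lin_hom R V W" and x: "x \<in> carrier (G V)"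
    show "s W (t W (arr C01 V W f x)) = arr C01 V W f (s V (t V x))"
      by (simp add: nat_trans_natural[OF t V W f x]
          nat_trans_natural[OF s V W f add_map_closed[OF nat_trans_add_map[OF t V] x]])
  qed
  then show ?thesis by (simp add: sqz_ring_def compose_def)
qed

lemma R'_apply:
  "V \<in> \<P> \<Longrightarrow> x \<in> carrier (G V) \<Longrightarrow> (s \<oplus>\<^bsub>R'\<^esub> t) V x = s V x \<oplus>\<^bsub>G V\<^esub> t V x"
  "V \<in> \<P> \<Longrightarrow> x \<in> carrier (G V) \<Longrightarrow> (s \<otimes>\<^bsub>R'\<^esub> t) V x = s V (t V x)"
  "V \<in> \<P> \<Longrightarrow> x \<in> carrier (G V) \<Longrightarrow> \<one>\<^bsub>R'\<^esub> V x = x"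
  "V \<in> \<P> \<Longrightarrow> x \<in> carrier (G V) \<Longrightarrow> \<zero>\<^bsub>R'\<^esub> V x = \<zero>\<^bsub>G V\<^esub>"
  by (simp_all add: sqz_ring_def compose_def)


section \<open>Comparison with Witt vectors\<close>

lemma mixed_U:
  assumes r: "r \<in> carrier R" and s: "s \<in> carrier R"
  shows "c1 U (mixed U (r \<odot>\<^bsub>U\<^esub> u) (s \<odot>\<^bsub>U\<^esub> u)) = \<iota> (witt_cocycle r s) U u"
proof -
  interpret U: char_free R p U "{pt}" "std_basis code {pt}" "std_coord code {pt}" by (rule U_free)
  show ?thesis
    using U.necklace_sum_rank_one[OF refl r s] psi_pure[OF U_module witt_cocycle_closed[OF r s] u_closed]
    by (simp add: u_def)
qed

lemma \<iota>_neg: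
  assumes m: "m \<in> carrier R"
  shows "\<iota> (\<ominus> m) U u = \<ominus>\<^bsub>G U\<^esub> \<iota> m U u"
proof -
  interpret GU: abelian_group "G U" by (rule G_group[OF U_proj])
  have "\<iota> (\<ominus> m) U u \<oplus>\<^bsub>G U\<^esub> \<iota> m U u = \<zero>\<^bsub>G U\<^esub>"
    using \<iota>_add_left[OF U_proj a_inv_closed[OF m] m u_closed] m
    by (simp add: l_neg \<iota>_zero_left[OF U_proj u_closed])
  then show ?thesis
    using \<iota>_closed[OF U_proj _ u_closed] m by (intro GU.minus_equality[symmetric]) auto
qed

context
  fixes r m s n
  assumes r: "r \<in> carrier R" and m: "m \<in> carrier R" and s: "s \<in> carrier R" and n: "n \<in> carrier R"
begin

text \<open>
  Both sides lie over \<open>r + s\<close>, so it suffices to compare the values at \<open>e\<close>. There \<open>lift_add\<close> for \<open>r u\<close> and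
  \<open>s u\<close> contributes the cocycle.
\<close>

lemma elt_add: "elt r m \<oplus>\<^bsub>R'\<^esub> elt s n = elt (r \<oplus> s) ((m \<oplus> n) \<ominus> witt_cocycle r s)"
proof (rule elt_eqI)
  note w = witt_cocycle_closed[OF r s]
  show "r \<oplus> s \<in> carrier R" "(m \<oplus> n) \<ominus> witt_cocycle r s \<in> carrier R" using r s m n w by auto
  show "elt r m \<oplus>\<^bsub>R'\<^esub> elt s n \<in> nat_trans R C01 C01"
    by (rule sum_nat_trans[OF elt_nat_trans[OF r m] elt_nat_trans[OF s n]])
  note o = elt_over[OF r m] elt_over[OF s n]
  show "over (elt r m \<oplus>\<^bsub>R'\<^esub> elt s n) (r \<oplus> s)"
    unfolding over_iff
  proof (intro ballI conjI)
    fix V assume V: "V \<in> \<P>"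
    have VM: "module R V" by (rule proj_module[OF V])
    interpret VM: module R V by (rule VM)
    interpret T: module R "tpower R p V" by (rule module_tpower[OF VM])
    interpret C: module R "coinv R p V" by (rule module_coinv[OF VM])
    show "\<tau> V ((elt r m \<oplus>\<^bsub>R'\<^esub> elt s n) V x) = ((r \<oplus> s) [^] p) \<odot>\<^bsub>tpower R p V\<^esub> \<tau> V x"
      "\<alpha> V ((elt r m \<oplus>\<^bsub>R'\<^esub> elt s n) V x) = (r \<oplus> s) \<odot>\<^bsub>V\<^esub> \<alpha> V x" if x: "x \<in> carrier (G V)" for x
    proof -
      have cl: "elt r m V x \<in> carrier (G V)" "elt s n V x \<in> carrier (G V)"
        using add_map_closed[OF nat_trans_add_map[OF elt_nat_trans V] x] r s m n by auto
      have ov: "\<tau> V (elt r m V x) = (r [^] p) \<odot>\<^bsub>tpower R p V\<^esub> \<tau> V x" "\<alpha> V (elt r m V x) = r \<odot>\<^bsub>V\<^esub> \<alpha> V x"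
        "\<tau> V (elt s n V x) = (s [^] p) \<odot>\<^bsub>tpower R p V\<^esub> \<tau> V x" "\<alpha> V (elt s n V x) = s \<odot>\<^bsub>V\<^esub> \<alpha> V x"
        using o V x unfolding over_iff by auto
      show "\<tau> V ((elt r m \<oplus>\<^bsub>R'\<^esub> elt s n) V x) = ((r \<oplus> s) [^] p) \<odot>\<^bsub>tpower R p V\<^esub> \<tau> V x"
        using r s \<tau>_closed[OF V x]
        by (simp add: R'_apply[OF V x] add_map_add[OF \<tau>_add_map[OF V] cl] ov frobenius_add T.smult_l_distr)
      show "\<alpha> V ((elt r m \<oplus>\<^bsub>R'\<^esub> elt s n) V x) = (r \<oplus> s) \<odot>\<^bsub>V\<^esub> \<alpha> V x"
        using r s \<alpha>_closed[OF V x]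
        by (simp add: R'_apply[OF V x] add_map_add[OF \<alpha>_add_map[OF V] cl] ov VM.smult_l_distr)
    qed
    fix y assume y: "y \<in> carrier (coinv R p V)"
    have ov: "elt r m V (c1 V y) = c1 V ((r [^] p) \<odot>\<^bsub>coinv R p V\<^esub> y)"
      "elt s n V (c1 V y) = c1 V ((s [^] p) \<odot>\<^bsub>coinv R p V\<^esub> y)"
      using o V y unfolding over_iff by auto
    show "(elt r m \<oplus>\<^bsub>R'\<^esub> elt s n) V (c1 V y) = c1 V (((r \<oplus> s) [^] p) \<odot>\<^bsub>coinv R p V\<^esub> y)"
      using r s y add_map_add[OF c1_add_map[OF V]]
      by (simp add: R'_apply[OF V c1_closed[OF V y]] ov frobenius_add C.smult_l_distr)
  qed
  interpret UM: module R U by (rule U_module)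
  interpret GU: abelian_group "G U" by (rule G_group[OF U_proj])
  note l = lift_closed[OF U_proj U_smult_closed] and i = \<iota>_closed[OF U_proj _ u_closed]
  have "lift U (r \<odot>\<^bsub>U\<^esub> u) \<oplus>\<^bsub>G U\<^esub> lift U (s \<odot>\<^bsub>U\<^esub> u) =
      lift U ((r \<oplus> s) \<odot>\<^bsub>U\<^esub> u) \<ominus>\<^bsub>G U\<^esub> \<iota> (witt_cocycle r s) U u"
    using lift_add[OF U_proj U_smult_closed[OF r] U_smult_closed[OF s]] mixed_U[OF r s] r s u_closed
    by (simp add: UM.smult_l_distr)
  moreover have "(elt r m \<oplus>\<^bsub>R'\<^esub> elt s n) U e =
      (lift U (r \<odot>\<^bsub>U\<^esub> u) \<oplus>\<^bsub>G U\<^esub> lift U (s \<odot>\<^bsub>U\<^esub> u)) \<oplus>\<^bsub>G U\<^esub> (\<iota> m U u \<oplus>\<^bsub>G U\<^esub> \<iota> n U u)"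
    using l r s i m n
    by (simp add: R'_apply[OF U_proj e(1)] elt_e[OF r m] elt_e[OF s n] GU.a_ac)
  ultimately show "(elt r m \<oplus>\<^bsub>R'\<^esub> elt s n) U e =
      lift U ((r \<oplus> s) \<odot>\<^bsub>U\<^esub> u) \<oplus>\<^bsub>G U\<^esub> \<iota> ((m \<oplus> n) \<ominus> witt_cocycle r s) U u"
    using l r s i m n w
    by (simp add: minus_eq GU.minus_eq \<iota>_add_left[OF U_proj _ _ u_closed] \<iota>_neg GU.a_ac)
qed

text \<open>
  At \<open>e\<close>, the endomorphism \<open>[r] + i(m)\<close> is applied to \<open>lift (s u)\<close>, where \<open>i(m)\<close> yields \<open>m \<otimes> s u = s\<^sup>p m \<otimes> u\<close>, and
  to \<open>i(n) e\<close> in the image of \<open>c1\<close>, where it acts as \<open>r\<close>, that is, through \<open>r\<^sup>p\<close>.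
\<close>

lemma elt_mult: "elt r m \<otimes>\<^bsub>R'\<^esub> elt s n = elt (r \<otimes> s) ((r [^] p) \<otimes> n \<oplus> (s [^] p) \<otimes> m)"
proof (rule elt_eqI)
  show "r \<otimes> s \<in> carrier R" "(r [^] p) \<otimes> n \<oplus> (s [^] p) \<otimes> m \<in> carrier R" using r s m n by auto
  show "elt r m \<otimes>\<^bsub>R'\<^esub> elt s n \<in> nat_trans R C01 C01"
    by (rule comp_nat_trans[OF elt_nat_trans[OF r m] elt_nat_trans[OF s n]])
  note o = elt_over[OF r m] elt_over[OF s n]
  show "over (elt r m \<otimes>\<^bsub>R'\<^esub> elt s n) (r \<otimes> s)"
    unfolding over_iff
  proof (intro ballI conjI)
    fix V assume V: "V \<in> \<P>"
    have VM: "module R V" by (rule proj_module[OF V])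
    interpret VM: module R V by (rule VM)
    interpret T: module R "tpower R p V" by (rule module_tpower[OF VM])
    interpret C: module R "coinv R p V" by (rule module_coinv[OF VM])
    show "\<tau> V ((elt r m \<otimes>\<^bsub>R'\<^esub> elt s n) V x) = ((r \<otimes> s) [^] p) \<odot>\<^bsub>tpower R p V\<^esub> \<tau> V x"
      "\<alpha> V ((elt r m \<otimes>\<^bsub>R'\<^esub> elt s n) V x) = (r \<otimes> s) \<odot>\<^bsub>V\<^esub> \<alpha> V x" if x: "x \<in> carrier (G V)" for x
    proof -
      have cl: "elt s n V x \<in> carrier (G V)"
        by (rule add_map_closed[OF nat_trans_add_map[OF elt_nat_trans[OF s n] V] x])
      have ov: "\<tau> V (elt r m V (elt s n V x)) = (r [^] p) \<odot>\<^bsub>tpower R p V\<^esub> \<tau> V (elt s n V x)"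
        "\<alpha> V (elt r m V (elt s n V x)) = r \<odot>\<^bsub>V\<^esub> \<alpha> V (elt s n V x)"
        "\<tau> V (elt s n V x) = (s [^] p) \<odot>\<^bsub>tpower R p V\<^esub> \<tau> V x" "\<alpha> V (elt s n V x) = s \<odot>\<^bsub>V\<^esub> \<alpha> V x"
        using o V x cl unfolding over_iff by auto
      show "\<tau> V ((elt r m \<otimes>\<^bsub>R'\<^esub> elt s n) V x) = ((r \<otimes> s) [^] p) \<odot>\<^bsub>tpower R p V\<^esub> \<tau> V x"
        using r s \<tau>_closed[OF V x]
        by (simp add: R'_apply[OF V x] ov nat_pow_distrib T.smult_assoc1)
      show "\<alpha> V ((elt r m \<otimes>\<^bsub>R'\<^esub> elt s n) V x) = (r \<otimes> s) \<odot>\<^bsub>V\<^esub> \<alpha> V x"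
        using r s \<alpha>_closed[OF V x] by (simp add: R'_apply[OF V x] ov VM.smult_assoc1)
    qed
    fix y assume y: "y \<in> carrier (coinv R p V)"
    then have sy: "(s [^] p) \<odot>\<^bsub>coinv R p V\<^esub> y \<in> carrier (coinv R p V)" using s by simp
    have ov: "elt r m V (c1 V ((s [^] p) \<odot>\<^bsub>coinv R p V\<^esub> y)) =
        c1 V ((r [^] p) \<odot>\<^bsub>coinv R p V\<^esub> ((s [^] p) \<odot>\<^bsub>coinv R p V\<^esub> y))"
      "elt s n V (c1 V y) = c1 V ((s [^] p) \<odot>\<^bsub>coinv R p V\<^esub> y)"
      using o V y sy unfolding over_iff by auto
    show "(elt r m \<otimes>\<^bsub>R'\<^esub> elt s n) V (c1 V y) = c1 V (((r \<otimes> s) [^] p) \<odot>\<^bsub>coinv R p V\<^esub> y)"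
      using r s y by (simp add: R'_apply[OF V c1_closed[OF V y]] ov nat_pow_distrib C.smult_assoc1)
  qed
  interpret UM: module R U by (rule U_module)
  interpret GU: abelian_group "G U" by (rule G_group[OF U_proj])
  have su: "s \<odot>\<^bsub>U\<^esub> u \<in> carrier U" by (rule U_smult_closed[OF s])
  have ls: "lift U (s \<odot>\<^bsub>U\<^esub> u) \<in> carrier (G U)" by (rule lift_closed[OF U_proj su])
  have pn: "psi R p U (pure R (R1 R p) U n u) \<in> carrier (coinv R p U)"
    by (rule psi_closed[OF U_proj pure_V1_closed[OF U_module n u_closed]])
  have i: "\<iota> k U u \<in> carrier (G U)" if "k \<in> carrier R" for k by (rule \<iota>_closed[OF U_proj that u_closed])
  have "(elt r m \<otimes>\<^bsub>R'\<^esub> elt s n) U e = elt r m U (lift U (s \<odot>\<^bsub>U\<^esub> u) \<oplus>\<^bsub>G U\<^esub> \<iota> n U u)"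
    by (simp add: R'_apply[OF U_proj e(1)] elt_e[OF s n])
  also have "\<dots> = elt r m U (lift U (s \<odot>\<^bsub>U\<^esub> u)) \<oplus>\<^bsub>G U\<^esub> elt r m U (\<iota> n U u)"
    by (rule add_map_add[OF nat_trans_add_map[OF elt_nat_trans[OF r m] U_proj] ls i[OF n]])
  also have "elt r m U (lift U (s \<odot>\<^bsub>U\<^esub> u)) = lift U ((r \<otimes> s) \<odot>\<^bsub>U\<^esub> u) \<oplus>\<^bsub>G U\<^esub> \<iota> ((s [^] p) \<otimes> m) U u"
    using arr_lift[OF U_proj U_proj homothety[OF U_proj r] su] r s su u_closed
    by (simp add: elt_apply[OF U_proj ls] \<alpha>_lift[OF U_proj su] \<iota>_balanced[OF U_proj m s u_closed]
        homothety_def UM.smult_assoc1)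
  also have "elt r m U (\<iota> n U u) = \<iota> ((r [^] p) \<otimes> n) U u"
  proof -
    have "elt r m U (\<iota> n U u) = c1 U ((r [^] p) \<odot>\<^bsub>coinv R p U\<^esub> psi R p U (pure R (R1 R p) U n u))"
      using o(1) U_proj pn unfolding over_iff by auto
    also have "\<dots> = c1 U (psi R p U (r \<odot>\<^bsub>V1 R p U\<^esub> pure R (R1 R p) U n u))"
      using lin_map_smult[OF psi_lin_map[OF U_module] r pure_V1_closed[OF U_module n u_closed]] by simp
    also have "r \<odot>\<^bsub>V1 R p U\<^esub> pure R (R1 R p) U n u = pure R (R1 R p) U ((r [^] p) \<otimes> n) u"
      using lin_map_smult[OF pure_lin_left[OF module_R1 U_module u_closed] r, of n] n by (simp add: V1_def)
    finally show ?thesis .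
  qed
  finally show "(elt r m \<otimes>\<^bsub>R'\<^esub> elt s n) U e =
      lift U ((r \<otimes> s) \<odot>\<^bsub>U\<^esub> u) \<oplus>\<^bsub>G U\<^esub> \<iota> ((r [^] p) \<otimes> n \<oplus> (s [^] p) \<otimes> m) U u"
    using i r s m n lift_closed[OF U_proj U_smult_closed, of "r \<otimes> s"]
    by (simp add: \<iota>_add_left[OF U_proj _ _ u_closed] GU.a_ac)
qed

end

lemma elt_one: "\<one>\<^bsub>R'\<^esub> = elt \<one> \<zero>"
proof (rule elt_eqI[OF one_closed zero_closed])
  show "\<one>\<^bsub>R'\<^esub> \<in> nat_trans R C01 C01"
    using nat_transI[of "\<lambda>V x. x"] by (simp add: sqz_ring_def add_map_def)
  show "over \<one>\<^bsub>R'\<^esub> \<one>"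
    unfolding over_iff
    using module.smult_one[OF proj_module] module.smult_one[OF module_tpower[OF proj_module]]
      module.smult_one[OF module_coinv[OF proj_module]]
    by (simp add: R'_apply c1_closed \<tau>_closed \<alpha>_closed)
  interpret UM: module R U by (rule U_module)
  interpret GU: abelian_group "G U" by (rule G_group[OF U_proj])
  have "lift U u = e"
  proof -
    have "(\<lambda>v\<in>carrier U. v) \<in> lin_hom R U U"
      by (rule lin_map_restrict[OF _ U_module]) (simp add: lin_map_def)
    from arr_e[OF U_proj this] show ?thesis using arr_id[OF U_proj e(1)] u_closed by simp
  qed
  then show "\<one>\<^bsub>R'\<^esub> U e = lift U (\<one> \<odot>\<^bsub>U\<^esub> u) \<oplus>\<^bsub>G U\<^esub> \<iota> \<zero> U u"
    using u_closed e(1) by (simp add: R'_apply[OF U_proj e(1)] \<iota>_zero_left[OF U_proj u_closed])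
qed

lemma elt_zero: "\<zero>\<^bsub>R'\<^esub> = elt \<zero> \<zero>"
proof (rule elt_eqI[OF zero_closed zero_closed])
  have z: "\<zero>\<^bsub>G V\<^esub> \<in> carrier (G V)" "\<zero>\<^bsub>G V\<^esub> \<oplus>\<^bsub>G V\<^esub> \<zero>\<^bsub>G V\<^esub> = \<zero>\<^bsub>G V\<^esub>" if "V \<in> \<P>" for V
  proof -
    interpret GV: abelian_group "G V" by (rule G_group[OF that])
    show "\<zero>\<^bsub>G V\<^esub> \<in> carrier (G V)" "\<zero>\<^bsub>G V\<^esub> \<oplus>\<^bsub>G V\<^esub> \<zero>\<^bsub>G V\<^esub> = \<zero>\<^bsub>G V\<^esub>" by auto
  qed
  have "(\<lambda>V\<in>\<P>. \<lambda>x\<in>carrier (G V). \<zero>\<^bsub>G V\<^esub>) \<in> nat_trans R C01 C01"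
    by (rule nat_transI)
      (use z add_map_zero[OF G_group G_group arr_add_map] in \<open>auto simp: add_map_def\<close>)
  then show "\<zero>\<^bsub>R'\<^esub> \<in> nat_trans R C01 C01" by (simp add: sqz_ring_def)
  show "over \<zero>\<^bsub>R'\<^esub> \<zero>"
    unfolding over_iff
  proof (intro ballI conjI)
    fix V assume V: "V \<in> \<P>"
    have VM: "module R V" by (rule proj_module[OF V])
    interpret VM: module R V by (rule VM)
    interpret T: module R "tpower R p V" by (rule module_tpower[OF VM])
    interpret C: module R "coinv R p V" by (rule module_coinv[OF VM])
    have p0: "\<zero> [^] p = \<zero>" using p_pos by (simp add: nat_pow_zero)
    show "\<tau> V (\<zero>\<^bsub>R'\<^esub> V x) = (\<zero> [^] p) \<odot>\<^bsub>tpower R p V\<^esub> \<tau> V x" "\<alpha> V (\<zero>\<^bsub>R'\<^esub> V x) = \<zero> \<odot>\<^bsub>V\<^esub> \<alpha> V x"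
      if x: "x \<in> carrier (G V)" for x
      using add_map_zero[OF G_group[OF V] T.abelian_group_axioms \<tau>_add_map[OF V]]
        add_map_zero[OF G_group[OF V] VM.abelian_group_axioms \<alpha>_add_map[OF V]]
        \<tau>_closed[OF V x] \<alpha>_closed[OF V x] by (simp_all add: R'_apply[OF V x] p0)
    show "\<zero>\<^bsub>R'\<^esub> V (c1 V y) = c1 V ((\<zero> [^] p) \<odot>\<^bsub>coinv R p V\<^esub> y)" if y: "y \<in> carrier (coinv R p V)" for y
      using add_map_zero[OF coinv_group[OF V] G_group[OF V] c1_add_map[OF V]] y
      by (simp add: R'_apply[OF V c1_closed[OF V y]] p0)
  qed
  interpret UM: module R U by (rule U_module)
  show "\<zero>\<^bsub>R'\<^esub> U e = lift U (\<zero> \<odot>\<^bsub>U\<^esub> u) \<oplus>\<^bsub>G U\<^esub> \<iota> \<zero> U u"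
    using u_closed z[OF U_proj]
    by (simp add: R'_apply[OF U_proj e(1)] \<iota>_zero_left[OF U_proj u_closed] lift_zero[OF U_proj])
qed

lemma witt_cocycle_zero: "s \<in> carrier R \<Longrightarrow> witt_cocycle \<zero> s = \<zero>"
  unfolding witt_cocycle_def
  by (rule add.finprod_one_eqI) (auto simp: nat_pow_zero)

lemma sqz_i_elt:
  assumes m: "m \<in> carrier R"
  shows "sqz_i R E C01 c1 c0 m = elt \<zero> m"
proof (rule elt_eqI[OF zero_closed m])
  have eq: "sqz_i R E C01 c1 c0 m = (\<lambda>V\<in>\<P>. \<lambda>x\<in>carrier (G V). \<iota> m V (\<alpha> V x))"
    unfolding sqz_i_def by (auto simp: fun_eq_iff amap_eq c0_closed)
  show "sqz_i R E C01 c1 c0 m \<in> nat_trans R C01 C01"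
    unfolding eq
  proof (rule nat_transI)
    show "add_map (G V) (G V) (\<lambda>x. \<iota> m V (\<alpha> V x))" if V: "V \<in> \<P>" for V
      using \<iota>_add_map[OF V m] \<alpha>_add_map[OF V] by (auto simp: add_map_def Pi_def)
    show "\<iota> m W (\<alpha> W (arr C01 V W f x)) = arr C01 V W f (\<iota> m V (\<alpha> V x))"
      if "V \<in> \<P>" "W \<in> \<P>" "f \<in> lin_hom R V W" "x \<in> carrier (G V)" for V W f x
      using that by (simp add: \<iota>_natural m \<alpha>_closed c0_natural)
  qed
  show "over (sqz_i R E C01 c1 c0 m) \<zero>"
    unfolding over_iff
  proof (intro ballI conjI)
    fix V assume V: "V \<in> \<P>"
    have VM: "module R V" by (rule proj_module[OF V])
    interpret VM: module R V by (rule VM)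
    interpret T: module R "tpower R p V" by (rule module_tpower[OF VM])
    interpret C: module R "coinv R p V" by (rule module_coinv[OF VM])
    have p0: "\<zero> [^] p = \<zero>" using p_pos by (simp add: nat_pow_zero)
    show "\<tau> V (sqz_i R E C01 c1 c0 m V x) = (\<zero> [^] p) \<odot>\<^bsub>tpower R p V\<^esub> \<tau> V x"
      "\<alpha> V (sqz_i R E C01 c1 c0 m V x) = \<zero> \<odot>\<^bsub>V\<^esub> \<alpha> V x" if x: "x \<in> carrier (G V)" for x
      using V x \<iota>_kernel[OF V m \<alpha>_closed[OF V x]] \<tau>_closed[OF V x] \<alpha>_closed[OF V x]
      by (simp_all add: eq p0)
    show "sqz_i R E C01 c1 c0 m V (c1 V y) = c1 V ((\<zero> [^] p) \<odot>\<^bsub>coinv R p V\<^esub> y)"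
      if y: "y \<in> carrier (coinv R p V)" for y
      using add_map_zero[OF coinv_group[OF V] G_group[OF V] c1_add_map[OF V]] y V
      by (simp add: eq c1_closed[OF V y] c0_c1[OF V y] \<iota>_zero_right[OF V m] p0)
  qed
  interpret UM: module R U by (rule U_module)
  interpret GU: abelian_group "G U" by (rule G_group[OF U_proj])
  show "sqz_i R E C01 c1 c0 m U e = lift U (\<zero> \<odot>\<^bsub>U\<^esub> u) \<oplus>\<^bsub>G U\<^esub> \<iota> m U u"
    using u_closed U_proj e \<iota>_closed[OF U_proj m u_closed] by (simp add: eq lift_zero[OF U_proj])
qed

lemma R'_carrier: "t \<in> carrier R' \<Longrightarrow> t \<in> nat_trans R C01 C01"
  by (simp add: sqz_ring_def)

lemma R'_closed:
  assumes "s \<in> carrier R'" "t \<in> carrier R'"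
  shows "s \<oplus>\<^bsub>R'\<^esub> t \<in> carrier R'" "s \<otimes>\<^bsub>R'\<^esub> t \<in> carrier R'"
proof -
  obtain r m r' m' where "r \<in> carrier R" "m \<in> carrier R" "r' \<in> carrier R" "m' \<in> carrier R"
    "s = elt r m" "t = elt r' m'"
    using elt_surj assms by metis
  then show "s \<oplus>\<^bsub>R'\<^esub> t \<in> carrier R'" "s \<otimes>\<^bsub>R'\<^esub> t \<in> carrier R'"
    by (auto simp: elt_add elt_mult witt_cocycle_closed intro!: elt_carrier)
qed

lemma R'_ext:
  assumes "s \<in> carrier R'" "t \<in> carrier R'" "\<And>V x. V \<in> \<P> \<Longrightarrow> x \<in> carrier (G V) \<Longrightarrow> s V x = t V x"
  shows "s = t"
  by (rule nat_trans_ext[OF R'_carrier R'_carrier]) (use assms in auto)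

lemma R'_maps: "t \<in> carrier R' \<Longrightarrow> V \<in> \<P> \<Longrightarrow> x \<in> carrier (G V) \<Longrightarrow> t V x \<in> carrier (G V)"
  by (rule add_map_closed[OF nat_trans_add_map[OF R'_carrier]])

text \<open>
  The ring laws hold for endomorphisms of any functor. Closure and the existence of negatives are seen
  in the coordinates \<open>(r, m)\<close>. For \<open>p = 2\<close> the negative of \<open>(r, m)\<close> is not \<open>(- r, - m)\<close>, which is why the
  cocycle occurs in it.
\<close>

lemma R'_ring: "ring R'"
proof -
  have one: "\<one>\<^bsub>R'\<^esub> \<in> carrier R'" by (simp add: elt_one elt_carrier)
  have zero: "\<zero>\<^bsub>R'\<^esub> \<in> carrier R'" by (simp add: elt_zero elt_carrier)
  have G: "\<And>V. V \<in> \<P> \<Longrightarrow> abelian_monoid (G V)" using G_group abelian_group.axioms(1) by blast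
  show ?thesis
  proof (rule ringI)
    show "abelian_group R'"
    proof (rule abelian_groupI)
      fix s t v assume s: "s \<in> carrier R'" and t: "t \<in> carrier R'" and v: "v \<in> carrier R'"
      show "s \<oplus>\<^bsub>R'\<^esub> t \<oplus>\<^bsub>R'\<^esub> v = s \<oplus>\<^bsub>R'\<^esub> (t \<oplus>\<^bsub>R'\<^esub> v)"
        by (rule R'_ext) (use s t v in \<open>auto simp: R'_closed R'_apply R'_maps abelian_monoid.a_assoc[OF G]\<close>)
      show "s \<oplus>\<^bsub>R'\<^esub> t = t \<oplus>\<^bsub>R'\<^esub> s"
        by (rule R'_ext) (use s t in \<open>auto simp: R'_closed R'_apply R'_maps abelian_monoid.a_comm[OF G]\<close>)
    next
      fix s assume s: "s \<in> carrier R'"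
      show "\<zero>\<^bsub>R'\<^esub> \<oplus>\<^bsub>R'\<^esub> s = s"
        by (rule R'_ext) (use s zero in \<open>auto simp: R'_closed R'_apply R'_maps abelian_monoid.l_zero[OF G]\<close>)
      obtain r m where rm: "r \<in> carrier R" "m \<in> carrier R" "s = elt r m" using elt_surj[OF s] by blast
      let ?n = "witt_cocycle (\<ominus> r) r \<ominus> m"
      have w: "witt_cocycle (\<ominus> r) r \<in> carrier R" using rm by (simp add: witt_cocycle_closed)
      have "(?n \<oplus> m) \<ominus> witt_cocycle (\<ominus> r) r = \<zero>"
        using w rm by (simp add: minus_eq a_assoc l_neg r_neg)
      then have "elt (\<ominus> r) ?n \<oplus>\<^bsub>R'\<^esub> s = \<zero>\<^bsub>R'\<^esub>"
        using rm w by (simp add: elt_add elt_zero l_neg)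
      then show "\<exists>t\<in>carrier R'. t \<oplus>\<^bsub>R'\<^esub> s = \<zero>\<^bsub>R'\<^esub>"
        using rm w by (intro bexI[of _ "elt (\<ominus> r) ?n"] elt_carrier) auto
    qed (auto simp: R'_closed zero)
    show "monoid R'"
    proof (rule monoidI)
      fix s t v assume s: "s \<in> carrier R'" and t: "t \<in> carrier R'" and v: "v \<in> carrier R'"
      show "s \<otimes>\<^bsub>R'\<^esub> t \<otimes>\<^bsub>R'\<^esub> v = s \<otimes>\<^bsub>R'\<^esub> (t \<otimes>\<^bsub>R'\<^esub> v)"
        by (rule R'_ext) (use s t v in \<open>auto simp: R'_closed R'_apply R'_maps\<close>)
    next
      fix s assume s: "s \<in> carrier R'"
      show "\<one>\<^bsub>R'\<^esub> \<otimes>\<^bsub>R'\<^esub> s = s" "s \<otimes>\<^bsub>R'\<^esub> \<one>\<^bsub>R'\<^esub> = s"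
        by (rule R'_ext; use s one in \<open>auto simp: R'_closed R'_apply R'_maps\<close>)+
    qed (auto simp: R'_closed one)
    fix s t v assume s: "s \<in> carrier R'" and t: "t \<in> carrier R'" and v: "v \<in> carrier R'"
    show "(s \<oplus>\<^bsub>R'\<^esub> t) \<otimes>\<^bsub>R'\<^esub> v = s \<otimes>\<^bsub>R'\<^esub> v \<oplus>\<^bsub>R'\<^esub> t \<otimes>\<^bsub>R'\<^esub> v"
      by (rule R'_ext) (use s t v in \<open>auto simp: R'_closed R'_apply R'_maps\<close>)
    show "v \<otimes>\<^bsub>R'\<^esub> (s \<oplus>\<^bsub>R'\<^esub> t) = v \<otimes>\<^bsub>R'\<^esub> s \<oplus>\<^bsub>R'\<^esub> v \<otimes>\<^bsub>R'\<^esub> t"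
      by (rule R'_ext)
        (use s t v in \<open>auto simp: R'_closed R'_apply R'_maps add_map_add[OF nat_trans_add_map[OF R'_carrier]]\<close>)
  qed
qed

abbreviation "qq \<equiv> sqz_q R E C01 c1 c0"
abbreviation "ii \<equiv> sqz_i R E C01 c1 c0"

lemma square_zero: "square_zero_extension R (R1 R p) R' ii qq"
proof -
  have z: "\<zero> [^] p = \<zero>" using p_pos by (simp add: nat_pow_zero)
  have i_closed: "ii m \<in> carrier R'" if "m \<in> carrier R" for m
    using that by (simp add: sqz_i_elt elt_carrier)
  have "ii \<in> hom (add_monoid (R1 R p)) (add_monoid R')"
    by (rule homI)
      (auto simp: elt_carrier sqz_i_elt elt_add witt_cocycle_zero minus_eq)
  moreover have "qq \<in> ring_hom R' R"
  proof (rule ring_hom_memI)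
    fix s t assume "s \<in> carrier R'" "t \<in> carrier R'"
    then obtain r m r' m' where "r \<in> carrier R" "m \<in> carrier R" "r' \<in> carrier R" "m' \<in> carrier R"
      "s = elt r m" "t = elt r' m'"
      using elt_surj by metis
    then show "qq (s \<otimes>\<^bsub>R'\<^esub> t) = qq s \<otimes> qq t" "qq (s \<oplus>\<^bsub>R'\<^esub> t) = qq s \<oplus> qq t"
      by (simp_all add: elt_add elt_mult elt_q witt_cocycle_closed)
  next
    fix s assume "s \<in> carrier R'"
    then show "qq s \<in> carrier R" using elt_surj elt_q by metis
  qed (simp add: elt_one elt_q)
  moreover have "inj_on ii (carrier R)"
    using elt_inject[OF zero_closed _ zero_closed] by (intro inj_onI) (simp add: sqz_i_elt)
  moreover have "a_kernel R' R qq = ii ` carrier R"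
  proof
    show "a_kernel R' R qq \<subseteq> ii ` carrier R"
    proof
      fix t assume "t \<in> a_kernel R' R qq"
      then have t: "t \<in> carrier R'" "qq t = \<zero>" by (auto simp: a_kernel_def')
      obtain r m where rm: "r \<in> carrier R" "m \<in> carrier R" "t = elt r m" using elt_surj[OF t(1)] by blast
      then have "r = \<zero>" using t(2) elt_q by simp
      then show "t \<in> ii ` carrier R" using rm sqz_i_elt by (intro image_eqI[of _ _ m]) auto
    qed
    show "ii ` carrier R \<subseteq> a_kernel R' R qq"
      using i_closed by (auto simp: a_kernel_def' sqz_i_elt elt_q)
  qed
  moreover have "qq ` carrier R' = carrier R"
  proof
    show "qq ` carrier R' \<subseteq> carrier R" using elt_surj elt_q by fastforce
    show "carrier R \<subseteq> qq ` carrier R'"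
    proof
      fix r assume "r \<in> carrier R"
      then show "r \<in> qq ` carrier R'"
        using elt_q[of r \<zero>] elt_carrier[of r \<zero>] by (intro image_eqI[of _ _ "elt r \<zero>"]) auto
    qed
  qed
  moreover have "ii m \<otimes>\<^bsub>R'\<^esub> x = ii (qq x \<odot>\<^bsub>R1 R p\<^esub> m) \<and> x \<otimes>\<^bsub>R'\<^esub> ii m = ii (qq x \<odot>\<^bsub>R1 R p\<^esub> m)"
    if m: "m \<in> carrier R" and x: "x \<in> carrier R'" for m x
  proof -
    obtain r n where "r \<in> carrier R" "n \<in> carrier R" "x = elt r n" using elt_surj[OF x] by blast
    then show ?thesis using m by (simp add: sqz_i_elt elt_mult elt_q z)
  qed
  moreover have "ii m \<otimes>\<^bsub>R'\<^esub> ii n = \<zero>\<^bsub>R'\<^esub>" if "m \<in> carrier R" "n \<in> carrier R" for m n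
    using that by (simp add: sqz_i_elt elt_mult elt_zero z)
  ultimately show ?thesis
    unfolding square_zero_extension_def by (simp add: R'_ring)
qed

definition coords :: "(('a, 'v) module \<Rightarrow> 'c \<Rightarrow> 'c) \<Rightarrow> 'a \<times> 'a" where
  "coords = inv_into (carrier R \<times> carrier R) (\<lambda>(r, m). elt r m)"

lemma bij_elt: "bij_betw (\<lambda>(r, m). elt r m) (carrier R \<times> carrier R) (carrier R')"
proof (rule bij_betw_imageI)
  show "inj_on (\<lambda>(r, m). elt r m) (carrier R \<times> carrier R)"
    using elt_inject by (auto simp: inj_on_def)
  show "(\<lambda>(r, m). elt r m) ` (carrier R \<times> carrier R) = carrier R'"
    using elt_carrier elt_surj by fastforce
qed

lemma coords_elt: "r \<in> carrier R \<Longrightarrow> m \<in> carrier R \<Longrightarrow> coords (elt r m) = (r, m)"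
  unfolding coords_def using inv_into_f_f[OF bij_betw_imp_inj_on[OF bij_elt], of "(r, m)"] by simp

lemma coords_ring_iso: "coords \<in> ring_iso R' (witt2 R p)"
proof -
  have "coords \<in> ring_hom R' (witt2 R p)"
  proof (rule ring_hom_memI)
    fix s t assume "s \<in> carrier R'" "t \<in> carrier R'"
    then obtain r m r' m' where rm: "r \<in> carrier R" "m \<in> carrier R" "r' \<in> carrier R" "m' \<in> carrier R"
      "s = elt r m" "t = elt r' m'"
      using elt_surj by metis
    then have "[p] \<cdot> (m \<otimes> m') = \<zero>" using char by simp
    then show "coords (s \<otimes>\<^bsub>R'\<^esub> t) = coords s \<otimes>\<^bsub>witt2 R p\<^esub> coords t"
      using rm by (simp add: elt_mult coords_elt witt2_def)
    show "coords (s \<oplus>\<^bsub>R'\<^esub> t) = coords s \<oplus>\<^bsub>witt2 R p\<^esub> coords t"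
      using rm by (simp add: elt_add coords_elt witt_cocycle_closed) (simp add: witt2_def witt_cocycle_def)
  next
    fix s assume "s \<in> carrier R'"
    then obtain r m where "r \<in> carrier R" "m \<in> carrier R" "s = elt r m" using elt_surj by metis
    then show "coords s \<in> carrier (witt2 R p)" by (simp add: coords_elt witt2_def)
  qed (simp add: elt_one coords_elt witt2_def)
  moreover have "bij_betw coords (carrier R') (carrier (witt2 R p))"
    using bij_betw_inv_into[OF bij_elt] by (simp add: coords_def witt2_def)
  ultimately show ?thesis by (simp add: ring_iso_def)
qed

end

theorem proposition6p3:
  fixes R :: "('a, 'k) ring_scheme" and p :: nat
    and C01 :: "('a, 'v, ('c, 'x) ring_scheme, 'c) proj_functor"
    and c1 :: "('a, 'v) module \<Rightarrow> ('v list \<Rightarrow> 'a) set set \<Rightarrow> 'c"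
    and c0 :: "('a, 'v) module \<Rightarrow> 'c \<Rightarrow> ('v list \<Rightarrow> 'a) set \<times> 'v"
  assumes "cring R"
    and "prime p"
    and "\<And>x. x \<in> carrier R \<Longrightarrow> [p] \<cdot>\<^bsub>R\<^esub> x = \<zero>\<^bsub>R\<^esub>"
    and "\<exists>e :: 'a list \<Rightarrow> 'v. inj_on e (lists (carrier R))"
    and "splitting R (cyclic_powers_ext R p) C01 c1 c0"
  shows "let R' = sqz_ring R (cyclic_powers_ext R p) C01 c1 c0;
             i = sqz_i R (cyclic_powers_ext R p) C01 c1 c0;
             q = sqz_q R (cyclic_powers_ext R p) C01 c1 c0
         in square_zero_extension R (R1 R p) R' i q \<and>
            (\<exists>\<phi> \<in> ring_iso R' (witt2 R p).
               (\<forall>m \<in> carrier (R1 R p). \<phi> (i m) = (\<zero>\<^bsub>R\<^esub>, m)) \<and>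
               (\<forall>r' \<in> carrier R'. fst (\<phi> r') = q r'))"
proof -
  obtain code :: "'a list \<Rightarrow> 'v" where code: "inj_on code (lists (carrier R))" using assms(4) by blast
  have char: "cring_char R p"
    by (rule cring_char.intro[OF assms(1)], rule cring_char_axioms.intro) (use assms(2,3) in auto)
  interpret cyc_splitting R p code C01 c1 c0
    by (rule cyc_splitting.intro[OF char], rule cyc_splitting_axioms.intro) (use code assms(5) in auto)
  have "coords (ii m) = (\<zero>\<^bsub>R\<^esub>, m)" if "m \<in> carrier R" for m
    using that by (simp add: sqz_i_elt coords_elt)
  moreover have "fst (coords t) = qq t" if t: "t \<in> carrier R'" for t
  proof -
    obtain r m where "r \<in> carrier R" "m \<in> carrier R" "t = elt r m" using elt_surj[OF t] by blast
    then show ?thesis by (simp add: coords_elt elt_q)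
  qed
  ultimately show ?thesis
    using square_zero coords_ring_iso by (auto simp: Let_def)
qed

end
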